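(* Let $(\mathfrak g,z)$ be a standard simple Lie algebra of hermitian type and real rank $r$ (one of $\mathfrak{sp}(r,\mathbb R)$; $\mathfrak{su}(p,q)$ with $p\ge q=r$; $\mathfrak{so}^*(2n)$ with $r=[\frac n2]$). For $1\le s\le r$, the holomorphic nilpotent orbit $\mathcal O_s$ is the (connected) smooth manifold of non-negative rank $s$ nilpotent matrices in $\mathfrak g$ (real rank $s$ for $\mathfrak{sp}(r,\mathbb R)$; complex rank $s$ for $\mathfrak{su}(p,q)$; quaternionic rank $s$ for $\mathfrak{so}^*(2n)$). Furthermore, as a real semi-algebraic set in $\mathfrak g$, the closure $\overline{\mathcal O_s}$ is the space of non-negative nilpotent matrices in $\mathfrak g$ which have rank at most $s$.
   Context: Standard Lie algebras. Let $\mathbb K=\mathbb R,\mathbb C,\mathbb H$, and $V=\mathbb K^n$ as a right $\mathbb K$-vector space with hermitian form $(x,y)=\sum\overline{x_j}y_j$. Let $J_V\in\mathrm{End}_{\mathbb K}(V)$ be: for $\mathbb K=\mathbb R$, $n=2\ell$: $J_V=\begin{pmatrix} 0 & -I_\ell \\ I_\ell & 0 \end{pmatrix}$; for $\mathbb K=\mathbb C$, $n=p+q$, $p\ge q\ge1$: $J_V=i\,\mathrm{diag}(I_p,-I_q)$; for $\mathbb K=\mathbb H$: $J_V$ is left multiplication by a fixed imaginary unit quaternion $\mathcal J$ on $\mathbb H^n$, $n>2$. Put $\mathcal B(u,v)=(J_Vu,v)$ (skew-hermitian) and $\mathfrak u(V,\mathcal B)=\{X\in\mathrm{End}_{\mathbb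 K}(V):\mathcal B(Xv,w)+\mathcal B(v,Xw)=0\}$. Then $\mathfrak g=\mathfrak{sp}(\ell,\mathbb R)$, $\mathfrak g=\mathfrak{su}(p,q)$ (trace zero part of $\mathfrak u(V,\mathcal B)=\mathfrak u(p,q)$), $\mathfrak g=\mathfrak{so}^*(2n)$, respectively, with $z=\frac12J_V$ (respectively its component in $\mathfrak{su}(p,q)$). The Cartan decomposition is $\mathfrak g=\mathfrak k\oplus\mathfrak p$ with $\mathfrak k=\ker\mathrm{ad}(z)$, $\mathfrak p=[z,\mathfrak g]$. $G$ is the adjoint group. An element $X\in\mathfrak g$ is nilpotent if $\mathrm{ad}(X)$ is nilpotent, and non-negative if the hermitian form $\mathcal B_X(v,w)=-\mathcal B(Xv,w)$ on $V$ is positive semidefinite. The rank of $X$ is its rank as a $\mathbb K$-linear endomorphism of $V$. Orbits $\mathcal O_s$: an $H_1$-triple is $(e,f,h)$ in $\mathfrak g$ with $[h,e]=2e$, $[h,f]=-2f$, $[e,f]=h$, $e-f\in\mathfrak k$, $e+f,h\in\mathfrak p$, $[z,e+f]=h$, $[z,h]=-(e+f)$. A choice of maximal abelian subalgebra $\mathfrak a_{\mathfrak p}\subseteq\mathfrak p$ (of dimension $r$) determines $r$ pairwise commuting $H_1$-triples $(e_j,f_j,h_j)$ such that $h_1,\dots,h_r$ is a basis of $\mathfrak a_{\mathfrak p}$ and, with dual basis $\xi_j$, the relative root system is $\{\pm\xi_j\pm\xi_k\,(j\ne k),\pm2\xi_j\}$, possibly together with $\{\pm\xi_j\}$. Then $\mathcal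 O_s=G(e_1+\dots+e_s)$; these are precisely the non-zero holomorphic nilpotent orbits of $(\mathfrak g,z)$. *)

theory Defs
  imports "HOL-Analysis.Analysis"
begin

section \<open>Quaternions\<close>

datatype quat = Quat (qre: real) (qi: real) (qj: real) (qk: real)

lemma quat_eq_iff: "x = y \<longleftrightarrow> qre x = qre y \<and> qi x = qi y \<and> qj x = qj y \<and> qk x = qk y"
  by (cases x; cases y) simp

instantiation quat :: ring_1
begin

definition "0 = Quat 0 0 0 0"
definition "1 = Quat 1 0 0 0"
definition "x + y = Quat (qre x + qre y) (qi x + qi y) (qj x + qj y) (qk x + qk y)"
definition "- x = Quat (- qre x) (- qi x) (- qj x) (- qk x)"
definition "x - y = Quat (qre x - qre y) (qi x - qi y) (qj x - qj y) (qk x - qk y)"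
definition "x * y = Quat
  (qre x * qre y - qi x * qi y - qj x * qj y - qk x * qk y)
  (qre x * qi y + qi x * qre y + qj x * qk y - qk x * qj y)
  (qre x * qj y - qi x * qk y + qj x * qre y + qk x * qi y)
  (qre x * qk y + qi x * qj y - qj x * qi y + qk x * qre y)"

lemmas quat_ring_defs = zero_quat_def one_quat_def plus_quat_def uminus_quat_def
  minus_quat_def times_quat_def

instance
  by standard (simp_all add: quat_ring_defs quat_eq_iff algebra_simps)

end

instantiation quat :: real_algebra_1
begin

definition "a *\<^sub>R x = Quat (a * qre x) (a * qi x) (a * qj x) (a * qk x)"

instance
  by standard (simp_all add: quat_ring_defs scaleR_quat_def quat_eq_iff algebra_simps)

end

instantiation quat :: real_inner
begin

definition "inner x y = qre x * qre y + qi x * qi y + qj x * qj y + qk x * qk y"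
definition "norm x = sqrt (inner x (x::quat))"
definition "sgn x = x /\<^sub>R norm (x::quat)"
definition "dist x y = norm (x - y :: quat)"
definition [code del]:
  "(uniformity :: (quat \<times> quat) filter) = (INF e\<in>{0 <..}. principal {(x, y). dist x y < e})"
definition [code del]:
  "open (U :: quat set) \<longleftrightarrow> (\<forall>x\<in>U. eventually (\<lambda>(x', y). x' = x \<longrightarrow> y \<in> U) uniformity)"

instance
proof
  fix x :: quat
  show "inner x x = 0 \<longleftrightarrow> x = 0"
    by (auto simp: inner_quat_def quat_eq_iff zero_quat_def add_nonneg_eq_0_iff)
qed (simp_all add: quat_ring_defs scaleR_quat_def inner_quat_def norm_quat_def sgn_quat_def
      dist_quat_def uniformity_quat_def open_quat_def quat_eq_iff algebra_simps)

end

lemma norm_quat_mult: "norm (x * y) = norm x * norm (y :: quat)"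
proof -
  have "inner (x * y) (x * y) = inner x x * inner y y"
    by (simp add: inner_quat_def times_quat_def algebra_simps)
  then show ?thesis
    by (simp add: norm_quat_def real_sqrt_mult)
qed

class conjugation =
  fixes cj :: "'a \<Rightarrow> 'a"

instantiation real :: conjugation
begin
definition cj_real :: "real \<Rightarrow> real" where "cj_real x = x"
instance ..
end

instantiation complex :: conjugation
begin
definition cj_complex :: "complex \<Rightarrow> complex" where "cj_complex x = cnj x"
instance ..
end

instantiation quat :: conjugation
begin
definition cj_quat :: "quat \<Rightarrow> quat" where "cj_quat x = Quat (qre x) (- qi x) (- qj x) (- qk x)"
instance ..
end

instantiation quat :: real_normed_div_algebra
begin

definition "inverse x = cj (x::quat) /\<^sub>R inner x x"
definition "x div y = x * inverse (y::quat)"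

instance
proof
  fix x y :: quat
  have "x * cj x = inner x x *\<^sub>R 1" "cj x * x = inner x x *\<^sub>R 1"
    by (simp_all add: cj_quat_def inner_quat_def times_quat_def scaleR_quat_def
        one_quat_def quat_eq_iff)
  then show "inverse x * x = 1" "x * inverse x = 1" if "x \<noteq> 0"
    using that by (simp_all add: inverse_quat_def)
  show "x div y = x * inverse y"
    by (rule divide_quat_def)
  show "inverse (0::quat) = 0"
    by (simp add: inverse_quat_def cj_quat_def scaleR_quat_def zero_quat_def)
  show "norm (x * y) = norm x * norm y"
    by (rule norm_quat_mult)
qed

end

instantiation quat :: euclidean_space
begin

definition "Basis = {Quat 1 0 0 0, Quat 0 1 0 0, Quat 0 0 1 0, Quat 0 0 0 1}"

instance
proof
  fix u v :: quat
  assume "u \<in> Basis" "v \<in> Basis"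
  then show "inner u v = (if u = v then 1 else 0)"
    unfolding Basis_quat_def by (elim insertE emptyE) (simp_all add: inner_quat_def)
next
  fix x :: quat
  show "(\<forall>u\<in>Basis. inner x u = 0) \<longleftrightarrow> x = 0"
    by (cases x) (auto simp: Basis_quat_def inner_quat_def zero_quat_def)
qed (simp_all add: Basis_quat_def)

end


section \<open>Rank over the quaternions\<close>

text \<open>Column vectors form a right vector space, and a matrix acts on them from the left by
  \<^term>\<open>(*v)\<close>. The dimension theory of the library only covers left vector spaces over fields.\<close>

definition rscale :: "quat ^ 'n \<Rightarrow> quat \<Rightarrow> quat ^ 'n" where
  "rscale v c = (\<chi> i. v $ i * c)"

definition right_independent :: "(quat ^ 'n) set \<Rightarrow> bool" where
  "right_independent B \<longleftrightarrow> finite B \<and>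
     (\<forall>c. (\<Sum>v\<in>B. rscale v (c v)) = 0 \<longrightarrow> (\<forall>v\<in>B. c v = 0))"

definition right_span :: "(quat ^ 'n) set \<Rightarrow> (quat ^ 'n) set" where
  "right_span B = {(\<Sum>v\<in>A. rscale v (c v)) | A c. finite A \<and> A \<subseteq> B}"

definition right_dim :: "(quat ^ 'n) set \<Rightarrow> nat" where
  "right_dim W = card (SOME B. right_independent B \<and> right_span B = W)"

definition quat_rank :: "quat ^ 'n ^ 'n \<Rightarrow> nat" where
  "quat_rank X = right_dim (range (\<lambda>v. X *v v))"


section \<open>The standard Lie algebras\<close>

definition herm_form :: "'k::{conjugation,semiring_1} ^ 'n \<Rightarrow> 'k ^ 'n \<Rightarrow> 'k" where
  "herm_form x y = (\<Sum>j\<in>UNIV. cj (x $ j) * y $ j)"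

definition \<B> :: "'k::{conjugation,semiring_1} ^ 'n ^ 'n \<Rightarrow> 'k ^ 'n \<Rightarrow> 'k ^ 'n \<Rightarrow> 'k" where
  "\<B> J u v = herm_form (J *v u) v"

definition u_alg :: "'k::{conjugation,semiring_1} ^ 'n ^ 'n \<Rightarrow> ('k ^ 'n ^ 'n) set" where
  "u_alg J = {X. \<forall>v w. \<B> J (X *v v) w + \<B> J v (X *v w) = 0}"

definition J_sp :: "real ^ ('l::finite + 'l) ^ ('l + 'l)" where
  "J_sp = (\<chi> i j. case (i, j) of
       (Inl a, Inr b) \<Rightarrow> if a = b then - 1 else 0
     | (Inr a, Inl b) \<Rightarrow> if a = b then 1 else 0
     | _ \<Rightarrow> 0)"

definition J_su :: "complex ^ ('p::finite + 'q::finite) ^ ('p + 'q)" where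
  "J_su = (\<chi> i j. if i = j then (case i of Inl _ \<Rightarrow> \<i> | Inr _ \<Rightarrow> - \<i>) else 0)"

text \<open>\<^term>\<open>mat c\<close> acts on column vectors as left multiplication by \<open>c\<close>.\<close>

definition J_so :: "quat \<Rightarrow> quat ^ 'n ^ 'n" where
  "J_so c = mat c"

definition sp_alg :: "(real ^ ('l::finite + 'l) ^ ('l + 'l)) set" where
  "sp_alg = u_alg J_sp"

definition su_alg :: "(complex ^ ('p::finite + 'q::finite) ^ ('p + 'q)) set" where
  "su_alg = {X \<in> u_alg J_su. trace X = 0}"

definition so_star_alg :: "quat \<Rightarrow> (quat ^ 'n ^ 'n) set" where
  "so_star_alg c = u_alg (J_so c)"

definition z_sp :: "real ^ ('l::finite + 'l) ^ ('l + 'l)" where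
  "z_sp = (1/2) *\<^sub>R J_sp"

text \<open>The component of \<open>J_su / 2\<close> in the trace zero part of \<open>u_alg J_su\<close>; the complementary ideal
  consists of the imaginary multiples of the identity.\<close>

definition z_su :: "complex ^ ('p::finite + 'q::finite) ^ ('p + 'q)" where
  "z_su = (1/2) *\<^sub>R (J_su - mat (trace (J_su :: complex ^ ('p::finite + 'q::finite) ^ ('p + 'q)) / of_nat CARD('p + 'q)))"

definition z_so :: "quat \<Rightarrow> quat ^ 'n ^ 'n" where
  "z_so c = (1/2) *\<^sub>R J_so c"


section \<open>Lie-theoretic notions\<close>

definition lie :: "'k::ring_1 ^ 'n ^ 'n \<Rightarrow> 'k ^ 'n ^ 'n \<Rightarrow> 'k ^ 'n ^ 'n" where
  "lie X Y = X ** Y - Y ** X"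

definition lie_nilpotent :: "('k::ring_1 ^ 'n ^ 'n) set \<Rightarrow> 'k ^ 'n ^ 'n \<Rightarrow> bool" where
  "lie_nilpotent \<gg> X \<longleftrightarrow> X \<in> \<gg> \<and> (\<exists>m. \<forall>Y\<in>\<gg>. (lie X ^^ m) Y = 0)"

definition \<B>_form :: "'k::{conjugation,ring_1} ^ 'n ^ 'n \<Rightarrow> 'k ^ 'n ^ 'n \<Rightarrow> 'k ^ 'n \<Rightarrow> 'k ^ 'n \<Rightarrow> 'k" where
  "\<B>_form J X v w = - \<B> J (X *v v) w"

definition non_negative :: "'k::{conjugation,real_algebra_1} ^ 'n ^ 'n \<Rightarrow> 'k ^ 'n ^ 'n \<Rightarrow> bool" where
  "non_negative J X \<longleftrightarrow>
     (\<forall>v w. \<B>_form J X w v = cj (\<B>_form J X v w)) \<and>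
     (\<forall>v. \<exists>t::real. t \<ge> 0 \<and> \<B>_form J X v v = of_real t)"

definition k_part :: "('k::ring_1 ^ 'n ^ 'n) set \<Rightarrow> 'k ^ 'n ^ 'n \<Rightarrow> ('k ^ 'n ^ 'n) set" where
  "k_part \<gg> z = {X \<in> \<gg>. lie z X = 0}"

definition p_part :: "('k::ring_1 ^ 'n ^ 'n) set \<Rightarrow> 'k ^ 'n ^ 'n \<Rightarrow> ('k ^ 'n ^ 'n) set" where
  "p_part \<gg> z = lie z ` \<gg>"

definition exp_ad :: "'k::real_normed_div_algebra ^ 'n ^ 'n \<Rightarrow> 'k ^ 'n ^ 'n \<Rightarrow> 'k ^ 'n ^ 'n" where
  "exp_ad Y X = (\<Sum>m. (lie Y ^^ m) X /\<^sub>R fact m)"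

text \<open>The connected subgroup of \<open>GL(\<gg>)\<close> with Lie algebra \<open>ad \<gg>\<close>. Its elements are written as maps
  on the whole matrix space, but only their restrictions to \<open>\<gg>\<close> are relevant. Closure under
  inverses is automatic since \<open>exp_ad (- Y)\<close> is inverse to \<open>exp_ad Y\<close>.\<close>

inductive_set adjoint_group ::
    "('k::real_normed_div_algebra ^ 'n ^ 'n) set \<Rightarrow> ('k ^ 'n ^ 'n \<Rightarrow> 'k ^ 'n ^ 'n) set"
  for \<gg> where
  "id \<in> adjoint_group \<gg>"
| "Y \<in> \<gg> \<Longrightarrow> \<phi> \<in> adjoint_group \<gg> \<Longrightarrow> exp_ad Y \<circ> \<phi> \<in> adjoint_group \<gg>"

definition H1_triple ::
    "('k::real_algebra_1 ^ 'n ^ 'n) set \<Rightarrow> 'k ^ 'n ^ 'n \<Rightarrow> 'k ^ 'n ^ 'n \<Rightarrow> 'k ^ 'n ^ 'n \<Rightarrow> 'k ^ 'n ^ 'n \<Rightarrow> bool"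
  where
  "H1_triple \<gg> z e f h \<longleftrightarrow>
     e \<in> \<gg> \<and> f \<in> \<gg> \<and> h \<in> \<gg> \<and>
     lie h e = 2 *\<^sub>R e \<and> lie h f = (- 2) *\<^sub>R f \<and> lie e f = h \<and>
     e - f \<in> k_part \<gg> z \<and> e + f \<in> p_part \<gg> z \<and> h \<in> p_part \<gg> z \<and>
     lie z (e + f) = h \<and> lie z h = - (e + f)"

definition abelian_in :: "('k::real_algebra_1 ^ 'n ^ 'n) set \<Rightarrow> ('k ^ 'n ^ 'n) set \<Rightarrow> bool" where
  "abelian_in \<pp> \<aa> \<longleftrightarrow> subspace \<aa> \<and> \<aa> \<subseteq> \<pp> \<and> (\<forall>X\<in>\<aa>. \<forall>Y\<in>\<aa>. lie X Y = 0)"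

definition maximal_abelian_in :: "('k::real_algebra_1 ^ 'n ^ 'n) set \<Rightarrow> ('k ^ 'n ^ 'n) set \<Rightarrow> bool" where
  "maximal_abelian_in \<pp> \<aa> \<longleftrightarrow>
     abelian_in \<pp> \<aa> \<and> (\<forall>\<bb>. abelian_in \<pp> \<bb> \<and> \<aa> \<subseteq> \<bb> \<longrightarrow> \<bb> = \<aa>)"

text \<open>Elements of the dual of \<open>\<aa>\<close> are represented as restrictions to \<open>\<aa>\<close> of linear functionals on the
  matrix space.\<close>

definition relative_roots ::
    "('k::real_algebra_1 ^ 'n ^ 'n) set \<Rightarrow> ('k ^ 'n ^ 'n) set \<Rightarrow> ('k ^ 'n ^ 'n \<Rightarrow> real) set" where
  "relative_roots \<gg> \<aa> = {restrict \<alpha> \<aa> | \<alpha>. linear \<alpha> \<and> (\<exists>H\<in>\<aa>. \<alpha> H \<noteq> 0) \<and>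
     (\<exists>X\<in>\<gg>. X \<noteq> 0 \<and> (\<forall>H\<in>\<aa>. lie H X = \<alpha> H *\<^sub>R X))}"

definition H1_system ::
    "('k::real_algebra_1 ^ 'n ^ 'n) set \<Rightarrow> 'k ^ 'n ^ 'n \<Rightarrow> nat \<Rightarrow> ('k ^ 'n ^ 'n) set \<Rightarrow>
     (nat \<Rightarrow> 'k ^ 'n ^ 'n) \<Rightarrow> (nat \<Rightarrow> 'k ^ 'n ^ 'n) \<Rightarrow> (nat \<Rightarrow> 'k ^ 'n ^ 'n) \<Rightarrow> bool" where
  "H1_system \<gg> z r \<aa> e f h \<longleftrightarrow>
     maximal_abelian_in (p_part \<gg> z) \<aa> \<and>
     (\<forall>j\<in>{1..r}. H1_triple \<gg> z (e j) (f j) (h j)) \<and>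
     (\<forall>j\<in>{1..r}. \<forall>k\<in>{1..r}. j \<noteq> k \<longrightarrow>
        (\<forall>X\<in>{e j, f j, h j}. \<forall>Y\<in>{e k, f k, h k}. lie X Y = 0)) \<and>
     inj_on h {1..r} \<and> independent (h ` {1..r}) \<and> span (h ` {1..r}) = \<aa> \<and>
     (\<exists>\<xi> :: nat \<Rightarrow> 'k ^ 'n ^ 'n \<Rightarrow> real.
        (\<forall>j\<in>{1..r}. linear (\<xi> j)) \<and>
        (\<forall>j\<in>{1..r}. \<forall>k\<in>{1..r}. \<xi> j (h k) = (if j = k then 1 else 0)) \<and>
        (let C_roots = {restrict (\<lambda>H. \<sigma> * \<xi> j H + \<tau> * \<xi> k H) \<aa> | \<sigma> \<tau> j k.
                       \<sigma> \<in> {1, - 1} \<and> \<tau> \<in> {1, - 1} \<and> j \<in> {1..r} \<and> k \<in> {1..r} \<and> j \<noteq> k}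
                  \<union> {restrict (\<lambda>H. \<sigma> * (2 * \<xi> j H)) \<aa> | \<sigma> j. \<sigma> \<in> {1, - 1} \<and> j \<in> {1..r}};
             short_roots = {restrict (\<lambda>H. \<sigma> * \<xi> j H) \<aa> | \<sigma> j. \<sigma> \<in> {1, - 1} \<and> j \<in> {1..r}}
         in relative_roots \<gg> \<aa> = C_roots \<or> relative_roots \<gg> \<aa> = C_roots \<union> short_roots))"

definition holo_orbit ::
    "('k::real_normed_div_algebra ^ 'n ^ 'n) set \<Rightarrow> (nat \<Rightarrow> 'k ^ 'n ^ 'n) \<Rightarrow> nat \<Rightarrow> ('k ^ 'n ^ 'n) set" where
  "holo_orbit \<gg> e s = {\<phi> (\<Sum>j=1..s. e j) | \<phi>. \<phi> \<in> adjoint_group \<gg>}"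


section \<open>Smooth submanifolds and semi-algebraic sets\<close>

text \<open>\<open>Ck_on k S f\<close> says that \<open>f\<close> is \<open>k\<close> times continuously differentiable; it is meant for open \<open>S\<close>
  and finite-dimensional spaces.\<close>

primrec Ck_on :: "nat \<Rightarrow> 'a::euclidean_space set \<Rightarrow> ('a \<Rightarrow> 'b::euclidean_space) \<Rightarrow> bool" where
  "Ck_on 0 S f \<longleftrightarrow> continuous_on S f"
| "Ck_on (Suc k) S f \<longleftrightarrow> (\<forall>x\<in>S. f differentiable (at x)) \<and>
     (\<forall>v. Ck_on k S (\<lambda>x. frechet_derivative f (at x) v))"

definition smooth_on :: "'a::euclidean_space set \<Rightarrow> ('a \<Rightarrow> 'b::euclidean_space) \<Rightarrow> bool" where
  "smooth_on S f \<longleftrightarrow> (\<forall>k. Ck_on k S f)"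

text \<open>Embedded submanifolds of pure dimension, by slice charts.\<close>

definition smooth_submanifold :: "'a::euclidean_space set \<Rightarrow> bool" where
  "smooth_submanifold M \<longleftrightarrow> (\<exists>d. \<forall>x\<in>M. \<exists>U V \<phi> \<psi> L.
     open U \<and> x \<in> U \<and> open V \<and> homeomorphism U V \<phi> \<psi> \<and>
     smooth_on U \<phi> \<and> smooth_on V \<psi> \<and>
     subspace (L :: 'a set) \<and> dim L = d \<and> \<phi> ` (U \<inter> M) = V \<inter> L)"

inductive semialgebraic :: "'a::euclidean_space set \<Rightarrow> bool" where
  "real_polynomial_function p \<Longrightarrow> semialgebraic {x. p x = 0}"
| "real_polynomial_function p \<Longrightarrow> semialgebraic {x. p x > 0}"
| "semialgebraic A \<Longrightarrow> semialgebraic B \<Longrightarrow> semialgebraic (A \<union> B)"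
| "semialgebraic A \<Longrightarrow> semialgebraic B \<Longrightarrow> semialgebraic (A \<inter> B)"
| "semialgebraic A \<Longrightarrow> semialgebraic (- A)"

end

theory Submission
  imports Defs
begin

text \<open>
  All three families consist of matrices over a division algebra with involution, with \<open>J\<close>
  unitary and skew-hermitian. Writing \<open>X = J ** M\<close>, the element \<open>X\<close> is non-negative iff \<open>M\<close> is
  positive semidefinite, say \<open>M = A ** ctr A\<close>, and then nilpotency forces \<open>X ** X = 0\<close>, that is, the
  columns of \<open>A\<close> span an isotropic subspace. So the non-negative nilpotent elements of rank \<open>s\<close>
  correspond to isotropic \<open>s\<close>-frames up to unitary changes of the frame.

  Any two such frames are related by transvections \<open>mat 1 + N ** J\<close> with \<open>N ** J ** N = 0\<close>, which are
  exponentials of elements of the Lie algebra: transvections of rank one bring the frames into general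
  position, after a unitary change of one frame their Gram matrix is hermitian, and then a single
  transvection moves one frame to the other. The elements \<open>e j\<close> of an \<open>H\<^sub>1\<close>-system are
  \<open>J\<close> times pairwise orthogonal projections, each of rank one because there are as many of them
  as the Witt index permits. Hence the orbit is the set of all elements of rank \<open>s\<close>. Homogeneity reduces
  charts and closures to the base point, and Gaussian elimination gives the semi-algebraic description.
\<close>

section \<open>Matrices over real division algebras with involution\<close>

text \<open>Quaternions do not commute, so determinants, characteristic polynomials and cyclic
  traces are of no help. Every argument is therefore run on the underlying real Euclidean space:
  ranks are real dimensions of ranges, positivity is tested with the real inner product
  (\<open>inner 1 x\<close> is the real part of \<open>x\<close>), and spectral theorems give way to
  splitting off pieces of rank one or to a maximum over a compact group. The delicate point is that
  nilpotency is a condition on ad X, not on the matrix X. If J were definite, say i times the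
  identity, then X = J would be central with M = 1, although X ** X is not 0. A single nonzero
  isotropic vector excludes this; it is taken from the base point of the orbit, whose rank s is at
  least 1. For su(p,q) all test elements and transvections must moreover have trace zero. The
  reality and isotropy conditions that accompany them serve this purpose.\<close>

class involutive_algebra = real_normed_div_algebra + euclidean_space + conjugation +
  assumes cj_add: "cj (x + y) = cj x + cj y"
    and cj_scaleR: "cj (r *\<^sub>R x) = r *\<^sub>R cj x"
    and cj_mult: "cj (x * y) = cj y * cj x"
    and cj_cj [simp]: "cj (cj x) = x"
    and cj_mult_self_scaleR: "cj x * x = (norm x)\<^sup>2 *\<^sub>R 1"
    and add_cj: "x + cj x = (2 * inner 1 x) *\<^sub>R 1"
    and inner_mult_left_cj: "inner (a * x) y = inner x (cj a * y)"
    and inner_mult_right_cj: "inner (x * a) y = inner x (y * cj a)"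

instance real :: involutive_algebra
  by standard (auto simp: cj_real_def power2_eq_square)

instance complex :: involutive_algebra
proof
  fix x y a :: complex
  show "cj x * x = (norm x)\<^sup>2 *\<^sub>R 1"
    using complex_norm_square[of x] by (simp add: cj_complex_def mult.commute scaleR_conv_of_real)
  show "x + cj x = (2 * inner 1 x) *\<^sub>R 1"
    by (simp add: cj_complex_def complex_eq_iff)
  show "inner (a * x) y = inner x (cj a * y)" "inner (x * a) y = inner x (y * cj a)"
    by (simp_all add: cj_complex_def inner_complex_def algebra_simps)
qed (auto simp: cj_complex_def)

instance quat :: involutive_algebra
proof
  fix x y a :: quat
  show "cj x * x = (norm x)\<^sup>2 *\<^sub>R 1"
    by (simp add: norm_quat_def inner_quat_def) (simp add: cj_quat_def times_quat_def scaleR_quat_def one_quat_def)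
  show "x + cj x = (2 * inner 1 x) *\<^sub>R 1"
    by (simp add: cj_quat_def plus_quat_def inner_quat_def one_quat_def scaleR_quat_def)
  show "inner (a * x) y = inner x (cj a * y)" "inner (x * a) y = inner x (y * cj a)"
    by (simp_all add: cj_quat_def inner_quat_def times_quat_def algebra_simps)
qed (simp_all add: cj_quat_def plus_quat_def times_quat_def scaleR_quat_def algebra_simps quat_eq_iff)

lemma cj_mult_self: "cj x * x = of_real ((norm (x :: 'a::involutive_algebra))\<^sup>2)"
  by (simp add: cj_mult_self_scaleR of_real_def)

lemma linear_cj: "linear (cj :: 'a::involutive_algebra \<Rightarrow> 'a)"
  by (rule linearI) (auto simp: cj_add cj_scaleR)

lemma cj_0 [simp]: "cj (0 :: 'a::involutive_algebra) = 0"
  by (rule linear_0[OF linear_cj])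

lemma cj_minus: "cj (- x :: 'a::involutive_algebra) = - cj x"
  by (rule linear_neg[OF linear_cj])

lemma cj_diff: "cj (x - y :: 'a::involutive_algebra) = cj x - cj y"
  by (rule linear_diff[OF linear_cj])

lemma cj_sum: "cj (sum f I :: 'a::involutive_algebra) = (\<Sum>i\<in>I. cj (f i))"
  by (rule linear_sum[OF linear_cj])

lemma cj_1 [simp]: "cj (1 :: 'a::involutive_algebra) = 1"
  by (metis cj_cj cj_mult mult_1_right)

lemma cj_of_real [simp]: "cj (of_real r :: 'a::involutive_algebra) = of_real r"
  by (simp add: of_real_def cj_scaleR)

lemma cj_eq_self:
  assumes "cj (x :: 'a::involutive_algebra) = x"
  shows "x = of_real (inner 1 x)"
proof -
  have "2 *\<^sub>R x = 2 *\<^sub>R of_real (inner 1 x)"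
    using add_cj[of x] assms by (simp add: of_real_def scaleR_2)
  then show ?thesis by simp
qed

text \<open>Both sides are the real part of one number, once taken directly and once through its
  conjugate.\<close>

lemma inner_cj: "inner (cj x) (cj (y :: 'a::involutive_algebra)) = inner x y"
proof -
  have 1: "inner (cj a) 1 = inner a 1" for a :: 'a
    using inner_mult_left_cj[of "cj a" 1 1] by (simp add: inner_commute)
  have "inner x y = inner (cj y * x) 1"
    by (simp add: inner_mult_left_cj)
  also have "\<dots> = inner (cj x * y) 1"
    using 1[of "cj y * x"] by (simp add: cj_mult)
  also have "\<dots> = inner (cj x) (cj y)"
    by (simp add: inner_mult_right_cj)
  finally show ?thesis by simp
qed

subsection \<open>Column vectors as a right module\<close>

text \<open>Scalars act from the right, so that matrices acting from the left are linear over the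
  quaternions too (\<open>matrix_vector_scr\<close>).\<close>

definition scr :: "'a::semiring_1 ^ 'n \<Rightarrow> 'a \<Rightarrow> 'a ^ 'n" (infixl "*r" 75) where
  "v *r c = (\<chi> i. v $ i * c)"

lemma scr_add: "(u + v) *r c = u *r c + v *r c"
  by (simp add: scr_def vec_eq_iff algebra_simps)
lemma scr_add_right: "v *r (c + d) = v *r c + v *r d"
  by (simp add: scr_def vec_eq_iff algebra_simps)
lemma scr_minus_right: "(v :: 'a::ring_1^'n) *r (- c) = - (v *r c)"
  by (simp add: scr_def vec_eq_iff algebra_simps)
lemma scr_diff_right: "(v :: 'a::ring_1^'n) *r (c - d) = v *r c - v *r d"
  by (simp add: scr_def vec_eq_iff algebra_simps)
lemma scr_scr: "v *r c *r d = v *r (c * d)"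
  by (simp add: scr_def vec_eq_iff algebra_simps)
lemma scr_0 [simp]: "0 *r c = 0" "v *r 0 = 0"
  by (simp_all add: scr_def vec_eq_iff)
lemma scr_1 [simp]: "v *r 1 = v"
  by (simp add: scr_def vec_eq_iff)
lemma scr_of_real: "(v :: 'a::real_algebra_1^'n) *r of_real r = r *\<^sub>R v"
  by (simp add: scr_def vec_eq_iff of_real_def)
lemma scr_sum: "sum f I *r c = (\<Sum>i\<in>I. f i *r c)"
  by (induction I rule: infinite_finite_induct) (auto simp: scr_add)
lemma scr_eq_0_iff: "(v :: 'a::real_normed_div_algebra^'n) *r c = 0 \<longleftrightarrow> v = 0 \<or> c = 0"
  by (auto simp: scr_def vec_eq_iff)
lemma matrix_vector_scr: "A *v (v *r c) = (A *v v) *r c"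
  by (simp add: matrix_vector_mult_def scr_def vec_eq_iff sum_distrib_right mult.assoc)
lemma linear_scr: "linear (\<lambda>c. (v :: 'a::real_algebra_1^'n) *r c)"
  by (rule linearI) (auto simp: scr_def vec_eq_iff algebra_simps)
lemma matrix_vector_minus: "(- A) *v x = - (A *v (x :: 'a::ring_1^'n))"
  by (simp add: matrix_vector_mult_def vec_eq_iff sum_negf)
lemma matrix_vector_minus_right: "A *v (- x) = - (A *v (x :: 'a::ring_1^'n))"
  by (simp add: matrix_vector_mult_def vec_eq_iff sum_negf)
lemma matrix_vector_scaleR: "(r *\<^sub>R A) *v x = r *\<^sub>R (A *v (x :: 'a::real_algebra_1^'n))"
  by (simp add: matrix_vector_mult_def vec_eq_iff scaleR_right.sum)

subsection \<open>Conjugate transpose and the hermitian form\<close>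

definition ctr :: "'a::conjugation ^ 'n ^ 'm \<Rightarrow> 'a ^ 'm ^ 'n" where
  "ctr A = (\<chi> i j. cj (A $ j $ i))"

lemma ctr_ctr [simp]: "ctr (ctr A) = (A :: 'a::involutive_algebra^'n^'m)"
  by (simp add: ctr_def vec_eq_iff)
lemma ctr_add: "ctr (A + B :: 'a::involutive_algebra^'n^'m) = ctr A + ctr B"
  by (simp add: ctr_def vec_eq_iff cj_add)
lemma ctr_diff: "ctr (A - B :: 'a::involutive_algebra^'n^'m) = ctr A - ctr B"
  by (simp add: ctr_def vec_eq_iff cj_diff)
lemma ctr_minus: "ctr (- A :: 'a::involutive_algebra^'n^'m) = - ctr A"
  by (simp add: ctr_def vec_eq_iff cj_minus)
lemma ctr_scaleR: "ctr (r *\<^sub>R A :: 'a::involutive_algebra^'n^'m) = r *\<^sub>R ctr A"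
  by (simp add: ctr_def vec_eq_iff cj_scaleR)
lemma ctr_0 [simp]: "ctr (0 :: 'a::involutive_algebra^'n^'m) = 0"
  by (simp add: ctr_def vec_eq_iff)
lemma ctr_mat: "ctr (mat c :: 'a::involutive_algebra^'n^'n) = mat (cj c)"
  by (simp add: ctr_def mat_def vec_eq_iff)
lemma ctr_1 [simp]: "ctr (mat 1 :: 'a::involutive_algebra^'n^'n) = mat 1"
  by (simp add: ctr_mat)
lemma ctr_mult: "ctr (A ** B :: 'a::involutive_algebra^'n^'m) = ctr B ** ctr A"
  by (simp add: ctr_def matrix_matrix_mult_def vec_eq_iff cj_sum cj_mult)
lemma ctr_sum: "ctr (sum f I :: 'a::involutive_algebra^'n^'m) = (\<Sum>i\<in>I. ctr (f i))"
  by (induction I rule: infinite_finite_induct) (auto simp: ctr_add)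
lemma ctr_eq_0_iff: "ctr A = 0 \<longleftrightarrow> A = (0 :: 'a::involutive_algebra^'n^'m)"
  by (metis ctr_ctr ctr_0)
lemma linear_ctr: "linear (ctr :: 'a::involutive_algebra^'n^'m \<Rightarrow> _)"
  by (rule linearI) (auto simp: ctr_add ctr_scaleR)

lemmas ctr_simps = ctr_add ctr_diff ctr_minus ctr_scaleR ctr_mult

text \<open>The inner product of matrices is the real part of the trace of
  \<open>ctr P ** Q\<close>; using it avoids the quaternionic trace, which is not cyclic.\<close>

lemma inner_mult_left_ctr: "inner (S ** P) Q = inner P (ctr S ** Q)"
  for S :: "'a::involutive_algebra^'n^'m" and P :: "'a^'k^'n"
proof -
  have "inner (S ** P) Q = (\<Sum>i\<in>UNIV. \<Sum>j\<in>UNIV. \<Sum>k\<in>UNIV. inner (P$k$j) (cj (S$i$k) * Q$i$j))"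
    by (simp add: inner_vec_def matrix_matrix_mult_def inner_sum_left inner_mult_left_cj)
  also have "\<dots> = (\<Sum>i\<in>UNIV. \<Sum>k\<in>UNIV. \<Sum>j\<in>UNIV. inner (P$k$j) (cj (S$i$k) * Q$i$j))"
    by (intro sum.cong refl) (rule sum.swap)
  also have "\<dots> = (\<Sum>k\<in>UNIV. \<Sum>i\<in>UNIV. \<Sum>j\<in>UNIV. inner (P$k$j) (cj (S$i$k) * Q$i$j))"
    by (rule sum.swap)
  also have "\<dots> = (\<Sum>k\<in>UNIV. \<Sum>j\<in>UNIV. \<Sum>i\<in>UNIV. inner (P$k$j) (cj (S$i$k) * Q$i$j))"
    by (intro sum.cong refl) (rule sum.swap)
  also have "\<dots> = inner P (ctr S ** Q)"
    by (simp add: inner_vec_def matrix_matrix_mult_def inner_sum_right ctr_def)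
  finally show ?thesis .
qed

lemma inner_ctr: "inner (ctr A) (ctr B) = inner A (B :: 'a::involutive_algebra^'n^'m)"
  by (simp add: inner_vec_def ctr_def inner_cj) (rule sum.swap)

lemma inner_mult_right_ctr: "inner (P ** S) Q = inner P (Q ** ctr S)"
  for P :: "'a::involutive_algebra^'n^'m" and S :: "'a^'k^'n"
proof -
  have "inner (P ** S) Q = inner (ctr S ** ctr P) (ctr Q)"
    by (metis ctr_mult inner_ctr)
  also have "\<dots> = inner (ctr P) (S ** ctr Q)"
    by (simp add: inner_mult_left_ctr)
  also have "\<dots> = inner P (Q ** ctr S)"
    by (metis ctr_ctr ctr_mult inner_ctr)
  finally show ?thesis .
qed

lemma inner_matrix_vector_ctr: "inner (A *v u) v = inner u (ctr A *v v)"
  for A :: "'a::involutive_algebra^'n^'m"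
proof -
  have "inner (A *v u) v = (\<Sum>i\<in>UNIV. \<Sum>k\<in>UNIV. inner (u$k) (cj (A$i$k) * v$i))"
    by (simp add: inner_vec_def matrix_vector_mult_def inner_sum_left inner_mult_left_cj)
  also have "\<dots> = (\<Sum>k\<in>UNIV. \<Sum>i\<in>UNIV. inner (u$k) (cj (A$i$k) * v$i))"
    by (rule sum.swap)
  also have "\<dots> = inner u (ctr A *v v)"
    by (simp add: inner_vec_def matrix_vector_mult_def inner_sum_right ctr_def)
  finally show ?thesis .
qed

abbreviation hf :: "'a::{conjugation,semiring_1} ^ 'n \<Rightarrow> 'a ^ 'n \<Rightarrow> 'a" where
  "hf \<equiv> herm_form"

lemma hf_add_left: "hf (u + v) w = hf u w + hf v (w :: 'a::involutive_algebra^'n)"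
  by (simp add: herm_form_def cj_add algebra_simps sum.distrib)
lemma hf_add_right: "hf w (u + v) = hf w u + hf w (v :: 'a::involutive_algebra^'n)"
  by (simp add: herm_form_def algebra_simps sum.distrib)
lemma hf_diff_left: "hf (u - v) w = hf u w - hf v (w :: 'a::involutive_algebra^'n)"
  by (simp add: herm_form_def cj_diff algebra_simps sum_subtractf)
lemma hf_diff_right: "hf w (u - v) = hf w u - hf w (v :: 'a::involutive_algebra^'n)"
  by (simp add: herm_form_def algebra_simps sum_subtractf)
lemma hf_minus_left: "hf (- v) w = - hf v (w :: 'a::involutive_algebra^'n)"
  by (simp add: herm_form_def cj_minus sum_negf)
lemma hf_minus_right: "hf w (- v) = - hf w (v :: 'a::involutive_algebra^'n)"
  by (simp add: herm_form_def sum_negf)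
lemma hf_scr_left: "hf (v *r c) w = cj c * hf v (w :: 'a::involutive_algebra^'n)"
  by (simp add: herm_form_def scr_def cj_mult sum_distrib_left mult.assoc)
lemma hf_scr_right: "hf w (v *r c) = hf w (v :: 'a::involutive_algebra^'n) * c"
  by (simp add: herm_form_def scr_def sum_distrib_right mult.assoc)
lemma hf_scaleR_left: "hf (r *\<^sub>R v) w = r *\<^sub>R hf v (w :: 'a::involutive_algebra^'n)"
  by (simp add: herm_form_def cj_scaleR scaleR_right.sum)
lemma hf_scaleR_right: "hf w (r *\<^sub>R v) = r *\<^sub>R hf w (v :: 'a::involutive_algebra^'n)"
  by (simp add: herm_form_def scaleR_right.sum)
lemma hf_0 [simp]: "hf 0 v = 0" "hf v (0 :: 'a::involutive_algebra^'n) = 0"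
  by (simp_all add: herm_form_def)
lemma cj_hf: "cj (hf u v) = hf v (u :: 'a::involutive_algebra^'n)"
  by (simp add: herm_form_def cj_sum cj_mult)

lemmas hf_simps = hf_add_left hf_add_right hf_diff_left hf_diff_right hf_minus_left hf_minus_right
  hf_scr_left hf_scr_right hf_scaleR_left hf_scaleR_right

lemma hf_self: "hf v v = of_real ((norm (v :: 'a::involutive_algebra^'n))\<^sup>2)"
  by (simp add: herm_form_def cj_mult_self norm_vec_def L2_set_def sum_nonneg)

lemma hf_self_eq_0 [simp]: "hf v v = 0 \<longleftrightarrow> v = (0 :: 'a::involutive_algebra^'n)"
  by (simp add: hf_self)

lemma inner_1_hf: "inner 1 (hf u v) = inner u (v :: 'a::involutive_algebra^'n)"
proof -
  have "inner 1 (cj a * b) = inner a b" for a b :: 'a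
    using inner_mult_left_cj[of a 1 b] by simp
  then show ?thesis by (simp add: herm_form_def inner_sum_right inner_vec_def)
qed

lemma hf_matrix_left: "hf (A *v u) v = hf u (ctr A *v v)"
  for A :: "'a::involutive_algebra^'n^'m"
proof -
  have "hf (A *v u) v = (\<Sum>i\<in>UNIV. \<Sum>k\<in>UNIV. cj (u$k) * cj (A$i$k) * v$i)"
    by (simp add: herm_form_def matrix_vector_mult_def cj_sum cj_mult sum_distrib_right)
  also have "\<dots> = (\<Sum>k\<in>UNIV. \<Sum>i\<in>UNIV. cj (u$k) * cj (A$i$k) * v$i)"
    by (rule sum.swap)
  also have "\<dots> = hf u (ctr A *v v)"
    by (simp add: herm_form_def matrix_vector_mult_def ctr_def sum_distrib_left mult.assoc)
  finally show ?thesis .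
qed

lemma hf_matrix_right: "hf u (A *v v) = hf (ctr A *v u) v"
  for A :: "'a::involutive_algebra^'n^'m"
  by (simp add: hf_matrix_left)

lemma hf_nondegenerate: "(\<And>u. hf u v = 0) \<Longrightarrow> v = (0 :: 'a::involutive_algebra^'n)"
  by (metis hf_self_eq_0)

lemma matrix_eqI_hf: "(\<And>u v. hf u (A *v v) = hf u (B *v v)) \<Longrightarrow> A = (B :: 'a::involutive_algebra^'n^'m)"
proof -
  assume *: "\<And>u v. hf u (A *v v) = hf u (B *v v)"
  have "A *v v - B *v v = 0" for v
    by (rule hf_nondegenerate) (simp add: hf_diff_right *)
  then show ?thesis by (simp add: matrix_eq)
qed

definition outer :: "'a::{conjugation,semiring_1} ^ 'm \<Rightarrow> 'a ^ 'n \<Rightarrow> 'a ^ 'n ^ 'm" where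
  "outer u v = (\<chi> i j. u $ i * cj (v $ j))"

lemma outer_mult_vector: "outer u v *v w = u *r hf v (w :: 'a::involutive_algebra^'n)"
  by (simp add: outer_def matrix_vector_mult_def herm_form_def scr_def vec_eq_iff
      sum_distrib_left mult.assoc)
lemma matrix_mult_outer: "A ** outer u v = outer (A *v u) (v :: 'a::involutive_algebra^'n)"
  by (simp add: outer_def matrix_vector_mult_def matrix_matrix_mult_def vec_eq_iff
      sum_distrib_right mult.assoc)
lemma ctr_outer: "ctr (outer u v) = outer v (u :: 'a::involutive_algebra^'n)"
  by (simp add: outer_def ctr_def vec_eq_iff cj_mult)
lemma outer_mult_matrix: "outer u v ** A = outer u (ctr A *v (v :: 'a::involutive_algebra^'n))"
  by (metis ctr_ctr ctr_mult ctr_outer matrix_mult_outer)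
lemma outer_0 [simp]: "outer 0 w = 0" "outer u (0 :: 'a::involutive_algebra^'n) = 0"
  by (simp_all add: outer_def vec_eq_iff)

subsection \<open>Matrix products\<close>

lemma matrix_diff_ldistrib: "A ** (B - C) = A ** B - A ** (C :: 'a::ring_1^'n^'m)"
  by (simp add: matrix_matrix_mult_def vec_eq_iff right_diff_distrib sum_subtractf)
lemma matrix_diff_rdistrib: "(B - C) ** A = B ** A - C ** (A :: 'a::ring_1^'n^'m)"
  by (simp add: matrix_matrix_mult_def vec_eq_iff left_diff_distrib sum_subtractf)
lemma matrix_minus_left: "(- A) ** B = - (A ** (B :: 'a::ring_1^'n^'m))"
  by (simp add: matrix_matrix_mult_def vec_eq_iff sum_negf)
lemma matrix_minus_right: "A ** (- B) = - (A ** (B :: 'a::ring_1^'n^'m))"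
  by (simp add: matrix_matrix_mult_def vec_eq_iff sum_negf)
lemma matrix_scaleR_left: "(r *\<^sub>R A) ** B = r *\<^sub>R (A ** (B :: 'a::real_algebra_1^'n^'m))"
  by (simp add: matrix_matrix_mult_def vec_eq_iff scaleR_right.sum)
lemma matrix_scaleR_right: "A ** (r *\<^sub>R B) = r *\<^sub>R (A ** (B :: 'a::real_algebra_1^'n^'m))"
  by (simp add: matrix_matrix_mult_def vec_eq_iff scaleR_right.sum)
lemma matrix_add_rdistrib': "(B + C) ** A = B ** A + C ** (A :: 'a::semiring_1^'n^'m)"
  by (simp add: matrix_matrix_mult_def vec_eq_iff algebra_simps sum.distrib)
lemma matrix_0_left [simp]: "0 ** A = (0 :: 'a::semiring_1^'n^'m)"
  by (simp add: matrix_matrix_mult_def vec_eq_iff)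
lemma matrix_0_right [simp]: "A ** 0 = (0 :: 'a::semiring_1^'n^'m)"
  by (simp add: matrix_matrix_mult_def vec_eq_iff)
lemma matrix_sum_right: "A ** sum f I = (\<Sum>i\<in>I. A ** f i :: 'a::semiring_1^'n^'m)"
  by (induction I rule: infinite_finite_induct) (auto simp: matrix_add_ldistrib)
lemma matrix_sum_left: "sum f I ** A = (\<Sum>i\<in>I. f i ** A :: 'a::semiring_1^'n^'m)"
  by (induction I rule: infinite_finite_induct) (auto simp: matrix_add_rdistrib')

lemmas msimps = matrix_add_ldistrib matrix_add_rdistrib' matrix_diff_ldistrib matrix_diff_rdistrib
  matrix_minus_left matrix_minus_right matrix_scaleR_left matrix_scaleR_right
lemmas massoc = matrix_mul_assoc[symmetric]

lemma bounded_bilinear_matrix: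
  "bounded_bilinear ((**) :: 'a::{real_algebra_1,euclidean_space}^'n^'m \<Rightarrow> 'a^'k^'n \<Rightarrow> 'a^'k^'m)"
  by (subst bilinear_conv_bounded_bilinear[symmetric])
     (simp add: bilinear_def linear_iff msimps)

lemma bounded_bilinear_matrix_vector:
  "bounded_bilinear ((*v) :: 'a::{real_algebra_1,euclidean_space}^'n^'m \<Rightarrow> 'a^'n \<Rightarrow> 'a^'m)"
  by (subst bilinear_conv_bounded_bilinear[symmetric])
     (simp add: bilinear_def linear_iff algebra_simps matrix_vector_scaleR
        linear_scale[OF matrix_vector_mul_linear])

lemmas continuous_on_matrix_mult [continuous_intros] =
  bounded_bilinear.continuous_on[OF bounded_bilinear_matrix]

lemma mult_ctr_self_eq_0: "ctr A ** A = 0 \<longleftrightarrow> A = 0" for A :: "'a::involutive_algebra^'n^'m"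
proof
  assume "ctr A ** A = 0"
  then have "inner A A = 0"
    using inner_mult_left_ctr[of A "mat 1" A] by simp
  then show "A = 0" by simp
qed simp

section \<open>Real dimension of ranges\<close>

text \<open>Rank measured over the reals, so that one dimension theory serves all three scalar
  domains. It is \<open>DIM('a)\<close> times the rank over the scalars.\<close>

definition rdim :: "'a::real_algebra_1 ^ 'n ^ 'm \<Rightarrow> nat" where
  "rdim A = dim (range ((*v) A))"

abbreviation ker :: "'a::ring_1 ^ 'n ^ 'm \<Rightarrow> ('a ^ 'n) set" where
  "ker A \<equiv> {v. A *v v = 0}"

lemma subspace_ker: "subspace (ker (A :: 'a::real_algebra_1^'n^'m))"
  by (rule linear_subspace_kernel[OF matrix_vector_mul_linear])

lemma subspace_range_matrix: "subspace (range ((*v) (A :: 'a::real_algebra_1^'n^'m)))"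
  by (rule linear_subspace_image[OF matrix_vector_mul_linear subspace_UNIV])

text \<open>The kernel of \<open>ctr A\<close> is the orthogonal complement of the range of
  \<open>A\<close>.\<close>

lemma dim_ker_ctr: "dim (ker (ctr A)) + rdim A = DIM('a^'m)" for A :: "'a::involutive_algebra^'n^'m"
proof -
  have "{y \<in> UNIV. \<forall>x\<in>range ((*v) A). orthogonal x y} = ker (ctr A)"
  proof safe
    fix y assume "\<forall>x\<in>range ((*v) A). orthogonal x y"
    then have "inner u (ctr A *v y) = 0" for u
      by (auto simp: orthogonal_def inner_matrix_vector_ctr)
    then show "ctr A *v y = 0" using inner_eq_zero_iff by blast
  qed (auto simp: orthogonal_def inner_matrix_vector_ctr)
  then show ?thesis
    using dim_subspace_orthogonal_to_vectors[OF subspace_range_matrix[of A] subspace_UNIV]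
    by (simp add: rdim_def)
qed

text \<open>\<open>B\<close> is injective on the range of \<open>ctr B\<close>, because that range
  is orthogonal to the kernel of \<open>B\<close>. This gives one inequality, and
  \<open>ctr_ctr\<close> the other.\<close>

lemma rdim_ctr: "rdim (ctr A) = rdim A" for A :: "'a::involutive_algebra^'n^'m"
proof -
  have *: "rdim (ctr B) \<le> rdim B" for B :: "'a^'p::finite^'q::finite"
  proof -
    let ?R = "range ((*v) (ctr B))"
    have "inj_on ((*v) B) ?R"
    proof (rule inj_onI)
      fix u v assume "u \<in> ?R" "v \<in> ?R" and eq: "B *v u = B *v v"
      then obtain w where w: "u - v = ctr B *v w"
        by (metis (no_types) image_iff matrix_vector_mult_diff_distrib)
      have "inner (u - v) (u - v) = inner (B *v (u - v)) w"
        by (simp add: inner_matrix_vector_ctr flip: w)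
      also have "\<dots> = 0" by (simp add: eq matrix_vector_mult_diff_distrib)
      finally show "u = v" by simp
    qed
    then have "inj_on ((*v) B) (span ?R)"
      using subspace_range_matrix[of "ctr B"] by (simp only: span_eq_iff[symmetric])
    then have "dim ((*v) B ` ?R) = dim ?R"
      by (rule dim_image_eq[OF matrix_vector_mul_linear])
    moreover have "dim ((*v) B ` ?R) \<le> rdim B"
      unfolding rdim_def by (intro dim_subset) auto
    ultimately show ?thesis by (simp add: rdim_def)
  qed
  show ?thesis using *[of A] *[of "ctr A"] by simp
qed

lemma dim_ker: "dim (ker A) + rdim A = DIM('a^'n)" for A :: "'a::involutive_algebra^'n^'m"
  using dim_ker_ctr[of "ctr A"] by (simp add: rdim_ctr)

lemma ker_mult_ctr: "ker (A ** ctr A) = ker (ctr A)" for A :: "'a::involutive_algebra^'n^'m"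
proof safe
  fix v assume "(A ** ctr A) *v v = 0"
  then have "inner (ctr A *v v) (ctr A *v v) = 0"
    by (metis ctr_ctr inner_matrix_vector_ctr inner_zero_right matrix_vector_mul_assoc)
  then show "ctr A *v v = 0" by simp
qed (simp add: matrix_vector_mul_assoc[symmetric])

lemma rdim_mult_ctr: "rdim (A ** ctr A) = rdim A" for A :: "'a::involutive_algebra^'n^'m"
  using dim_ker[of "A ** ctr A"] dim_ker_ctr[of A] by (simp add: ker_mult_ctr)

lemma rdim_mult_le_left: "rdim (A ** B) \<le> rdim A"
  for A :: "'a::{real_algebra_1,euclidean_space}^'n^'m"
  unfolding rdim_def by (rule dim_subset) (auto simp: matrix_vector_mul_assoc[symmetric])

lemma rdim_mult_le_right: "rdim (A ** B) \<le> rdim B"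
  for B :: "'a::{real_algebra_1,euclidean_space}^'n^'m"
proof -
  have "range ((*v) (A ** B)) = (*v) A ` range ((*v) B)"
    by (auto simp: matrix_vector_mul_assoc[symmetric])
  then show ?thesis unfolding rdim_def by (simp add: dim_image_le)
qed

lemma rdim_mult_invertible:
  fixes A :: "'a::{real_algebra_1,euclidean_space}^'n^'m"
  assumes "H ** G = mat 1"
  shows "rdim (G ** A) = rdim A"
proof (rule antisym)
  show "rdim A \<le> rdim (G ** A)"
    using rdim_mult_le_right[of H "G ** A"] assms by (simp add: matrix_mul_assoc)
qed (rule rdim_mult_le_right)

lemma rdim_0 [simp]: "rdim (0 :: 'a::{real_algebra_1,euclidean_space}^'n^'m) = 0"
  by (auto simp: rdim_def)

lemma rdim_minus: "rdim (- A) = rdim (A :: 'a::{real_algebra_1,euclidean_space}^'n^'m)"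
proof -
  have "range ((*v) (- A)) = range ((*v) A)"
    by (auto simp: image_iff) (metis matrix_vector_minus matrix_vector_minus_right minus_minus)+
  then show ?thesis by (simp add: rdim_def)
qed

lemma rdim_scaleR: "c \<noteq> 0 \<Longrightarrow> rdim (c *\<^sub>R A) = rdim (A :: 'a::{real_algebra_1,euclidean_space}^'n^'m)"
proof -
  assume "c \<noteq> 0"
  then have "range ((*v) (c *\<^sub>R A)) = range ((*v) A)"
    by (auto simp: image_iff matrix_vector_scaleR linear_scale[OF matrix_vector_mul_linear, symmetric])
       (metis scaleR_scaleR right_inverse scaleR_one)
  then show ?thesis by (simp add: rdim_def)
qed

lemma ker_eqI:
  fixes A :: "'a::involutive_algebra^'n^'m" and B :: "'a^'n^'k"
  assumes "ker A \<subseteq> ker B" "rdim A \<le> rdim B"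
  shows "ker A = ker B"
  using assms dim_ker[of A] dim_ker[of B]
  by (intro subspace_dim_equal subspace_ker) auto

lemma left_inverse_imp_right_inverse:
  fixes A B :: "'a::{real_algebra_1,euclidean_space}^'n^'n"
  assumes "A ** B = mat 1"
  shows "B ** A = mat 1"
proof -
  have "inj ((*v) B)"
    by (rule inj_on_inverseI[where g = "(*v) A"]) (simp add: matrix_vector_mul_assoc assms)
  then have "surj ((*v) B)"
    using linear_inj_imp_surj matrix_vector_mul_linear by blast
  then have "B *v (A *v v) = v" for v
    by (metis assms matrix_vector_mul_assoc matrix_vector_mul_lid surjD)
  then show ?thesis
    by (simp add: matrix_eq matrix_vector_mul_assoc[symmetric])
qed

text \<open>The line through \<open>v\<close> meets \<open>W\<close> only in 0, since a nonzero
  multiple of \<open>v\<close> in \<open>W\<close> could be divided by its coefficient. All ranks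
  are counted in blocks of \<open>DIM('a)\<close> by means of this.\<close>

lemma dim_add_line:
  fixes v :: "'a::{real_normed_div_algebra,euclidean_space}^'n"
  assumes W: "subspace W" "\<And>w c. w \<in> W \<Longrightarrow> w *r c \<in> W" and v: "v \<notin> W"
  shows "dim {w + v *r c | w c. w \<in> W} = dim W + DIM('a)"
proof -
  let ?L = "range ((*r) v)"
  have v0: "v \<noteq> 0" using v subspace_0[OF W(1)] by auto
  have "inj ((*r) v)"
  proof (rule injI)
    fix c d assume "v *r c = v *r d"
    then have "v *r (c - d) = 0" by (simp add: scr_diff_right)
    then show "c = d" using v0 by (simp add: scr_eq_0_iff)
  qed
  then have dL: "dim ?L = DIM('a)"
    using dim_image_eq[OF linear_scr[of v], of UNIV] by simp
  have "W \<inter> ?L \<subseteq> {0}"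
  proof safe
    fix c assume "v *r c \<in> W"
    then have "v *r c *r inverse c \<in> W" by (rule W(2))
    with v have "c = 0" by (cases "c = 0") (auto simp: scr_scr)
    then show "v *r c = 0" by simp
  qed
  then have "dim (W \<inter> ?L) = 0" by (simp only: dim_eq_0)
  moreover have "subspace ?L" by (rule linear_subspace_image[OF linear_scr subspace_UNIV])
  ultimately have "dim {x + y |x y. x \<in> W \<and> y \<in> ?L} = dim W + DIM('a)"
    using dim_sums_Int[OF W(1), of ?L] dL by linarith
  moreover have "{x + y |x y. x \<in> W \<and> y \<in> ?L} = {w + v *r c | w c. w \<in> W}" by auto
  ultimately show ?thesis by simp
qed

section \<open>Positive semidefinite matrices\<close>

text \<open>Testing the real inner product suffices: for hermitian \<open>M\<close> the value of the
  hermitian form at \<open>v\<close> is a real scalar (\<open>hf_psd\<close>).\<close>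

definition psd :: "'a::involutive_algebra^'n^'n \<Rightarrow> bool" where
  "psd M \<longleftrightarrow> ctr M = M \<and> (\<forall>v. inner v (M *v v) \<ge> 0)"

lemma psd_ctr: "psd M \<Longrightarrow> ctr M = M"
  by (simp add: psd_def)

lemma psd_mult_ctr: "psd (A ** ctr A)"
  unfolding psd_def
  by (simp add: ctr_mult matrix_vector_mul_assoc[symmetric])
     (metis ctr_ctr inner_commute inner_ge_zero inner_matrix_vector_ctr)

lemma psd_add: "psd M \<Longrightarrow> psd N \<Longrightarrow> psd (M + N)"
  by (simp add: psd_def ctr_add matrix_vector_mult_add_rdistrib inner_add_right)

lemma psd_scaleR: "psd M \<Longrightarrow> c \<ge> 0 \<Longrightarrow> psd (c *\<^sub>R M)"
  by (simp add: psd_def ctr_scaleR matrix_vector_scaleR)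

lemma psd_0 [simp]: "psd 0"
  by (simp add: psd_def)

lemma inner_scr_hf: "inner v (a *r hf a v) = (norm (hf a v))\<^sup>2" for a v :: "'a::involutive_algebra^'n"
proof -
  have "inner v (a *r hf a v) = inner 1 (cj (hf a v) * hf a v)"
    by (simp add: inner_1_hf[symmetric] hf_scr_right cj_hf)
  also have "\<dots> = (norm (hf a v))\<^sup>2"
    by (simp add: cj_mult_self of_real_def power2_norm_eq_inner[symmetric])
  finally show ?thesis .
qed

lemma psd_outer: "psd (outer a a)"
  by (simp add: psd_def ctr_outer outer_mult_vector inner_scr_hf)

lemma hf_psd:
  fixes M :: "'a::involutive_algebra^'n^'n"
  assumes "ctr M = M"
  shows "hf v (M *v v) = of_real (inner v (M *v v))"
proof -
  have "cj (hf v (M *v v)) = hf v (M *v v)"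
    by (simp add: cj_hf hf_matrix_left assms)
  from cj_eq_self[OF this] show ?thesis by (simp add: inner_1_hf)
qed

lemma psd_isotropic_eq_0:
  assumes M: "psd M" and x: "inner x (M *v x) = 0"
  shows "M *v x = 0"
proof (rule ccontr)
  define a b where "a = inner (M *v x) (M *v x)" and "b = inner (M *v x) (M *v (M *v x))"
  assume "M *v x \<noteq> 0"
  then have a: "a > 0" by (simp add: a_def)
  have b: "b \<ge> 0" using M by (simp add: b_def psd_def)
  \<comment> \<open>The polynomial b t^2 - 2 a t is negative for small positive t. This t gives t b
    <= a, and the 1 in the denominator covers b = 0.\<close>
  define t where "t = a / (b + 1)"
  have sym: "inner x (M *v (M *v x)) = a"
    using M by (metis a_def inner_matrix_vector_ctr psd_def)
  have "0 \<le> inner (x - t *\<^sub>R (M *v x)) (M *v (x - t *\<^sub>R (M *v x)))"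
    using M by (simp add: psd_def)
  also have "\<dots> = t * t * b - 2 * t * a"
    by (simp add: inner_diff_left inner_diff_right x sym algebra_simps matrix_vector_mult_diff_distrib
        linear_scale[OF matrix_vector_mul_linear] flip: a_def b_def)
  also have "\<dots> = t * (t * b - 2 * a)" by (simp add: algebra_simps)
  finally have "t * (t * b - 2 * a) \<ge> 0" .
  moreover have "t > 0" using a b by (simp add: t_def)
  ultimately have "t * b \<ge> 2 * a" by (simp add: zero_le_mult_iff)
  moreover have "t * b \<le> a"
    using a b by (simp add: t_def divide_simps)
  ultimately show False using a by simp
qed

text \<open>One pivot step of Gaussian elimination (a Schur complement) along an arbitrary vector
  \<open>x\<close> in place of a basis vector.\<close>

definition deflate :: "'a::involutive_algebra^'n^'n \<Rightarrow> 'a^'n \<Rightarrow> 'a^'n^'n" where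
  "deflate M x = M - (1 / inner x (M *v x)) *\<^sub>R outer (M *v x) (M *v x)"

text \<open>Deflation makes the form vanish along \<open>x\<close> and keeps it on the
  \<open>M\<close>-orthogonal complement of \<open>x\<close>. So positivity survives, and the kernel
  grows by exactly the line through \<open>x\<close>.\<close>

lemma
  fixes M :: "'a::involutive_algebra^'n^'n"
  assumes M: "psd M" and x: "inner x (M *v x) > 0"
  shows deflate_mult_vector: "deflate M x *v x = 0"
    and psd_deflate: "psd (deflate M x)"
    and rdim_deflate: "rdim M = rdim (deflate M x) + DIM('a)"
proof -
  define m a where "m = inner x (M *v x)" and "a = M *v x"
  have m: "m > 0" using x by (simp add: m_def)
  have cM: "ctr M = M" using M by (simp add: psd_def)
  have D: "deflate M x *v v = M *v v - (1/m) *\<^sub>R (a *r hf a v)" for v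
    by (simp add: deflate_def m_def a_def matrix_vector_mult_diff_rdistrib matrix_vector_scaleR outer_mult_vector)
  have hax: "hf a x = of_real m"
    using hf_psd[OF cM, of x] by (simp add: a_def m_def hf_matrix_left cM)
  show Dx: "deflate M x *v x = 0"
    using m by (simp add: D hax scr_of_real) (simp add: a_def)
  have cD: "ctr (deflate M x) = deflate M x"
    by (simp add: deflate_def ctr_simps cM ctr_outer)
  have "inner v (deflate M x *v v) \<ge> 0" for v
  proof -
    \<comment> \<open>The component of \<open>v\<close> that is \<open>M\<close>-orthogonal to
      \<open>x\<close>. The deflated matrix does not see the difference, and on \<open>w\<close> it
      agrees with \<open>M\<close>.\<close>
    define w where "w = v - (1/m) *\<^sub>R (x *r hf a v)"
    have Dv: "deflate M x *v v = deflate M x *v w"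
      by (simp add: w_def matrix_vector_mult_diff_distrib linear_scale[OF matrix_vector_mul_linear]
          matrix_vector_scr Dx)
    have "inner v (deflate M x *v v) = inner (deflate M x *v v) w"
      using Dv cD by (metis inner_matrix_vector_ctr)
    also have "\<dots> = inner w (deflate M x *v w)"
      by (simp add: Dv inner_commute)
    also have "\<dots> = inner w (M *v w) - (1/m) * (norm (hf a w))\<^sup>2"
      by (simp add: D inner_diff_right inner_scr_hf)
    also have "hf a w = 0"
      using m by (simp add: w_def hf_simps hax of_real_def)
    finally show ?thesis using M by (simp add: psd_def)
  qed
  then show "psd (deflate M x)" by (simp add: psd_def cD)
  have "ker (deflate M x) = {w + x *r c | w c. w \<in> ker M}"
  proof safe
    fix v assume v: "deflate M x *v v = 0"
    have "v = (v - x *r ((1/m) *\<^sub>R hf a v)) + x *r ((1/m) *\<^sub>R hf a v)" by simp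
    moreover have "M *v (v - x *r ((1/m) *\<^sub>R hf a v)) = 0"
      using v by (simp add: D matrix_vector_mult_diff_distrib linear_scale[OF linear_scr]
          linear_scale[OF matrix_vector_mul_linear] matrix_vector_scr a_def[symmetric])
    ultimately show "\<exists>w c. v = w + x *r c \<and> w \<in> ker M" by blast
  next
    fix w c assume w: "M *v w = 0"
    have "hf a w = 0" by (simp add: a_def hf_matrix_left cM w)
    then show "deflate M x *v (w + x *r c) = 0"
      by (simp add: matrix_vector_right_distrib matrix_vector_scr Dx) (simp add: D w)
  qed
  moreover have "dim {w + x *r c | w c. w \<in> ker M} = dim (ker M) + DIM('a)"
    using x by (intro dim_add_line subspace_ker) (auto simp: matrix_vector_scr)
  ultimately show "rdim M = rdim (deflate M x) + DIM('a)"
    using dim_ker[of M] dim_ker[of "deflate M x"] by simp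
qed

section \<open>Factorisation of positive semidefinite matrices\<close>

lemma hf_axis: "hf (axis i 1) v = v $ i" "hf v (axis i 1) = cj (v $ i)"
  for v :: "'a::involutive_algebra^'n"
proof -
  show "hf (axis i 1) v = v $ i"
    by (simp add: herm_form_def axis_def if_distrib if_distribR sum.If_cases cong: if_cong)
  then show "hf v (axis i 1) = cj (v $ i)"
    by (metis cj_hf)
qed

lemma matrix_eq_axis:
  fixes A B :: "'a::involutive_algebra^'n^'m"
  assumes "\<And>j. A *v axis j 1 = B *v axis j 1"
  shows "A = B"
proof -
  have "(C *v axis j 1) $ i = C $ i $ j" for C :: "'a^'n^'m" and i j
    by (simp add: matrix_vector_mult_def axis_def if_distrib cong: if_cong)
  then show ?thesis using assms by (metis vec_eq_iff)
qed

text \<open>A Cholesky factorisation, deflating along one basis vector at a time; \<open>S\<close>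
  holds the indices of the basis vectors that \<open>M\<close> may not kill. That \<open>A\<close>
  kills the others as well is part of the induction, since it removes the cross terms.\<close>

lemma psd_decompose:
  fixes M :: "'a::involutive_algebra^'n^'n"
  assumes "psd M"
  obtains A :: "'a^'n^'n" where "M = A ** ctr A"
proof -
  have "\<exists>A. M = A ** ctr A \<and> (\<forall>j. j \<notin> S \<longrightarrow> A *v axis j 1 = 0)"
    if "finite S" "psd M" "\<forall>j. j \<notin> S \<longrightarrow> M *v axis j 1 = 0" for S and M :: "'a^'n^'n"
    using that
  proof (induction S arbitrary: M)
    case empty
    then have "M = 0" by (intro matrix_eq_axis) simp
    then show ?case by (intro exI[of _ 0]) simp
  next
    case (insert i S)
    define m a where "m = inner (axis i 1) (M *v axis i 1)" and "a = M *v axis i 1"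
    have "m \<ge> 0" using insert.prems by (simp add: m_def psd_def)
    then consider "m = 0" | "m > 0" by linarith
    then show ?case
    proof cases
      case 1
      then have "M *v axis i 1 = 0"
        using psd_isotropic_eq_0 insert.prems(1) unfolding m_def by blast
      then have "\<exists>A. M = A ** ctr A \<and> (\<forall>j. j \<notin> S \<longrightarrow> A *v axis j 1 = 0)"
        using insert.prems by (intro insert.IH) auto
      then show ?thesis by auto
    next
      case 2
      let ?D = "deflate M (axis i 1)"
      have "?D *v axis j 1 = 0" if "j \<notin> S" for j
      proof (cases "j = i")
        case True
        then show ?thesis using deflate_mult_vector[OF insert.prems(1)] 2 by (simp add: m_def)
      next
        case False
        then have "M *v axis j 1 = 0" using insert.prems that by auto
        then show ?thesis
          using psd_ctr[OF insert.prems(1)]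
          by (simp add: deflate_def matrix_vector_mult_diff_rdistrib matrix_vector_scaleR
              outer_mult_vector hf_matrix_left)
      qed
      with psd_deflate[OF insert.prems(1)] 2 have "\<exists>A. ?D = A ** ctr A \<and> (\<forall>j. j \<notin> S \<longrightarrow> A *v axis j 1 = 0)"
        by (intro insert.IH) (auto simp: m_def)
      then obtain A where A: "?D = A ** ctr A" "\<And>j. j \<notin> S \<Longrightarrow> A *v axis j 1 = 0" by blast
      \<comment> \<open>Column \<open>i\<close> of \<open>A\<close> is zero, which leaves room for
        the vector \<open>a / sqrt m\<close> there; its square restores the piece removed by
        deflation.\<close>
      define B where "B = A + (1 / sqrt m) *\<^sub>R outer a (axis i 1)"
      have Ai: "A *v axis i 1 = 0" using A(2) insert.hyps by simp
      have AX: "A ** ctr (outer a (axis i 1)) = 0"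
        by (simp add: ctr_outer matrix_mult_outer Ai)
      have XA: "outer a (axis i 1) ** ctr A = 0"
        using AX by (metis ctr_ctr ctr_eq_0_iff ctr_mult)
      have XX: "outer a (axis i 1) ** ctr (outer a (axis i 1)) = outer a a"
        by (simp add: ctr_outer matrix_mult_outer outer_mult_vector hf_axis)
      have "B ** ctr B = A ** ctr A + (1/m) *\<^sub>R outer a a"
        using 2 by (simp add: B_def ctr_simps msimps AX XA XX)
      also have "\<dots> = M"
        using A(1) by (simp add: deflate_def m_def a_def algebra_simps)
      finally have "M = B ** ctr B" ..
      moreover have "B *v axis j 1 = 0" if "j \<notin> insert i S" for j
        using A(2)[of j] that
        by (simp add: B_def matrix_vector_mult_add_rdistrib matrix_vector_scaleR outer_mult_vector hf_axis)
           (simp add: axis_def)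
      ultimately show ?thesis by blast
    qed
  qed
  from this[of UNIV M] assms that show ?thesis by auto
qed

text \<open>Rank is lower semicontinuous: \<open>A\<close> is injective on the range of
  \<open>ctr A\<close>, hence bounded below there by some \<open>e\<close>, and a perturbation of
  operator norm less than \<open>e\<close> stays injective on that space.\<close>

lemma closed_rdim_le: "closed {A :: 'a::involutive_algebra^'n^'m. rdim A \<le> k}"
proof -
  have "open {A :: 'a^'n^'m. k < rdim A}"
    unfolding open_dist
  proof safe
    fix A :: "'a^'n^'m" assume k: "k < rdim A"
    let ?U = "range ((*v) (ctr A))"
    have inj: "u = 0" if u: "u \<in> ?U" "A *v u = 0" for u
    proof -
      obtain w where w: "u = ctr A *v w" using u(1) by auto
      have "(A ** ctr A) *v w = 0" using u(2) w by (simp add: matrix_vector_mul_assoc)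
      then show ?thesis using ker_mult_ctr[of A] w by blast
    qed
    have "closed ?U" by (simp add: closed_subspace subspace_range_matrix)
    then obtain e where e: "e > 0" "\<And>u. u \<in> ?U \<Longrightarrow> norm (A *v u) \<ge> e * norm u"
      using injective_imp_isometric[of ?U "(*v) A"] inj subspace_range_matrix[of "ctr A"]
        linear_conv_bounded_linear[of "(*v) A"] matrix_vector_mul_linear[of A] by blast
    obtain K where K: "K > 0" "\<And>(B :: 'a^'n^'m) v. norm (B *v v) \<le> norm B * norm v * K"
      using bounded_bilinear.pos_bounded[OF bounded_bilinear_matrix_vector] by blast
    have "rdim B > k" if B: "dist B A < e / K" for B
    proof -
      have eK: "norm (B - A) * K < e" using B K(1) by (simp add: dist_norm field_simps)
      have inj: "u = 0" if "u \<in> ?U" "B *v u = 0" for u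
      proof (rule ccontr)
        assume "u \<noteq> 0"
        have "e * norm u \<le> norm (A *v u)" using e that by blast
        also have "\<dots> = norm ((B - A) *v u)"
          using that by (simp add: matrix_vector_mult_diff_rdistrib)
        also have "\<dots> \<le> (norm (B - A) * K) * norm u" using K(2)[of "B - A" u] by (simp add: mult.commute mult.left_commute)
        also have "\<dots> < e * norm u" using eK \<open>u \<noteq> 0\<close> by simp
        finally show False by simp
      qed
      have "inj_on ((*v) B) ?U"
      proof (rule inj_onI)
        fix u v assume "u \<in> ?U" "v \<in> ?U" "B *v u = B *v v"
        then have "u - v = 0"
          by (intro inj subspace_diff[OF subspace_range_matrix]) (auto simp: matrix_vector_mult_diff_distrib)
        then show "u = v" by simp
      qed
      then have "inj_on ((*v) B) (span ?U)"
        using subspace_range_matrix[of "ctr A"] by (simp only: span_eq_iff[symmetric])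
      then have "dim ((*v) B ` ?U) = dim ?U"
        by (rule dim_image_eq[OF matrix_vector_mul_linear])
      moreover have "dim ((*v) B ` ?U) \<le> rdim B"
        unfolding rdim_def by (intro dim_subset) auto
      ultimately show ?thesis using k rdim_ctr[of A] by (simp add: rdim_def)
    qed
    then show "\<exists>e>0. \<forall>B. dist B A < e \<longrightarrow> B \<in> {A. k < rdim A}"
      using e(1) K(1) by (intro exI[of _ "e / K"]) auto
  qed
  moreover have "- {A :: 'a^'n^'m. k < rdim A} = {A. rdim A \<le> k}" by auto
  ultimately show ?thesis by (metis closed_def double_complement)
qed

lemma closed_psd: "closed {M :: 'a::involutive_algebra^'n^'n. psd M}"
proof -
  have "closed {M :: 'a^'n^'n. ctr M = M}"
    by (intro closed_Collect_eq linear_continuous_on continuous_on_id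
        linear_conv_bounded_linear[THEN iffD1] linear_ctr)
  moreover have "closed {M :: 'a^'n^'n. inner v (M *v v) \<ge> 0}" for v
    by (intro closed_Collect_le continuous_intros bounded_bilinear.continuous_on[OF bounded_bilinear_matrix_vector])
  then have "closed {M :: 'a^'n^'n. \<forall>v. inner v (M *v v) \<ge> 0}"
    by (intro closed_Collect_all)
  moreover have "{M :: 'a^'n^'n. psd M} = {M. ctr M = M} \<inter> {M. \<forall>v. inner v (M *v v) \<ge> 0}"
    by (auto simp: psd_def)
  ultimately show ?thesis by auto
qed

section \<open>The matrix exponential\<close>

text \<open>A copy of the bounded endomorphisms that carries composition as its multiplication. It
  becomes a unital Banach algebra, so \<open>exp\<close> and its laws apply to left and right
  multiplication by a matrix.\<close>

typedef (overloaded) ('a::real_normed_vector) endo = "UNIV :: ('a \<Rightarrow>\<^sub>L 'a) set" ..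

setup_lifting type_definition_endo

instantiation endo :: (real_normed_vector) real_vector
begin

lift_definition zero_endo :: "'a endo" is 0 .
lift_definition plus_endo :: "'a endo \<Rightarrow> 'a endo \<Rightarrow> 'a endo" is "(+)" .
lift_definition minus_endo :: "'a endo \<Rightarrow> 'a endo \<Rightarrow> 'a endo" is "(-)" .
lift_definition uminus_endo :: "'a endo \<Rightarrow> 'a endo" is uminus .
lift_definition scaleR_endo :: "real \<Rightarrow> 'a endo \<Rightarrow> 'a endo" is "(*\<^sub>R)" .

instance
  by standard (transfer; simp add: algebra_simps)+

end

instantiation endo :: (euclidean_space) real_normed_algebra_1
begin

lift_definition one_endo :: "'a endo" is id_blinfun .
lift_definition times_endo :: "'a endo \<Rightarrow> 'a endo \<Rightarrow> 'a endo" is "(o\<^sub>L)" .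
lift_definition norm_endo :: "'a endo \<Rightarrow> real" is norm .
definition "sgn_endo x = x /\<^sub>R norm (x :: 'a endo)"
definition "dist_endo x y = norm (x - y :: 'a endo)"
definition [code del]:
  "(uniformity :: ('a endo \<times> 'a endo) filter) = (INF e\<in>{0 <..}. principal {(x, y). dist x y < e})"
definition [code del]:
  "open (U :: 'a endo set) \<longleftrightarrow> (\<forall>x\<in>U. eventually (\<lambda>(x', y). x' = x \<longrightarrow> y \<in> U) uniformity)"

instance
proof
  fix x y z :: "'a endo" and a :: real
  show "a *\<^sub>R x * y = a *\<^sub>R (x * y)" "x * a *\<^sub>R y = a *\<^sub>R (x * y)"
    by (transfer; rule blinfun_eqI; simp add: blinfun.bilinear_simps)+
  show "x * y * z = x * (y * z)" "(x + y) * z = x * z + y * z" "x * (y + z) = x * y + x * z"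
    by (transfer; rule blinfun_eqI; simp add: blinfun.bilinear_simps)+
  show "1 * x = x" "x * 1 = x"
    by (transfer; rule blinfun_eqI; simp)+
  show "norm (x * y) \<le> norm x * norm y" by (simp add: norm_endo.rep_eq times_endo.rep_eq norm_blinfun_compose)
  show "norm (1 :: 'a endo) = 1"
    by (simp add: norm_endo.rep_eq one_endo.rep_eq)
  show "norm (x + y) \<le> norm x + norm y"
    by (simp add: norm_endo.rep_eq plus_endo.rep_eq norm_triangle_ineq)
  show "norm (a *\<^sub>R x) = \<bar>a\<bar> * norm x"
    by (simp add: norm_endo.rep_eq scaleR_endo.rep_eq)
  show "(norm x = 0) = (x = 0)"
    by (simp add: norm_endo.rep_eq zero_endo.rep_eq flip: Rep_endo_inject)
  have "norm (1 :: 'a endo) = 1" "norm (0 :: 'a endo) = 0"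
    by (simp_all add: norm_endo.rep_eq one_endo.rep_eq zero_endo.rep_eq)
  then show "(0 :: 'a endo) \<noteq> 1" by force
qed (simp_all add: sgn_endo_def dist_endo_def uniformity_endo_def open_endo_def)

end

instance endo :: (euclidean_space) banach
proof
  fix X :: "nat \<Rightarrow> 'a endo"
  assume "Cauchy X"
  have d: "dist (Rep_endo x) (Rep_endo y) = dist x y" for x y :: "'a endo"
    by (simp add: dist_norm norm_endo.rep_eq minus_endo.rep_eq)
  have "Cauchy (\<lambda>n. Rep_endo (X n))"
    using \<open>Cauchy X\<close> by (simp add: Cauchy_def d)
  then obtain L where L: "(\<lambda>n. Rep_endo (X n)) \<longlonglongrightarrow> L"
    using Cauchy_convergent convergent_def by blast
  have "dist (X n) (Abs_endo L) = dist (Rep_endo (X n)) L" for n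
    using d[of "X n" "Abs_endo L"] by (simp only: Abs_endo_inverse[OF UNIV_I])
  with L have "X \<longlonglongrightarrow> Abs_endo L"
    by (simp add: tendsto_iff)
  then show "convergent X" by (auto simp: convergent_def)
qed

lift_definition app :: "'a::euclidean_space endo \<Rightarrow> 'a \<Rightarrow> 'a" is blinfun_apply .
lift_definition endo_of :: "('a::euclidean_space \<Rightarrow> 'a) \<Rightarrow> 'a endo" is Blinfun .

lemma app_endo_of: "linear f \<Longrightarrow> app (endo_of f) = f"
  by (simp add: app.rep_eq endo_of.rep_eq bounded_linear_Blinfun_apply linear_linear)

lemma app_times: "app (S * T) x = app S (app T x)"
  by (simp add: app.rep_eq times_endo.rep_eq)

lemma app_1 [simp]: "app 1 x = x"
  by (simp add: app.rep_eq one_endo.rep_eq)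

lemma app_simps: "app (S + T) x = app S x + app T x" "app (S - T) x = app S x - app T x"
  "app (- S) x = - app S x" "app (r *\<^sub>R S) x = r *\<^sub>R app S x"
  by (simp_all add: app.rep_eq plus_endo.rep_eq minus_endo.rep_eq uminus_endo.rep_eq
      scaleR_endo.rep_eq blinfun.bilinear_simps)

lemma app_power: "app (T ^ n) x = (app T ^^ n) x"
  by (induction n arbitrary: x) (auto simp: app_times)

lemma bounded_linear_app: "bounded_linear (\<lambda>T. app T x)"
proof (rule bounded_linear_intro)
  show "norm (app T x) \<le> norm T * norm x" for T
    by (simp add: app.rep_eq norm_endo.rep_eq norm_blinfun)
qed (simp_all add: app_simps)

lemma endo_eqI: "(\<And>x. app S x = app T x) \<Longrightarrow> S = T"
  by (simp add: app.rep_eq blinfun_eqI flip: Rep_endo_inject)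

lemma app_exp_sums: "(\<lambda>n. (app T ^^ n) x /\<^sub>R fact n) sums app (exp T) x"
  using bounded_linear.sums[OF bounded_linear_app exp_converges, of T x]
  by (simp add: app_simps app_power)

section \<open>From the operator exponential to matrices\<close>

definition lmul :: "'a::involutive_algebra^'n^'n \<Rightarrow> ('a^'n^'n) endo" where
  "lmul Y = endo_of ((**) Y)"

definition rmul :: "'a::involutive_algebra^'n^'n \<Rightarrow> ('a^'n^'n) endo" where
  "rmul Y = endo_of (\<lambda>X. X ** Y)"

text \<open>The operator exponential of left multiplication, evaluated at the identity; by
  \<open>app_exp_lmul\<close> the whole operator is left multiplication by this matrix.\<close>

definition mexp :: "'a::involutive_algebra^'n^'n \<Rightarrow> 'a^'n^'n" where
  "mexp Y = app (exp (lmul Y)) (mat 1)"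

definition mpow :: "'a::semiring_1^'n^'n \<Rightarrow> nat \<Rightarrow> 'a^'n^'n" where
  "mpow Y n = ((**) Y ^^ n) (mat 1)"

lemma app_lmul: "app (lmul Y) = (**) Y"
  unfolding lmul_def by (rule app_endo_of, rule linearI) (auto simp: msimps)

lemma app_rmul: "app (rmul Y) = (\<lambda>X. X ** Y)"
  unfolding rmul_def by (rule app_endo_of, rule linearI) (auto simp: msimps)

lemma mpow_0 [simp]: "mpow Y 0 = mat 1"
  by (simp add: mpow_def)

lemma mpow_Suc: "mpow Y (Suc n) = Y ** mpow Y n"
  by (simp add: mpow_def)

lemma mpow_Suc2: "mpow Y (Suc n) = mpow Y n ** Y"
proof (induction n)
  case (Suc n)
  have "mpow Y (Suc (Suc n)) = Y ** (mpow Y n ** Y)"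
    by (simp only: mpow_Suc[of _ "Suc n"] Suc)
  also have "\<dots> = (Y ** mpow Y n) ** Y"
    by (rule matrix_mul_assoc)
  finally show ?case by (simp only: mpow_Suc)
qed (simp add: mpow_Suc)

lemma mpow_add: "mpow Y (m + n) = mpow Y m ** mpow Y n"
  by (induction m) (simp_all add: mpow_Suc matrix_mul_assoc)

lemma lmul_funpow: "((**) Y ^^ n) X = mpow Y n ** X"
  by (induction n) (simp_all add: mpow_Suc matrix_mul_assoc)

lemma rmul_funpow: "((\<lambda>X. X ** Y) ^^ n) X = X ** mpow Y n"
  by (induction n) (simp_all add: mpow_Suc2 matrix_mul_assoc)

lemma ctr_mpow: "ctr (mpow Y n) = mpow (ctr Y :: 'a::involutive_algebra^'n^'n) n"
  by (induction n) (simp_all add: ctr_mult mpow_Suc2 flip: mpow_Suc)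

lemma mexp_sums: "(\<lambda>n. mpow Y n /\<^sub>R fact n) sums mexp Y"
  using app_exp_sums[of "lmul Y" "mat 1"] by (simp add: app_lmul lmul_funpow mexp_def)

lemma app_exp_lmul: "app (exp (lmul Y)) X = mexp Y ** X"
proof -
  have "(\<lambda>n. (mpow Y n /\<^sub>R fact n) ** X) sums (mexp Y ** X)"
    by (rule bounded_linear.sums[OF bounded_bilinear.bounded_linear_left[OF bounded_bilinear_matrix] mexp_sums])
  moreover have "(\<lambda>n. (mpow Y n /\<^sub>R fact n) ** X) sums app (exp (lmul Y)) X"
    using app_exp_sums[of "lmul Y" X] by (simp add: app_lmul lmul_funpow msimps)
  ultimately show ?thesis by (rule sums_unique2[symmetric])
qed

lemma app_exp_rmul: "app (exp (rmul Y)) X = X ** mexp Y"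
proof -
  have "(\<lambda>n. X ** (mpow Y n /\<^sub>R fact n)) sums (X ** mexp Y)"
    by (rule bounded_linear.sums[OF bounded_bilinear.bounded_linear_right[OF bounded_bilinear_matrix] mexp_sums])
  moreover have "(\<lambda>n. X ** (mpow Y n /\<^sub>R fact n)) sums app (exp (rmul Y)) X"
    using app_exp_sums[of "rmul Y" X] by (simp add: app_rmul rmul_funpow msimps)
  ultimately show ?thesis by (rule sums_unique2[symmetric])
qed

lemma lmul_minus: "lmul (- Y) = - lmul Y"
  by (rule endo_eqI) (simp add: app_lmul app_simps msimps)

lemma rmul_minus: "rmul (- Y) = - rmul Y"
  by (rule endo_eqI) (simp add: app_rmul app_simps msimps)

lemma mexp_minus: "mexp Y ** mexp (- Y) = mat 1" "mexp (- Y) ** mexp Y = mat 1"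
proof -
  have *: "mexp Y ** mexp (- Y) = mat 1" for Y :: "'a^'n^'n"
  proof -
    have "mexp Y ** mexp (- Y) = app (exp (lmul Y)) (app (exp (lmul (- Y))) (mat 1))"
      by (simp only: app_exp_lmul matrix_mul_rid)
    also have "\<dots> = app (exp (lmul Y) * exp (- lmul Y)) (mat 1)"
      by (simp only: app_times lmul_minus)
    also have "\<dots> = mat 1"
      by (simp only: exp_minus_inverse app_1)
    finally show ?thesis .
  qed
  show "mexp Y ** mexp (- Y) = mat 1" by (rule *)
  show "mexp (- Y) ** mexp Y = mat 1" using *[of "- Y"] by simp
qed

lemma bounded_linear_ctr: "bounded_linear (ctr :: 'a::involutive_algebra^'n^'m \<Rightarrow> _)"
  using linear_ctr by (simp add: linear_linear)

lemma ctr_mexp: "ctr (mexp Y) = mexp (ctr Y)"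
proof -
  have "(\<lambda>n. ctr (mpow Y n /\<^sub>R fact n)) sums ctr (mexp Y)"
    by (rule bounded_linear.sums[OF bounded_linear_ctr mexp_sums])
  then have "(\<lambda>n. mpow (ctr Y) n /\<^sub>R fact n) sums ctr (mexp Y)"
    by (simp add: ctr_scaleR ctr_mpow)
  then show ?thesis using mexp_sums by (rule sums_unique2)
qed

lemma mexp_conj:
  fixes G H Y :: "'a::involutive_algebra^'n^'n"
  assumes "H ** G = mat 1"
  shows "mexp (G ** Y ** H) = G ** mexp Y ** H"
proof -
  have pow: "mpow (G ** Y ** H) n = G ** mpow Y n ** H" for n
  proof (induction n)
    case 0
    then show ?case using left_inverse_imp_right_inverse[OF assms] by simp
  next
    case (Suc n)
    have "mpow (G ** Y ** H) (Suc n) = G ** Y ** (H ** G) ** mpow Y n ** H"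
      by (simp add: mpow_Suc Suc matrix_mul_assoc)
    then show ?case by (simp add: assms mpow_Suc matrix_mul_assoc)
  qed
  have "bounded_linear (\<lambda>X. G ** X ** H)"
    by (rule linear_conv_bounded_linear[THEN iffD1], rule linearI) (auto simp: msimps)
  from bounded_linear.sums[OF this mexp_sums[of Y]]
  have "(\<lambda>n. mpow (G ** Y ** H) n /\<^sub>R fact n) sums (G ** mexp Y ** H)"
    by (simp add: msimps pow)
  with mexp_sums show ?thesis by (rule sums_unique2)
qed

text \<open>ad Y is the difference of left and right multiplication by Y. These commute, so the
  exponential splits into a product.\<close>

lemma exp_ad_eq: "exp_ad Y X = mexp Y ** X ** mexp (- Y)"
proof -
  have "app (lmul Y + - rmul Y) = lie Y"
    by (rule ext) (simp add: app_simps app_lmul app_rmul lie_def)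
  then have "exp_ad Y X = app (exp (lmul Y + - rmul Y)) X"
    using sums_unique[OF app_exp_sums[of "lmul Y + - rmul Y" X]] by (simp add: exp_ad_def)
  also have "lmul Y * - rmul Y = - rmul Y * lmul Y"
    by (rule endo_eqI) (simp add: app_times app_lmul app_rmul app_simps msimps matrix_mul_assoc)
  then have "exp (lmul Y + - rmul Y) = exp (lmul Y) * exp (- rmul Y)"
    by (rule exp_add_commuting)
  also have "app \<dots> X = mexp Y ** X ** mexp (- Y)"
    by (simp add: app_times app_exp_lmul app_exp_rmul matrix_mul_assoc flip: rmul_minus)
  finally show ?thesis .
qed

lemma mexp_has_vector_derivative_0:
  "((\<lambda>t. mexp (t *\<^sub>R Y)) has_vector_derivative Y) (at 0)"
proof -
  have "((\<lambda>t. app (exp (t *\<^sub>R lmul Y)) (mat 1)) has_vector_derivative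
      app (exp (0 *\<^sub>R lmul Y) * lmul Y) (mat 1)) (at 0)"
    by (rule bounded_linear.has_vector_derivative[OF bounded_linear_app exp_scaleR_has_vector_derivative_right])
  moreover have "t *\<^sub>R lmul Y = lmul (t *\<^sub>R Y)" for t
    by (rule endo_eqI) (simp add: app_lmul app_simps msimps)
  moreover have "app (exp (0 *\<^sub>R lmul Y) * lmul Y) (mat 1) = Y"
    by (simp add: app_times app_lmul)
  ultimately show ?thesis by (simp only: mexp_def)
qed

lemma continuous_on_mexp: "continuous_on S (\<lambda>t::real. mexp (t *\<^sub>R Y))"
proof -
  have "t *\<^sub>R lmul Y = lmul (t *\<^sub>R Y)" for t
    by (rule endo_eqI) (simp add: app_lmul app_simps msimps)
  then have "mexp (t *\<^sub>R Y) = app (exp (t *\<^sub>R lmul Y)) (mat 1)" for t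
    by (simp add: mexp_def)
  moreover have "continuous_on S (\<lambda>t. exp (t *\<^sub>R lmul Y))"
    by (rule continuous_on_vector_derivative[OF exp_scaleR_has_vector_derivative_right])
  ultimately show ?thesis
    by (simp add: bounded_linear.continuous_on[OF bounded_linear_app])
qed

lemma mexp_square_zero:
  assumes "Y ** Y = 0"
  shows "mexp Y = mat 1 + Y"
proof -
  have "mpow Y n = 0" if n: "n \<notin> {0,1}" for n
  proof -
    obtain k where "n = Suc (Suc k)" using n by (cases n; cases "n - 1") auto
    then show ?thesis by (simp add: mpow_Suc matrix_mul_assoc assms)
  qed
  then have "(\<lambda>n. mpow Y n /\<^sub>R fact n) sums (\<Sum>n\<in>{0,1}. mpow Y n /\<^sub>R fact n)"
    by (intro sums_finite) auto
  then have "(\<lambda>n. mpow Y n /\<^sub>R fact n) sums (mat 1 + Y)"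
    by (simp add: mpow_Suc)
  with mexp_sums show ?thesis by (rule sums_unique2)
qed

subsection \<open>A polar decomposition\<close>

text \<open>Among all unitary \<open>U\<close>, one that maximises the real part of the trace of \<open>C ** U\<close> makes \<open>C ** U\<close>
  hermitian, because the first variation along \<open>U ** mexp (t *\<^sub>R K)\<close> vanishes for skew-hermitian \<open>K\<close>.\<close>

lemma exists_unitary_hermitian_mult:
  fixes C :: "'a::involutive_algebra^'n^'n"
  obtains U :: "'a^'n^'n" where "ctr U ** U = mat 1" "U ** ctr U = mat 1" "ctr (C ** U) = C ** U"
proof -
  define S where "S = {U :: 'a^'n^'n. ctr U ** U = mat 1 \<and> U ** ctr U = mat 1}"
  have "closed S"
    unfolding S_def
    by (intro closed_Collect_conj closed_Collect_eq continuous_intros linear_continuous_on bounded_linear_ctr)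
  \<comment> \<open>Unitary matrices all have the norm of the identity, so the group is
    bounded.\<close>
  moreover have "norm U = norm (mat 1 :: 'a^'n^'n)" if "U \<in> S" for U
  proof -
    have "inner U U = inner (mat 1 :: 'a^'n^'n) (mat 1)"
      using that inner_mult_left_ctr[of U "mat 1" U] by (simp add: S_def)
    then show ?thesis by (simp add: norm_eq_sqrt_inner)
  qed
  then have "bounded S" by (auto simp: bounded_iff intro!: exI[of _ "norm (mat 1 :: 'a^'n^'n)"])
  ultimately have "compact S" by (simp add: compact_eq_bounded_closed)
  moreover have "S \<noteq> {}" by (auto simp: S_def intro!: exI[of _ "mat 1"])
  moreover have "continuous_on S (\<lambda>U. inner (ctr C) U)" by (intro continuous_intros)
  ultimately obtain U where U: "U \<in> S" and max: "\<And>W. W \<in> S \<Longrightarrow> inner (ctr C) W \<le> inner (ctr C) U"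
    by (metis continuous_attains_sup)
  define P where "P = C ** U"
  have *: "inner (ctr P) K = 0" if K: "ctr K = - K" for K
  proof -
    let ?f = "\<lambda>t. inner (ctr C) (U ** mexp (t *\<^sub>R K))"
    have in_S: "U ** mexp (t *\<^sub>R K) \<in> S" for t
    proof -
      have c: "ctr (mexp (t *\<^sub>R K)) = mexp (- (t *\<^sub>R K))"
        by (simp add: ctr_mexp ctr_scaleR K)
      have 1: "ctr U ** U = mat 1" "U ** ctr U = mat 1" using U by (auto simp: S_def)
      have "ctr (U ** mexp (t *\<^sub>R K)) ** (U ** mexp (t *\<^sub>R K))
          = mexp (- (t *\<^sub>R K)) ** (ctr U ** U) ** mexp (t *\<^sub>R K)"
        by (simp add: ctr_mult c matrix_mul_assoc)
      moreover have "(U ** mexp (t *\<^sub>R K)) ** ctr (U ** mexp (t *\<^sub>R K))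
          = U ** (mexp (t *\<^sub>R K) ** mexp (- (t *\<^sub>R K))) ** ctr U"
        by (simp add: ctr_mult c matrix_mul_assoc)
      ultimately show ?thesis by (simp add: S_def 1 mexp_minus)
    qed
    have "((\<lambda>t. U ** mexp (t *\<^sub>R K)) has_vector_derivative U ** K) (at 0)"
      by (rule bounded_linear.has_vector_derivative[OF
          bounded_bilinear.bounded_linear_right[OF bounded_bilinear_matrix] mexp_has_vector_derivative_0])
    then have "(?f has_vector_derivative inner (ctr C) (U ** K)) (at 0)"
      by (rule bounded_linear.has_vector_derivative[OF bounded_linear_inner_right])
    then have d: "(?f has_real_derivative inner (ctr C) (U ** K)) (at 0)"
      by (simp add: has_real_derivative_iff_has_vector_derivative)
    have "?f t \<le> ?f 0" for t
    proof -
      have "mexp (0 *\<^sub>R K) = mat 1" by (simp add: mexp_square_zero)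
      then show ?thesis using max[OF in_S] by simp
    qed
    then have "inner (ctr C) (U ** K) = 0"
      using DERIV_local_max[OF d, of 1] by simp
    then show ?thesis
      by (simp add: P_def ctr_mult) (metis ctr_ctr inner_mult_left_ctr inner_commute)
  qed
  \<comment> \<open>The skew part of \<open>P\<close> is itself an admissible direction. It is
    orthogonal to \<open>ctr P\<close>, and after conjugate transposition also to \<open>P\<close>,
    hence to itself.\<close>
  have "inner (ctr P) (ctr P - P) = 0" by (rule *) (simp add: ctr_diff)
  moreover have "inner P (ctr P - P) = - inner (ctr P) (ctr P - P)"
    using inner_ctr[of P "ctr P - P"] by (simp add: ctr_diff inner_diff_right)
  ultimately have "inner (ctr P - P) (ctr P - P) = 0"
    by (simp add: inner_diff_left)
  then have "ctr P = P" by simp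
  then show ?thesis using that[of U] U by (auto simp: S_def P_def)
qed

text \<open>Induction on the rank, splitting off one piece of rank one at a time.\<close>

lemma exists_generalised_inverse: "\<exists>G. C ** G ** C = C" for C :: "'a::involutive_algebra^'n^'n"
proof (induction "rdim C" arbitrary: C rule: less_induct)
  case less
  show ?case
  proof (cases "C = 0")
    case False
    then obtain x where x: "C *v x \<noteq> 0" by (auto simp: matrix_eq)
    define y where "y = C *v x"
    \<comment> \<open>Scaled so that \<open>outer y n\<close> is a projection onto the line through
      \<open>y\<close>; \<open>p\<close> is the complementary one.\<close>
    define n where "n = (1 / (norm y)\<^sup>2) *\<^sub>R y"
    have ny: "hf n y = 1"
      using x by (simp add: n_def y_def hf_scaleR_left hf_self of_real_def)
    define p where "p = mat 1 - outer y n"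
    have sub: "range ((*v) (p ** C)) \<subseteq> range ((*v) C)"
    proof safe
      fix v
      have "(p ** C) *v v = C *v v - y *r hf n (C *v v)"
        by (simp add: p_def matrix_vector_mul_assoc[symmetric] matrix_vector_mult_diff_rdistrib outer_mult_vector)
      also have "\<dots> = C *v (v - x *r hf n (C *v v))"
        by (simp add: matrix_vector_mult_diff_distrib matrix_vector_scr y_def)
      finally show "(p ** C) *v v \<in> range ((*v) C)" by simp
    qed
    have hn: "hf n (p *v v) = 0" for v
      by (simp add: p_def matrix_vector_mult_diff_rdistrib outer_mult_vector hf_simps ny)
    have "y \<notin> range ((*v) (p ** C))"
      using hn ny by (auto simp: matrix_vector_mul_assoc[symmetric])
    with sub have "range ((*v) (p ** C)) \<subset> range ((*v) C)" by (auto simp: y_def)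
    then have "span (range ((*v) (p ** C))) \<subset> span (range ((*v) C))"
      using subspace_range_matrix[of C] subspace_range_matrix[of "p ** C"] by (simp only: span_eq_iff[symmetric])
    then have "rdim (p ** C) < rdim C"
      unfolding rdim_def by (rule dim_psubset)
    from less[OF this] obtain G where G: "p ** C ** G ** (p ** C) = p ** C" ..
    \<comment> \<open>\<open>G\<close> inverts the part seen through \<open>p\<close>. What is then
      still missing is a multiple of \<open>y = C *v x\<close>, and the second summand supplies its
      preimage along \<open>x\<close>.\<close>
    define H where "H = G ** p + outer x n ** (mat 1 - C ** G ** p)"
    have split: "v = p *v v + y *r hf n v" for v
      by (simp add: p_def matrix_vector_mult_diff_rdistrib outer_mult_vector)
    have "(C ** H ** C) *v v = C *v v" for v
    proof -
      define w where "w = (C ** G ** p ** C) *v v"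
      have "p *v w = (p ** C) *v v"
        unfolding w_def using G by (metis matrix_mul_assoc matrix_vector_mul_assoc)
      then have w: "w = (p ** C) *v v + y *r hf n w"
        using split[of w] by simp
      have Cw: "C *v ((G ** p) *v (C *v v)) = w" "(C ** G ** p) *v (C *v v) = w"
        by (simp_all add: w_def matrix_vector_mul_assoc matrix_mul_assoc)
      have "H *v u = (G ** p) *v u + x *r hf n (u - (C ** G ** p) *v u)" for u
        by (simp add: H_def matrix_vector_mult_add_rdistrib outer_mult_vector
            matrix_vector_mult_diff_rdistrib flip: matrix_vector_mul_assoc)
      then have "C *v (H *v (C *v v)) = w + y *r hf n (C *v v - w)"
        by (simp add: matrix_vector_right_distrib matrix_vector_scr Cw y_def)
      then have "(C ** H ** C) *v v = w + y *r hf n (C *v v - w)"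
        by (simp add: matrix_vector_mul_assoc matrix_mul_assoc)
      also have "\<dots> = (p ** C) *v v + y *r hf n (C *v v)"
        by (subst w) (simp add: hf_diff_right scr_diff_right)
      also have "\<dots> = C *v v"
        using split[of "C *v v"] by (simp add: matrix_vector_mul_assoc)
      finally show ?thesis .
    qed
    then show ?thesis by (auto simp: matrix_eq)
  qed (auto intro: exI[of _ 0])
qed

text \<open>If \<open>G\<close> is a generalised inverse of the hermitian \<open>C\<close>, so is
  \<open>ctr G\<close>, and then so is the hermitian matrix \<open>ctr G ** C ** G\<close>.\<close>

lemma exists_hermitian_generalised_inverse:
  fixes C :: "'a::involutive_algebra^'n^'n"
  assumes "ctr C = C"
  obtains H where "ctr H = H" "C ** H ** C = C"
proof -
  obtain G where G: "C ** G ** C = C" using exists_generalised_inverse by blast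
  have "ctr (C ** G ** C) = C" by (simp only: G assms)
  then have G': "C ** ctr G ** C = C"
    by (simp add: ctr_mult assms matrix_mul_assoc)
  have "C ** (ctr G ** C ** G) ** C = (C ** ctr G ** C) ** G ** C"
    by (simp add: matrix_mul_assoc)
  then show ?thesis
    using that[of "ctr G ** C ** G"] by (simp add: G G' ctr_mult assms matrix_mul_assoc)
qed

section \<open>Smooth maps\<close>

lemma Ck_on_cong:
  assumes "open S" "\<And>x. x \<in> S \<Longrightarrow> f x = g x" "Ck_on k S f"
  shows "Ck_on k S g"
  using assms(2,3)
proof (induction k arbitrary: f g)
  case 0
  then show ?case by (auto cong: continuous_on_cong)
next
  case (Suc k)
  have der: "(g has_derivative frechet_derivative f (at x)) (at x)" if x: "x \<in> S" for x
  proof -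
    have "(f has_derivative frechet_derivative f (at x)) (at x)"
      using Suc.prems(2) x frechet_derivative_works by auto
    then show ?thesis
      by (rule has_derivative_transform_within_open[OF _ assms(1) x Suc.prems(1)])
  qed
  have "Ck_on k S (\<lambda>x. frechet_derivative g (at x) v)" for v
  proof (rule Suc.IH)
    show "frechet_derivative f (at x) v = frechet_derivative g (at x) v" if "x \<in> S" for x
      using frechet_derivative_at[OF der[OF that]] by simp
    show "Ck_on k S (\<lambda>x. frechet_derivative f (at x) v)" using Suc.prems(2) by simp
  qed
  then show ?case using der by (auto simp: differentiable_def)
qed

text \<open>Lets any explicit family of derivatives stand in for \<open>frechet_derivative\<close>;
  the closure properties below are proved in this form.\<close>

lemma Ck_on_Suc:
  assumes "open S" and f: "\<And>x. x \<in> S \<Longrightarrow> (f has_derivative F x) (at x)"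
    and F: "\<And>v. Ck_on k S (\<lambda>x. F x v)"
  shows "Ck_on (Suc k) S f"
proof -
  have "frechet_derivative f (at x) = F x" if "x \<in> S" for x
    using frechet_derivative_at[OF f[OF that]] by simp
  then have "Ck_on k S (\<lambda>x. frechet_derivative f (at x) v)" for v
    by (intro Ck_on_cong[OF assms(1) _ F[of v]]) simp
  then show ?thesis using f by (auto simp: differentiable_def)
qed

lemma Ck_on_SucE:
  assumes "Ck_on (Suc k) S f"
  obtains F where "\<And>x. x \<in> S \<Longrightarrow> (f has_derivative F x) (at x)" "\<And>v. Ck_on k S (\<lambda>x. F x v)"
  using assms that[of "\<lambda>x. frechet_derivative f (at x)"] by (auto simp: frechet_derivative_works)

lemma Ck_on_SucD: "Ck_on (Suc k) S f \<Longrightarrow> Ck_on k S f"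
proof (induction k arbitrary: f)
  case 0
  then show ?case
    by (auto intro!: continuous_at_imp_continuous_on differentiable_imp_continuous_within)
next
  case (Suc k)
  then show ?case by (auto simp del: Ck_on.simps(2) simp: Ck_on.simps(2)[of "Suc k"] Ck_on.simps(2)[of k])
qed

lemma Ck_on_const: "open S \<Longrightarrow> Ck_on k S (\<lambda>x. c)"
proof (induction k arbitrary: c)
  case (Suc k)
  show ?case by (rule Ck_on_Suc[where F = "\<lambda>x v. 0"]) (use Suc in auto)
qed simp

lemma Ck_on_linear:
  assumes "open S" "bounded_linear f"
  shows "Ck_on k S f"
proof (cases k)
  case 0
  then show ?thesis by (simp add: linear_continuous_on assms)
next
  case (Suc j)
  have "Ck_on (Suc j) S f"
    by (rule Ck_on_Suc[where F = "\<lambda>x. f"])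
       (use assms in \<open>auto intro: bounded_linear_imp_has_derivative Ck_on_const\<close>)
  then show ?thesis using Suc by simp
qed

lemma Ck_on_compose_linear:
  assumes S: "open S" and h: "bounded_linear h" and f: "Ck_on k S f"
  shows "Ck_on k S (\<lambda>x. h (f x))"
  using f
proof (induction k arbitrary: f)
  case 0
  then show ?case by (simp add: bounded_linear.continuous_on[OF h])
next
  case (Suc k)
  obtain F where F: "\<And>x. x \<in> S \<Longrightarrow> (f has_derivative F x) (at x)" "\<And>v. Ck_on k S (\<lambda>x. F x v)"
    using Ck_on_SucE[OF Suc.prems] by blast
  show ?case
    by (rule Ck_on_Suc[where F = "\<lambda>x v. h (F x v)"])
       (use S F Suc.IH in \<open>auto intro: bounded_linear.has_derivative[OF h]\<close>)
qed

lemma Ck_on_add: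
  assumes S: "open S" and "Ck_on k S f" "Ck_on k S g"
  shows "Ck_on k S (\<lambda>x. f x + g x)"
  using assms(2-)
proof (induction k arbitrary: f g)
  case 0
  then show ?case by (simp add: continuous_on_add)
next
  case (Suc k)
  obtain F where F: "\<And>x. x \<in> S \<Longrightarrow> (f has_derivative F x) (at x)" "\<And>v. Ck_on k S (\<lambda>x. F x v)"
    using Ck_on_SucE[OF Suc.prems(1)] by blast
  obtain G where G: "\<And>x. x \<in> S \<Longrightarrow> (g has_derivative G x) (at x)" "\<And>v. Ck_on k S (\<lambda>x. G x v)"
    using Ck_on_SucE[OF Suc.prems(2)] by blast
  show ?case
    by (rule Ck_on_Suc[where F = "\<lambda>x v. F x v + G x v"])
       (use S F G Suc.IH in \<open>auto intro: has_derivative_add\<close>)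
qed

lemma Ck_on_bilinear:
  assumes S: "open S" and h: "bounded_bilinear h" and "Ck_on k S f" "Ck_on k S g"
  shows "Ck_on k S (\<lambda>x. h (f x) (g x))"
  using assms(3-)
proof (induction k arbitrary: f g)
  case 0
  then show ?case by (simp add: bounded_bilinear.continuous_on[OF h])
next
  case (Suc k)
  obtain F where F: "\<And>x. x \<in> S \<Longrightarrow> (f has_derivative F x) (at x)" "\<And>v. Ck_on k S (\<lambda>x. F x v)"
    using Ck_on_SucE[OF Suc.prems(1)] by blast
  obtain G where G: "\<And>x. x \<in> S \<Longrightarrow> (g has_derivative G x) (at x)" "\<And>v. Ck_on k S (\<lambda>x. G x v)"
    using Ck_on_SucE[OF Suc.prems(2)] by blast
  show ?case
    by (rule Ck_on_Suc[where F = "\<lambda>x v. h (f x) (G x v) + h (F x v) (g x)"])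
       (use S F G Suc.IH Suc.prems[THEN Ck_on_SucD] in
         \<open>auto intro!: Ck_on_add bounded_bilinear.FDERIV[OF h]\<close>)
qed

lemma Ck_on_linear_compose:
  assumes S: "open S" and h: "bounded_linear h" and f: "Ck_on k S f"
  shows "Ck_on k (h -` S) (\<lambda>x. f (h x))"
  using f
proof (induction k arbitrary: f)
  case 0
  then show ?case
    using continuous_on_compose2[of S f "h -` S" h] linear_continuous_on[OF h] by auto
next
  case (Suc k)
  have o: "open (h -` S)"
    using S h by (simp add: open_vimage linear_continuous_on)
  obtain F where F: "\<And>x. x \<in> S \<Longrightarrow> (f has_derivative F x) (at x)" "\<And>v. Ck_on k S (\<lambda>x. F x v)"
    using Ck_on_SucE[OF Suc.prems] by blast
  show ?case
  proof (rule Ck_on_Suc[OF o, where F = "\<lambda>x v. F (h x) (h v)"])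
    show "((\<lambda>x. f (h x)) has_derivative (\<lambda>v. F (h x) (h v))) (at x)" if "x \<in> h -` S" for x
      using has_derivative_compose[OF bounded_linear_imp_has_derivative[OF h] F(1)[of "h x"]] that by simp
    show "Ck_on k (h -` S) (\<lambda>x. F (h x) (h v))" for v
      by (rule Suc.IH[OF F(2)])
  qed
qed

text \<open>Since \<open>b\<close> vanishes at \<open>x\<close>, the product rule needs only
  continuity of \<open>a\<close>. This allows a matrix inverse to be differentiated before it is
  known to be differentiable.\<close>

lemma has_derivative_bilinear_vanishing:
  assumes h: "bounded_bilinear h" and a: "isCont a x" and b: "(b has_derivative B) (at x)" and b0: "b x = 0"
  shows "((\<lambda>y. h (a y) (b y)) has_derivative (\<lambda>v. h (a x) (B v))) (at x)"
proof -
  interpret h: bounded_bilinear h by (rule h)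
  have B: "bounded_linear B" using b by (rule has_derivative_bounded_linear)
  have lim: "((\<lambda>y. norm (b y - b x - B (y - x)) / norm (y - x)) \<longlongrightarrow> 0) (at x)"
    using b by (simp add: has_derivative_iff_norm)
  obtain K where K: "\<And>u v. norm (h u v) \<le> norm u * norm v * K" "K > 0"
    using h.pos_bounded by blast
  obtain M where M: "\<And>v. norm (B v) \<le> norm v * M" "M > 0"
    using bounded_linear.pos_bounded[OF B] by blast
  have "((\<lambda>y. norm (h (a y) (b y) - h (a x) (b x) - h (a x) (B (y - x))) / norm (y - x)) \<longlongrightarrow> 0) (at x)"
  proof (rule Lim_null_comparison)
    show "((\<lambda>y. norm (a y) * (norm (b y - b x - B (y - x)) / norm (y - x)) * K + norm (a y - a x) * (M * K)) \<longlongrightarrow> 0) (at x)"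
    proof -
      have "((\<lambda>y. norm (a y) * (norm (b y - b x - B (y - x)) / norm (y - x)) * K + norm (a y - a x) * (M * K))
          \<longlongrightarrow> norm (a x) * 0 * K + norm (a x - a x) * (M * K)) (at x)"
        using a lim by (intro tendsto_intros) (auto simp: isCont_def)
      then show ?thesis by simp
    qed
    show "\<forall>\<^sub>F y in at x. norm (norm (h (a y) (b y) - h (a x) (b x) - h (a x) (B (y - x))) / norm (y - x))
       \<le> norm (a y) * (norm (b y - b x - B (y - x)) / norm (y - x)) * K + norm (a y - a x) * (M * K)"
      unfolding eventually_at_filter
    proof (intro always_eventually allI impI)
      fix y assume "y \<noteq> x"
      then have n: "norm (y - x) > 0" by simp
      have "h (a y) (b y) - h (a x) (b x) - h (a x) (B (y - x))
          = h (a y) (b y - b x - B (y - x)) + h (a y - a x) (B (y - x))"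
        by (simp add: b0 h.diff_left h.diff_right h.zero_right)
      then have "norm (h (a y) (b y) - h (a x) (b x) - h (a x) (B (y - x)))
          \<le> norm (a y) * norm (b y - b x - B (y - x)) * K + norm (a y - a x) * norm (B (y - x)) * K"
        by (simp only:) (rule order_trans[OF norm_triangle_ineq add_mono[OF K(1) K(1)]])
      also have "\<dots> \<le> norm (a y) * norm (b y - b x - B (y - x)) * K + norm (a y - a x) * (norm (y - x) * M) * K"
        using K(2) M(1)[of "y - x"] by (intro add_left_mono mult_right_mono mult_left_mono) auto
      finally have "norm (h (a y) (b y) - h (a x) (b x) - h (a x) (B (y - x))) / norm (y - x)
          \<le> (norm (a y) * norm (b y - b x - B (y - x)) * K + norm (a y - a x) * (norm (y - x) * M) * K) / norm (y - x)"
        using n by (intro divide_right_mono) auto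
      also have "\<dots> = norm (a y) * (norm (b y - b x - B (y - x)) / norm (y - x)) * K + norm (a y - a x) * (M * K)"
        using n by (simp add: field_simps)
      finally show "norm (norm (h (a y) (b y) - h (a x) (b x) - h (a x) (B (y - x))) / norm (y - x))
       \<le> norm (a y) * (norm (b y - b x - B (y - x)) / norm (y - x)) * K + norm (a y - a x) * (M * K)"
        by simp
    qed
  qed
  moreover have "bounded_linear (\<lambda>v. h (a x) (B v))"
    by (rule bounded_linear_compose[OF h.bounded_linear_right B])
  ultimately show ?thesis by (simp add: has_derivative_iff_norm)
qed

section \<open>Smoothness of matrix inversion\<close>

lemma matrix_inverse_diff:
  fixes A A' B B' :: "'a::{real_algebra_1,euclidean_space}^'n^'n"
  assumes "A ** B = mat 1" "A' ** B' = mat 1"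
  shows "B' = B - B' ** ((A' - A) ** B)"
proof -
  have "B' ** ((A' - A) ** B) = (B' ** A') ** B - B' ** (A ** B)"
    by (simp add: msimps matrix_mul_assoc)
  then show ?thesis
    by (simp add: assms left_inverse_imp_right_inverse[OF assms(2)])
qed

text \<open>The resolvent identity bounds |g y - g x| by |g y| times a function \<open>d\<close>
  that tends to 0. This first gives |g y| <= 2 |g x| near \<open>x\<close>, and then
  convergence.\<close>

lemma isCont_matrix_inverse:
  fixes f g :: "'b::euclidean_space \<Rightarrow> 'a::{real_algebra_1,euclidean_space}^'n^'n"
  assumes S: "open S" and fg: "\<And>x. x \<in> S \<Longrightarrow> f x ** g x = mat 1"
    and f: "isCont f x" and x: "x \<in> S"
  shows "isCont g x"
proof -
  obtain K where K: "\<And>(u :: 'a^'n^'n) (v :: 'a^'n^'n). norm (u ** v) \<le> norm u * norm v * K" "K > 0"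
    using bounded_bilinear.pos_bounded[OF bounded_bilinear_matrix] by blast
  define d where "d = (\<lambda>y. norm (f y - f x) * norm (g x) * K * K)"
  have d: "(d \<longlongrightarrow> 0) (at x)"
  proof -
    have "(d \<longlongrightarrow> norm (f x - f x) * norm (g x) * K * K) (at x)"
      unfolding d_def using f by (intro tendsto_intros) (auto simp: isCont_def)
    then show ?thesis by simp
  qed
  have diff: "norm (g y - g x) \<le> norm (g y) * d y" if "y \<in> S" for y
  proof -
    have "g y - g x = - (g y ** ((f y - f x) ** g x))"
      using matrix_inverse_diff[OF fg[OF x] fg[OF that]] by (simp add: algebra_simps)
    then have "norm (g y - g x) = norm (g y ** ((f y - f x) ** g x))"
      by (simp only: norm_minus_cancel)
    also have "\<dots> \<le> norm (g y) * norm ((f y - f x) ** g x) * K"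
      by (rule K)
    also have "\<dots> \<le> norm (g y) * (norm (f y - f x) * norm (g x) * K) * K"
      using K by (intro mult_right_mono mult_left_mono) auto
    finally show ?thesis by (simp add: d_def mult_ac)
  qed
  have ev: "\<forall>\<^sub>F y in at x. y \<in> S"
    using S x by (auto intro: eventually_at_in_open')
  have "\<forall>\<^sub>F y in at x. d y < 1/2"
    using order_tendstoD(2)[OF d, of "1/2"] by simp
  with ev have bd: "\<forall>\<^sub>F y in at x. norm (g y) \<le> 2 * norm (g x)"
  proof eventually_elim
    case (elim y)
    have "norm (g y) \<le> norm (g x) + norm (g y - g x)"
      by (metis add.commute diff_add_cancel norm_triangle_ineq)
    also have "\<dots> \<le> norm (g x) + norm (g y) * (1/2)"
      using diff[OF elim(1)] mult_left_mono[of "d y" "1/2" "norm (g y)"] elim(2) by simp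
    finally show ?case by simp
  qed
  have "((\<lambda>y. g y - g x) \<longlongrightarrow> 0) (at x)"
  proof (rule Lim_null_comparison)
    show "((\<lambda>y. 2 * norm (g x) * d y) \<longlongrightarrow> 0) (at x)"
      using tendsto_mult[OF tendsto_const[of "2 * norm (g x)"] d] by simp
    show "\<forall>\<^sub>F y in at x. norm (g y - g x) \<le> 2 * norm (g x) * d y"
      using ev bd
    proof eventually_elim
      case (elim y)
      have "d y \<ge> 0" using K(2) by (simp add: d_def)
      then show ?case using diff[OF elim(1)] mult_right_mono[OF elim(2), of "d y"] by linarith
    qed
  qed
  then show ?thesis by (simp add: isCont_def LIM_zero_iff)
qed

text \<open>By \<open>matrix_inverse_diff\<close>, \<open>g\<close> is a constant minus a product
  whose second factor vanishes at \<open>x\<close>.\<close>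

lemma matrix_inverse_has_derivative:
  fixes f g :: "'b::euclidean_space \<Rightarrow> 'a::{real_algebra_1,euclidean_space}^'n^'n"
  assumes S: "open S" and fg: "\<And>x. x \<in> S \<Longrightarrow> f x ** g x = mat 1"
    and f: "(f has_derivative F) (at x)" and x: "x \<in> S"
  shows "(g has_derivative (\<lambda>v. - (g x ** (F v ** g x)))) (at x)"
proof -
  have c: "isCont g x"
    by (rule isCont_matrix_inverse[OF S fg _ x]) (use f has_derivative_continuous in auto)
  have "((\<lambda>y. (f y - f x) ** g x) has_derivative (\<lambda>v. F v ** g x)) (at x)"
    using f by (auto intro!: bounded_linear.has_derivative[OF
          bounded_bilinear.bounded_linear_left[OF bounded_bilinear_matrix]] derivative_eq_intros)
  then have "((\<lambda>y. g y ** ((f y - f x) ** g x)) has_derivative (\<lambda>v. g x ** (F v ** g x))) (at x)"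
    by (intro has_derivative_bilinear_vanishing[OF bounded_bilinear_matrix c]) simp_all
  then have "((\<lambda>y. g x - g y ** ((f y - f x) ** g x)) has_derivative (\<lambda>v. 0 - g x ** (F v ** g x))) (at x)"
    by (intro has_derivative_diff has_derivative_const)
  then have "(g has_derivative (\<lambda>v. 0 - g x ** (F v ** g x))) (at x)"
    by (rule has_derivative_transform_within_open[OF _ S x])
       (rule matrix_inverse_diff[OF fg[OF x] fg, symmetric])
  then show ?thesis by simp
qed

text \<open>A bootstrap: the derivative of \<open>g\<close> is a product of \<open>g\<close> and the
  derivative of \<open>f\<close>, so each degree of smoothness of \<open>g\<close> yields the
  next.\<close>

lemma Ck_on_matrix_inverse:
  fixes f g :: "'b::euclidean_space \<Rightarrow> 'a::{real_algebra_1,euclidean_space}^'n^'n"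
  assumes S: "open S" and fg: "\<And>x. x \<in> S \<Longrightarrow> f x ** g x = mat 1" and f: "Ck_on k S f"
  shows "Ck_on k S g"
  using f
proof (induction k)
  case 0
  have "isCont g x" if "x \<in> S" for x
  proof (rule isCont_matrix_inverse[OF S _ _ that])
    show "isCont f x" using 0 S that by (simp add: continuous_on_eq_continuous_at)
  qed (rule fg)
  then show ?case by (simp add: continuous_at_imp_continuous_on)
next
  case (Suc k)
  obtain F where F: "\<And>x. x \<in> S \<Longrightarrow> (f has_derivative F x) (at x)" "\<And>v. Ck_on k S (\<lambda>x. F x v)"
    using Ck_on_SucE[OF Suc.prems] by blast
  have g: "Ck_on k S g" using Suc.IH Ck_on_SucD[OF Suc.prems] by blast
  show ?case
  proof (rule Ck_on_Suc[OF S, where F = "\<lambda>x v. - (g x ** (F x v ** g x))"])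
    show "(g has_derivative (\<lambda>v. - (g x ** (F x v ** g x)))) (at x)" if "x \<in> S" for x
      by (rule matrix_inverse_has_derivative[OF S fg F(1)[OF that] that])
    show "Ck_on k S (\<lambda>x. - (g x ** (F x v ** g x)))" for v
      by (intro Ck_on_compose_linear[OF S bounded_linear_minus[OF bounded_linear_ident]]
          Ck_on_bilinear[OF S bounded_bilinear_matrix] g F(2))
  qed
qed

section \<open>Semi-algebraic sets\<close>

text \<open>Expand both arguments in coordinates with respect to \<open>Basis\<close>.\<close>

lemma polynomial_function_bilinear:
  fixes f :: "'c::real_normed_vector \<Rightarrow> 'a::euclidean_space" and g :: "'c \<Rightarrow> 'b::euclidean_space"
    and h :: "'a \<Rightarrow> 'b \<Rightarrow> 'd::euclidean_space"
  assumes h: "bounded_bilinear h" and f: "polynomial_function f" and g: "polynomial_function g"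
  shows "polynomial_function (\<lambda>x. h (f x) (g x))"
proof -
  interpret h: bounded_bilinear h by (rule h)
  have comp: "polynomial_function (\<lambda>x. inner (q x) b)" if "polynomial_function q"
    for q :: "'c \<Rightarrow> 'e::euclidean_space" and b
  proof -
    have "real_polynomial_function ((\<lambda>x. inner x b) \<circ> q)"
      using that[unfolded polynomial_function_def, THEN spec, of "\<lambda>x. inner x b"]
      by (simp add: bounded_linear_inner_left)
    then show ?thesis by (simp add: o_def real_polynomial_function_eq)
  qed
  have eq: "h (f x) (g x) = (\<Sum>b\<in>Basis. inner (f x) b *\<^sub>R (\<Sum>c\<in>Basis. inner (g x) c *\<^sub>R h b c))" for x
  proof -
    have "h b (g x) = (\<Sum>c\<in>Basis. inner (g x) c *\<^sub>R h b c)" for b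
      using h.sum_right[of b "\<lambda>c. inner (g x) c *\<^sub>R c" Basis]
      by (simp only: euclidean_representation h.scaleR_right)
    moreover have "h (f x) (g x) = (\<Sum>b\<in>Basis. inner (f x) b *\<^sub>R h b (g x))"
      using h.sum_left[of "\<lambda>b. inner (f x) b *\<^sub>R b" Basis "g x"]
      by (simp only: euclidean_representation h.scaleR_left)
    ultimately show ?thesis by simp
  qed
  have "polynomial_function (\<lambda>x. \<Sum>c\<in>Basis. inner (g x) c *\<^sub>R h b c)" for b
    by (rule polynomial_function_sum[OF finite_Basis])
       (rule polynomial_function_mult[OF comp[OF g] polynomial_function_const])
  then have "polynomial_function (\<lambda>x. \<Sum>b\<in>Basis. inner (f x) b *\<^sub>R (\<Sum>c\<in>Basis. inner (g x) c *\<^sub>R h b c))"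
    by (rule polynomial_function_sum[OF finite_Basis polynomial_function_mult[OF comp[OF f]]])
  then show ?thesis by (simp only: eq)
qed

lemma polynomial_function_compose_linear:
  assumes "linear h" "polynomial_function f"
  shows "polynomial_function (\<lambda>x. h (f x :: 'a::euclidean_space) :: 'b::euclidean_space)"
  unfolding polynomial_function_def
proof (intro allI impI)
  fix g :: "'b \<Rightarrow> real" assume "bounded_linear g"
  then have "bounded_linear (\<lambda>x. g (h x))"
    using assms(1) by (intro bounded_linear_compose[of g h]) (simp_all add: linear_linear)
  then have "real_polynomial_function ((\<lambda>x. g (h x)) \<circ> f)"
    using assms(2)[unfolded polynomial_function_def, THEN spec, of "\<lambda>x. g (h x)"] by simp
  then show "real_polynomial_function (g \<circ> (\<lambda>x. h (f x)))" by (simp add: o_def)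
qed

text \<open>The squared norm turns a vector equation into a single polynomial equation.\<close>

lemma semialgebraic_Collect_eq_0:
  fixes F :: "'a::euclidean_space \<Rightarrow> 'b::euclidean_space"
  assumes "polynomial_function F"
  shows "semialgebraic {x. F x = 0}"
proof -
  have "polynomial_function (\<lambda>x. inner (F x) (F x))"
    by (rule polynomial_function_bilinear[OF bounded_bilinear_inner assms assms])
  then have "semialgebraic {x. inner (F x) (F x) = 0}"
    by (intro semialgebraic.intros(1)) (simp only: real_polynomial_function_eq)
  then show ?thesis by simp
qed

lemma semialgebraic_Collect_ball:
  assumes "finite J" "\<And>j. j \<in> J \<Longrightarrow> semialgebraic {x. P j x}"
  shows "semialgebraic {x. \<forall>j\<in>J. P j x}"
  using assms
proof (induction J)
  case empty
  have "semialgebraic {x :: 'b. (0::real) = 0}"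
    by (intro semialgebraic.intros(1) real_polynomial_function.intros(2))
  then show ?case by simp
next
  case (insert j J)
  have "semialgebraic ({x. P j x} \<inter> {x. \<forall>j\<in>J. P j x})"
    by (rule semialgebraic.intros(4)) (simp_all add: insert)
  moreover have "{x. P j x} \<inter> {x. \<forall>j\<in>J. P j x} = {x. \<forall>j\<in>insert j J. P j x}" by auto
  ultimately show ?case by simp
qed

text \<open>Eliminating one index at a time, as in Gaussian elimination, expresses positive semidefiniteness
  and the rank bound by polynomial conditions without determinants.\<close>

lemma semialgebraic_psd_rank_le:
  fixes F :: "'b::euclidean_space \<Rightarrow> 'a::involutive_algebra^'n^'n"
  assumes "polynomial_function F"
  shows "semialgebraic {x. psd (F x) \<and> rdim (F x) \<le> DIM('a) * s}"
proof -
  have "semialgebraic {x. psd (F x) \<and> (\<forall>j. j \<notin> S \<longrightarrow> F x *v axis j 1 = 0) \<and> rdim (F x) \<le> DIM('a) * s}"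
    if "finite S" "polynomial_function F" for S and F :: "'b \<Rightarrow> 'a^'n^'n"
    using that
  proof (induction S arbitrary: F s)
    case empty
    have "M = 0" if "\<forall>j. M *v axis j 1 = 0" for M :: "'a^'n^'n"
      by (rule matrix_eq_axis) (simp add: that)
    then have "{x. psd (F x) \<and> (\<forall>j. j \<notin> {} \<longrightarrow> F x *v axis j 1 = 0) \<and> rdim (F x) \<le> DIM('a) * s} = {x. F x = 0}"
      by auto
    then show ?case by (simp only:) (intro semialgebraic_Collect_eq_0 empty)
  next
    case (insert i S)
    define e :: "'a^'n" where "e = axis i 1"
    define a where "a x = F x *v e" for x
    define m where "m x = inner e (a x)" for x
    \<comment> \<open>The deflation along basis vector \<open>i\<close>, multiplied by its pivot
      \<open>m x\<close>; clearing the denominator keeps \<open>G\<close> polynomial in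
      \<open>x\<close>.\<close>
    define G where "G x = m x *\<^sub>R F x - outer (a x) (a x)" for x
    let ?R = "\<lambda>S s M. psd M \<and> (\<forall>j. j \<notin> S \<longrightarrow> M *v axis j 1 = 0) \<and> rdim M \<le> DIM('a) * s"
    have pa: "polynomial_function a"
      unfolding a_def
      by (rule polynomial_function_bilinear[OF bounded_bilinear_matrix_vector insert.prems polynomial_function_const])
    have pm: "polynomial_function m"
      unfolding m_def by (rule polynomial_function_bilinear[OF bounded_bilinear_inner polynomial_function_const pa])
    have bo: "bounded_bilinear (outer :: 'a^'n \<Rightarrow> 'a^'n \<Rightarrow> 'a^'n^'n)"
      by (subst bilinear_conv_bounded_bilinear[symmetric])
         (simp add: bilinear_def linear_iff outer_def vec_eq_iff algebra_simps cj_add cj_scaleR)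
    have pG: "polynomial_function G"
      unfolding G_def
      by (intro polynomial_function_diff polynomial_function_mult pm insert.prems
          polynomial_function_bilinear[OF bo] pa)
    have Gd: "G x = m x *\<^sub>R deflate (F x) e" if "m x \<noteq> 0" for x
      using that by (simp add: G_def deflate_def m_def a_def algebra_simps)
    have rp: "real_polynomial_function m" using pm by (simp add: real_polynomial_function_eq)
    \<comment> \<open>Either the pivot is zero, and then the whole column vanishes by
      semidefiniteness, or it is positive and deflation lowers the rank by one. A positive pivot is
      impossible for \<open>s = 0\<close>, where \<open>s - 1\<close> would be cut off at 0.\<close>
    have eq: "{x. ?R (insert i S) s (F x)} =
      ({x. a x = 0} \<inter> {x. ?R S s (F x)}) \<union>
      ({x. m x > 0} \<inter> {x. ctr (F x) - F x = 0} \<inter> {x. \<forall>j\<in>-insert i S. F x *v axis j 1 = 0} \<inter>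
        (if s = 0 then {} else {x. ?R S (s - 1) (G x)}))" (is "?A = ?B \<union> ?C")
    proof (intro antisym subsetI)
      fix x assume "x \<in> ?A"
      then have x: "psd (F x)" "\<And>j. j \<notin> insert i S \<Longrightarrow> F x *v axis j 1 = 0" "rdim (F x) \<le> DIM('a) * s"
        by auto
      have "m x \<ge> 0" using x(1) by (simp add: m_def a_def psd_def)
      then consider "m x = 0" | "m x > 0" by linarith
      then show "x \<in> ?B \<union> ?C"
      proof cases
        case 1
        then have "a x = 0"
          using psd_isotropic_eq_0[OF x(1)] by (simp add: a_def m_def)
        moreover have "F x *v axis j 1 = 0" if "j \<notin> S" for j
          using x(2)[of j] \<open>a x = 0\<close> that by (cases "j = i") (auto simp: a_def e_def)
        ultimately have "x \<in> ?B" using x(1,3) by simp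
        then show ?thesis by blast
      next
        case 2
        then have p: "inner e (F x *v e) > 0" by (simp add: m_def a_def)
        have G: "G x = m x *\<^sub>R deflate (F x) e" using 2 Gd by simp
        have r: "rdim (F x) = rdim (G x) + DIM('a)"
          using rdim_deflate[OF x(1) p] 2 by (simp add: G rdim_scaleR)
        then have s: "s \<noteq> 0" using x(3) by (cases s) auto
        have "rdim (G x) \<le> DIM('a) * (s - 1)"
          using r x(3) s by (cases s) auto
        moreover have "psd (G x)"
          unfolding G using psd_deflate[OF x(1) p] 2 by (intro psd_scaleR) auto
        moreover have "G x *v axis j 1 = 0" if "j \<notin> S" for j
        proof (cases "j = i")
          case True
          then show ?thesis
            using deflate_mult_vector[OF x(1) p] by (simp add: G matrix_vector_scaleR e_def)
        next
          case False
          then show ?thesis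
            using x(2)[of j] that psd_ctr[OF x(1)]
            by (simp add: G_def matrix_vector_mult_diff_rdistrib matrix_vector_scaleR
                outer_mult_vector a_def hf_matrix_left)
        qed
        ultimately have "x \<in> ?C" using 2 s x psd_ctr[OF x(1)] by auto
        then show ?thesis by blast
      qed
    next
      fix x assume "x \<in> ?B \<union> ?C"
      then show "x \<in> ?A"
      proof
        assume "x \<in> ?B"
        then show ?thesis by auto
      next
        assume "x \<in> ?C"
        then have s: "s \<noteq> 0" and x: "m x > 0" "ctr (F x) = F x" "?R S (s - 1) (G x)"
          "\<And>j. j \<notin> insert i S \<Longrightarrow> F x *v axis j 1 = 0"
          by (auto split: if_splits)
        have F: "F x = (1 / m x) *\<^sub>R (G x + outer (a x) (a x))"
          using x(1) by (simp add: G_def)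
        have psd: "psd (F x)"
          unfolding F using x(1,3) by (intro psd_scaleR psd_add psd_outer) auto
        have p: "inner e (F x *v e) > 0" using x(1) by (simp add: m_def a_def)
        have "rdim (F x) = rdim (G x) + DIM('a)"
          using rdim_deflate[OF psd p] x(1) Gd[of x] by (simp add: rdim_scaleR)
        then have "rdim (F x) \<le> DIM('a) * s"
          using x(3) s by (cases s) auto
        with psd x(4) show ?thesis by auto
      qed
    qed
    have 1: "semialgebraic {x. ?R S (s - 1) (G x)}" "semialgebraic {x. ?R S s (F x)}"
      using insert.IH pG insert.prems by blast+
    have e: "semialgebraic ({} :: 'b set)"
    proof -
      have "semialgebraic {x :: 'b. (1::real) = 0}"
        by (intro semialgebraic.intros(1) real_polynomial_function.intros(2))
      then show ?thesis by simp
    qed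
    have 2: "semialgebraic {x. ctr (F x) - F x = 0}"
      by (intro semialgebraic_Collect_eq_0 polynomial_function_diff insert.prems
          polynomial_function_compose_linear[OF linear_ctr])
    have 3: "semialgebraic {x. \<forall>j\<in>-insert i S. F x *v axis j 1 = 0}"
      by (intro semialgebraic_Collect_ball semialgebraic_Collect_eq_0 finite
          polynomial_function_bilinear[OF bounded_bilinear_matrix_vector insert.prems polynomial_function_const])
    show ?case
      unfolding eq
      by (intro semialgebraic.intros(2-4) semialgebraic_Collect_eq_0 pa rp 1 2 3) (use 1 e in auto)
  qed
  from this[of UNIV F] assms show ?thesis by simp
qed

section \<open>Non-negative nilpotent matrices\<close>

lemma psd_congruence:
  fixes M :: "'a::involutive_algebra^'n^'n" and G :: "'a^'n^'m"
  assumes "psd M"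
  shows "psd (G ** M ** ctr G)"
proof -
  obtain A :: "'a^'n^'n" where "M = A ** ctr A" by (rule psd_decompose[OF assms])
  then have "G ** M ** ctr G = (G ** A) ** ctr (G ** A)"
    by (simp only: ctr_mult matrix_mul_assoc)
  then show ?thesis by (simp only: psd_mult_ctr)
qed

lemma exists_right_inverse:
  fixes A :: "'a::involutive_algebra^'n^'n"
  assumes "\<And>v. A *v v = 0 \<Longrightarrow> v = 0"
  shows "\<exists>B. A ** B = mat 1"
proof -
  have "inj ((*v) A)"
    using assms by (simp add: linear_injective_0[OF matrix_vector_mul_linear])
  then have "surj ((*v) A)"
    by (rule linear_inj_imp_surj[OF matrix_vector_mul_linear])
  define b where "b j = inv ((*v) A) (axis j 1)" for j
  have b: "A *v b j = axis j 1" for j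
    unfolding b_def by (rule surj_f_inv_f) fact
  define B :: "'a^'n^'n" where "B = (\<chi> i j. b j $ i)"
  have "B *v axis j 1 = b j" for j
    by (simp add: B_def matrix_vector_mult_def axis_def vec_eq_iff if_distrib cong: if_cong)
  then have "A ** B = mat 1"
    by (intro matrix_eq_axis) (simp add: b flip: matrix_vector_mul_assoc)
  then show ?thesis ..
qed

text \<open>Deflation lowers the real rank by exactly \<open>DIM('a)\<close> until nothing is left.
  This is the integrality of the rank over the scalars.\<close>

lemma DIM_dvd_rdim_psd: "psd M \<Longrightarrow> DIM('a) dvd rdim M" for M :: "'a::involutive_algebra^'n^'n"
proof (induction "rdim M" arbitrary: M rule: less_induct)
  case less
  show ?case
  proof (cases "M = 0")
    case False
    then obtain x where "M *v x \<noteq> 0" by (auto simp: matrix_eq)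
    then have x: "inner x (M *v x) > 0"
      using psd_isotropic_eq_0[OF less.prems, of x] less.prems unfolding psd_def less_le by auto
    have r: "rdim M = rdim (deflate M x) + DIM('a)"
      by (rule rdim_deflate[OF less.prems x])
    then have "DIM('a) dvd rdim (deflate M x)"
      by (intro less.hyps psd_deflate[OF less.prems x]) simp
    then show ?thesis using r by simp
  qed simp
qed

text \<open>The common properties of the three \<open>J\<close>; together they make \<open>J\<close>
  an isometry with inverse \<open>- J\<close>.\<close>

locale complex_structure =
  fixes J :: "'k::involutive_algebra^'n^'n"
  assumes ctr_J: "ctr J = - J" and J_J: "J ** J = - mat 1"
begin

lemma J_J_mult: "J ** (J ** X) = - X"
  by (simp add: matrix_mul_assoc J_J matrix_minus_left)

lemma J_J_vector: "J *v (J *v x) = - x"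
  by (simp add: matrix_vector_mul_assoc J_J matrix_vector_minus)

lemma hf_J_left: "hf (J *v u) v = - hf u (J *v v)"
  by (simp add: hf_matrix_left ctr_J matrix_vector_minus hf_minus_right)

lemma hf_J_J: "hf (J *v u) (J *v v) = hf u v"
  by (simp add: hf_J_left J_J_vector hf_minus_right)

lemma J_vector_eq_0_iff: "J *v u = 0 \<longleftrightarrow> u = 0"
  using J_J_vector[of u] by auto

lemma rdim_J_mult: "rdim (J ** M) = rdim M"
  by (rule rdim_mult_invertible[of "- J"]) (simp add: matrix_minus_left J_J)

lemma J_mult_inj: "J ** M = J ** N \<longleftrightarrow> M = N"
proof
  assume "J ** M = J ** N"
  then have "J ** (J ** M) = J ** (J ** N)" by (rule arg_cong)
  then show "M = N" by (simp only: J_J_mult neg_equal_iff_equal)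
qed simp

text \<open>The defining expression is the form of \<open>ctr (J ** X) - J ** X\<close>. So
  \<open>u_alg J\<close> consists of \<open>J\<close> times the hermitian matrices.\<close>

lemma u_alg_iff: "X \<in> u_alg J \<longleftrightarrow> ctr (J ** X) = J ** X"
proof -
  have "\<B> J (X *v v) w + \<B> J v (X *v w) = hf v ((ctr (J ** X) - J ** X) *v w)" for v w
    by (simp add: \<B>_def hf_matrix_left matrix_vector_mul_assoc ctr_mult ctr_J matrix_minus_left
        matrix_minus_right hf_simps matrix_vector_mult_diff_rdistrib matrix_vector_minus)
  then have "X \<in> u_alg J \<longleftrightarrow> (\<forall>v w. hf v ((ctr (J ** X) - J ** X) *v w) = hf v (0 *v w))"
    by (simp add: u_alg_def)
  also have "\<dots> \<longleftrightarrow> ctr (J ** X) - J ** X = 0"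
    using matrix_eqI_hf[of "ctr (J ** X) - J ** X" 0] by auto
  finally show ?thesis by simp
qed

lemma u_alg_ctr: "X \<in> u_alg J \<Longrightarrow> ctr X = J ** X ** J"
proof -
  assume "X \<in> u_alg J"
  then have "ctr X ** J = - (J ** X)"
    by (simp add: u_alg_iff ctr_mult ctr_J matrix_minus_right) (metis minus_minus)
  then have "ctr X ** (J ** J) = - (J ** X ** J)"
    by (simp add: matrix_mul_assoc matrix_minus_left)
  then show ?thesis by (simp add: J_J matrix_minus_right)
qed

text \<open>\<open>- (J ** X)\<close> is the matrix that represents the form of \<open>X\<close>
  with respect to \<open>hf\<close>.\<close>

lemma non_negative_iff: "non_negative J X \<longleftrightarrow> psd (- (J ** X))"
proof -
  define M where "M = - (J ** X)"
  have form: "\<B>_form J X v w = hf (M *v v) w" for v w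
    by (simp add: \<B>_form_def \<B>_def M_def hf_minus_left matrix_vector_minus matrix_vector_mul_assoc)
  show ?thesis
  proof
    assume nn: "non_negative J X"
    have "hf u (ctr M *v v) = hf u (M *v v)" for u v
      using nn by (simp add: non_negative_def form cj_hf hf_matrix_left)
    then have c: "ctr M = M" by (rule matrix_eqI_hf)
    have "inner v (M *v v) \<ge> 0" for v
    proof -
      obtain t where "t \<ge> 0" "hf (M *v v) v = of_real t"
        using nn[unfolded non_negative_def form] by blast
      then show ?thesis
        using inner_1_hf[of "M *v v" v] by (simp add: inner_commute of_real_def power2_norm_eq_inner[symmetric])
    qed
    then show "psd (- (J ** X))" using c by (simp add: psd_def M_def)
  next
    assume "psd (- (J ** X))"
    then have p: "psd M" by (simp add: M_def)
    then have c: "ctr M = M" by (rule psd_ctr)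
    have "hf (M *v v) v = of_real (inner v (M *v v))" for v
      using hf_psd[OF c, of v] by (simp add: hf_matrix_left c)
    then show "non_negative J X"
      using p unfolding non_negative_def form psd_def
      by (metis c cj_hf hf_matrix_left)
  qed
qed

text \<open>For hermitian \<open>M\<close> the equation says that the range of \<open>M\<close> is
  isotropic, equivalently that \<open>J ** M\<close> squares to zero.\<close>

definition cone :: "('k^'n^'n) set" where
  "cone = {J ** M | M. psd M \<and> M ** J ** M = 0}"

lemma cone_iff: "X \<in> cone \<longleftrightarrow> psd (- (J ** X)) \<and> X ** X = 0"
proof
  assume "X \<in> cone"
  then obtain M where M: "X = J ** M" "psd M" "M ** J ** M = 0" by (auto simp: cone_def)
  have "X ** X = J ** (M ** J ** M)" by (simp add: M(1) matrix_mul_assoc)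
  with M show "psd (- (J ** X)) \<and> X ** X = 0" by (simp add: J_J_mult)
next
  assume X: "psd (- (J ** X)) \<and> X ** X = 0"
  define M where "M = - (J ** X)"
  have XM: "X = J ** M" by (simp add: M_def matrix_minus_right J_J_mult)
  have "J ** (M ** J ** M) = 0" using X by (simp add: XM matrix_mul_assoc)
  then have "M ** J ** M = 0"
    using J_mult_inj[of "M ** J ** M" 0] by simp
  moreover have "psd M" using X by (simp add: M_def)
  ultimately show "X \<in> cone" unfolding cone_def using XM by blast
qed

text \<open>\<open>A\<close> may be singular and cannot be cancelled. But
  \<open>S = ctr A ** J ** A\<close> is skew-hermitian with vanishing cube, and a nilpotent
  skew-hermitian matrix is 0.\<close>

lemma isotropic_factor:
  assumes "A ** ctr A ** J ** (A ** ctr A) = 0"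
  shows "ctr A ** J ** A = 0"
proof -
  define S where "S = ctr A ** J ** A"
  have cS: "ctr S = - S"
    by (simp add: S_def ctr_mult ctr_J matrix_minus_left matrix_minus_right matrix_mul_assoc)
  have "S ** S ** S = ctr A ** J ** (A ** ctr A ** J ** (A ** ctr A)) ** J ** A"
    by (simp add: S_def matrix_mul_assoc)
  then have "S ** S ** S = 0" by (simp add: assms)
  then have "ctr (S ** S) ** (S ** S) = 0"
    by (simp add: ctr_mult cS msimps matrix_mul_assoc)
  then have "S ** S = 0" by (simp only: mult_ctr_self_eq_0)
  then have "ctr S ** S = 0" by (simp add: cS msimps)
  then show ?thesis by (simp only: mult_ctr_self_eq_0 S_def[symmetric])
qed

lemma isotropic_frame_vector: "ctr A ** J ** A = 0 \<Longrightarrow> hf (A *v x) (J *v (A *v y)) = 0"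
  by (simp add: hf_matrix_left matrix_vector_mul_assoc matrix_mul_assoc)

lemma coneE:
  assumes "X \<in> cone"
  obtains A :: "'k^'n^'n" where "X = J ** (A ** ctr A)" "ctr A ** J ** A = 0" "rdim A = rdim X"
proof -
  obtain M where M: "X = J ** M" "psd M" "M ** J ** M = 0" using assms by (auto simp: cone_def)
  obtain A :: "'k^'n^'n" where A: "M = A ** ctr A" by (rule psd_decompose[OF M(2)])
  show ?thesis
    using that[of A] M isotropic_factor[of A] by (simp add: A rdim_J_mult rdim_mult_ctr)
qed

text \<open>The pairs \<open>(g, inverse g)\<close> with \<open>g\<close> in the unitary group of the form given by \<open>J\<close>.\<close>

definition unitary_pair :: "'k^'n^'n \<Rightarrow> 'k^'n^'n \<Rightarrow> bool" where
  "unitary_pair g h \<longleftrightarrow> g ** h = mat 1 \<and> h ** g = mat 1 \<and> g ** J = J ** ctr h"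

lemma unitary_pair_sym: "unitary_pair g h \<Longrightarrow> unitary_pair h g"
proof -
  assume *: "unitary_pair g h"
  then have "ctr (g ** J) = ctr (J ** ctr h)" by (simp add: unitary_pair_def)
  then have "J ** ctr g = h ** J"
    by (simp add: ctr_mult ctr_J matrix_minus_left matrix_minus_right)
  with * show ?thesis by (simp add: unitary_pair_def)
qed

section \<open>The unitary group of the form and its action on the cone\<close>

lemma unitary_pair_comp:
  assumes "unitary_pair g h" "unitary_pair g' h'"
  shows "unitary_pair (g ** g') (h' ** h)"
proof -
  have "g ** g' ** (h' ** h) = g ** (g' ** h') ** h" "h' ** h ** (g ** g') = h' ** (h ** g) ** g'"
    by (simp_all add: matrix_mul_assoc)
  moreover have "g ** g' ** J = J ** ctr (h' ** h)"
  proof -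
    have "g ** g' ** J = g ** (J ** ctr h')"
      using assms(2) by (simp add: unitary_pair_def flip: matrix_mul_assoc)
    also have "\<dots> = J ** ctr h ** ctr h'"
      using assms(1) by (simp add: unitary_pair_def matrix_mul_assoc)
    finally show ?thesis by (simp add: ctr_mult matrix_mul_assoc)
  qed
  ultimately show ?thesis using assms by (simp add: unitary_pair_def)
qed

lemma unitary_pair_1: "unitary_pair (mat 1) (mat 1)"
  by (simp add: unitary_pair_def)

lemma unitary_pair_cone:
  assumes gh: "unitary_pair g h" and X: "X \<in> cone"
  shows "g ** X ** h \<in> cone" and "rdim (g ** X ** h) = rdim X"
proof -
  obtain M where M: "X = J ** M" "psd M" "M ** J ** M = 0" using X by (auto simp: cone_def)
  \<comment> \<open>Conjugation of \<open>J ** M\<close> by \<open>g\<close> is congruence of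
    \<open>M\<close> by \<open>ctr h\<close>.\<close>
  have eq: "g ** X ** h = J ** (ctr h ** M ** ctr (ctr h))"
    using gh by (simp add: M(1) unitary_pair_def matrix_mul_assoc)
  have "- (J ** (g ** X ** h)) = ctr h ** M ** ctr (ctr h)"
    by (simp only: eq J_J_mult minus_minus)
  then have "psd (- (J ** (g ** X ** h)))"
    using psd_congruence[OF M(2), of "ctr h"] by (simp only:)
  moreover have "(g ** X ** h) ** (g ** X ** h) = 0"
  proof -
    have "(g ** X ** h) ** (g ** X ** h) = g ** X ** (h ** g) ** X ** h"
      by (simp add: matrix_mul_assoc)
    moreover have "h ** g = mat 1" using gh by (simp add: unitary_pair_def)
    ultimately have "(g ** X ** h) ** (g ** X ** h) = g ** (X ** X) ** h"
      by (simp only: matrix_mul_rid matrix_mul_assoc)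
    then show ?thesis using X by (simp add: cone_iff)
  qed
  ultimately show "g ** X ** h \<in> cone" by (simp add: cone_iff)
  have "rdim (g ** (X ** h)) = rdim (X ** h)"
    using gh by (intro rdim_mult_invertible) (auto simp: unitary_pair_def)
  also have "\<dots> = rdim (ctr h ** ctr X)"
    by (metis ctr_mult rdim_ctr)
  also have "\<dots> = rdim (ctr X)"
  proof (rule rdim_mult_invertible)
    show "ctr g ** ctr h = mat 1"
      using gh by (simp add: unitary_pair_def flip: ctr_mult)
  qed
  finally show "rdim (g ** X ** h) = rdim X" by (simp add: rdim_ctr matrix_mul_assoc)
qed

text \<open>For \<open>Y\<close> in \<open>u_alg J\<close>, \<open>ctr (- Y)\<close> is the
  conjugate of \<open>Y\<close> by \<open>J\<close>, and the exponential respects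
  conjugation.\<close>

lemma unitary_pair_mexp:
  assumes "Y \<in> u_alg J"
  shows "unitary_pair (mexp Y) (mexp (- Y))"
proof -
  have "ctr (mexp (- Y)) = mexp (J ** Y ** (- J))"
    by (simp add: ctr_mexp ctr_minus u_alg_ctr[OF assms] matrix_minus_right)
  also have "\<dots> = J ** mexp Y ** (- J)"
    by (rule mexp_conj) (simp add: matrix_minus_left J_J)
  finally have "J ** ctr (mexp (- Y)) = mexp Y ** J"
    by (simp add: matrix_minus_right J_J_mult flip: matrix_mul_assoc)
  then show ?thesis by (simp add: unitary_pair_def mexp_minus)
qed

text \<open>Supplies the direction of a transvection that acts on two given frames at once. If
  \<open>w\<close> and \<open>w'\<close> are not orthogonal, \<open>J *v w\<close> serves; otherwise
  \<open>J\<close> applied to an isotropic combination of both.\<close>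

lemma exists_isotropic_nonorthogonal:
  assumes w: "w \<noteq> 0" "hf w (J *v w) = 0" and w': "w' \<noteq> 0" "hf w' (J *v w') = 0"
  obtains y where "hf y (J *v y) = 0" "hf y (J *v w) \<noteq> 0" "hf w' (J *v y) \<noteq> 0"
proof (cases "hf w w' = 0")
  case False
  then have "hf w' w \<noteq> 0" by (metis cj_0 cj_hf)
  then show ?thesis
    using that[of "J *v w"] w by (simp add: hf_J_J J_J_vector hf_minus_right hf_J_left)
next
  case True
  then have T': "hf w' w = 0" by (metis cj_0 cj_hf)
  define q where "q = hf w (J *v w')"
  \<comment> \<open>Makes \<open>q * l\<close> real, so that \<open>w + w' *r l\<close> is
    isotropic, while keeping \<open>l\<close> nonzero.\<close>
  define l where "l = (if q = 0 then 1 else cj q)"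
  have l0: "l \<noteq> 0" by (auto simp: l_def) (metis cj_0 cj_cj)
  have ql: "cj (q * l) = q * l" by (simp add: l_def cj_mult)
  have q': "hf w' (J *v w) = - cj q"
    by (simp add: q_def cj_hf hf_J_left)
  define u where "u = w + w' *r l"
  have "hf u (J *v u) = q * l - cj (q * l)"
    by (simp add: u_def matrix_vector_right_distrib matrix_vector_scr hf_simps w w' q' cj_mult flip: q_def)
  then have u: "hf u (J *v u) = 0" by (simp add: ql)
  show ?thesis
  proof (rule that[of "J *v u"])
    show "hf (J *v u) (J *v (J *v u)) = 0" by (simp add: hf_J_J u)
    show "hf (J *v u) (J *v w) \<noteq> 0"
      using w by (simp add: hf_J_J u_def hf_simps T')
    show "hf w' (J *v (J *v u)) \<noteq> 0"
      using w' l0 by (simp add: J_J_vector u_def hf_simps T')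
  qed
qed

end

text \<open>The last two assumptions list the elements needed for transvections and for testing
  ad-nilpotency. Their side conditions are what puts these elements into the trace zero algebra in
  the case of su(p,q).\<close>

locale hermitian_type = complex_structure J for J :: "'k::involutive_algebra^'n^'n" +
  fixes \<gg> :: "('k^'n^'n) set"
  assumes subspace_\<gg>: "subspace \<gg>"
    and \<gg>_subset: "\<gg> \<subseteq> u_alg J"
    and frame_in: "\<And>D H :: 'k^'n^'n. ctr D ** J ** D = 0 \<Longrightarrow> ctr H = H \<Longrightarrow> J ** (D ** H ** ctr D) \<in> \<gg>"
    and outer_in: "\<And>u v. cj (hf u (J *v v)) = hf u (J *v v) \<Longrightarrow> J ** (outer u v + outer v u) \<in> \<gg>"
begin

lemma outer_self_in: "hf a (J *v a) = 0 \<Longrightarrow> J ** outer a a \<in> \<gg>"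
proof -
  assume "hf a (J *v a) = 0"
  then have "J ** (outer ((1/2) *\<^sub>R a) a + outer a ((1/2) *\<^sub>R a)) \<in> \<gg>"
    by (intro outer_in) (simp add: hf_scaleR_left)
  moreover have "outer ((1/2) *\<^sub>R a) a + outer a ((1/2) *\<^sub>R a) = outer a a"
    by (simp add: outer_def vec_eq_iff cj_scaleR flip: scaleR_left_distrib)
  ultimately show ?thesis by simp
qed

lemma cone_subset: "cone \<subseteq> \<gg>"
proof
  fix X assume "X \<in> cone"
  then obtain A :: "'k^'n^'n" where "X = J ** (A ** ctr A)" "ctr A ** J ** A = 0" by (rule coneE)
  then show "X \<in> \<gg>" using frame_in[of A "mat 1"] by simp
qed

subsection \<open>Nilpotency of the adjoint action\<close>

text \<open>Each term of the third power of ad X has at least two factors X on one side.\<close>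

lemma lie_nilpotent_square_zero:
  assumes "X \<in> \<gg>" "X ** X = 0"
  shows "lie_nilpotent \<gg> X"
proof -
  have 1: "X ** (X ** Z) = 0" for Z by (simp add: matrix_mul_assoc assms)
  have "(lie X ^^ 3) Y = 0" for Y
    by (simp add: lie_def eval_nat_numeral msimps massoc 1 assms)
  then show ?thesis using assms by (auto simp: lie_nilpotent_def)
qed

text \<open>\<open>T = M ** J\<close> is skew for the semidefinite form \<open>M\<close>, so
  vanishing of \<open>mpow T (2 * j) ** M\<close> makes \<open>mpow T j ** A\<close> vanish by
  definiteness. Halving the exponent leads down to 1.\<close>

lemma nilpotent_imp_isotropic:
  assumes M: "psd M" and k: "mpow (M ** J) k = 0"
  shows "M ** J ** M = 0"
proof -
  define T where "T = M ** J"
  obtain A :: "'k^'n^'n" where A: "M = A ** ctr A" by (rule psd_decompose[OF M])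
  have TM: "T ** M = - (M ** ctr T)"
    using psd_ctr[OF M] by (simp add: T_def ctr_mult ctr_J msimps matrix_mul_assoc)
  have pow: "mpow T j ** M = (- 1) ^ j *\<^sub>R (M ** ctr (mpow T j))" for j
  proof (induction j)
    case (Suc j)
    have "mpow T (Suc j) ** M = T ** (mpow T j ** M)"
      by (simp add: mpow_Suc matrix_mul_assoc)
    also have "\<dots> = (- 1) ^ j *\<^sub>R ((T ** M) ** ctr (mpow T j))"
      by (simp add: Suc msimps matrix_mul_assoc)
    also have "\<dots> = (- 1) ^ Suc j *\<^sub>R (M ** (ctr T ** ctr (mpow T j)))"
      by (simp add: TM msimps matrix_mul_assoc)
    also have "ctr T ** ctr (mpow T j) = ctr (mpow T (Suc j))"
      by (simp add: mpow_Suc2 ctr_mult)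
    finally show ?case .
  qed simp
  have halve: "mpow T j ** M = 0" if "mpow T (j + j) ** M = 0" for j
  proof -
    have "mpow T (j + j) ** M = mpow T j ** (mpow T j ** M)"
      by (simp add: mpow_add matrix_mul_assoc)
    also have "\<dots> = (- 1) ^ j *\<^sub>R (mpow T j ** M ** ctr (mpow T j))"
      by (subst pow) (simp add: msimps matrix_mul_assoc)
    finally have "mpow T j ** M ** ctr (mpow T j) = 0" using that by simp
    then have "ctr (ctr (mpow T j ** A)) ** ctr (mpow T j ** A) = 0"
      by (simp add: A ctr_mult matrix_mul_assoc)
    then have "ctr (mpow T j ** A) = 0" by (simp only: mult_ctr_self_eq_0)
    then have "mpow T j ** A = 0" by (simp only: ctr_eq_0_iff)
    then show ?thesis by (simp add: A matrix_mul_assoc)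
  qed
  have "mpow T 1 ** M = 0" if "mpow T j ** M = 0" for j
    using that
  proof (induction j rule: less_induct)
    case (less j)
    consider "j = 0" | "j = 1" | "j \<ge> 2" by linarith
    then show ?case
    proof cases
      case 3
      \<comment> \<open>Half of \<open>j\<close> rounded up: twice this reaches \<open>j\<close>,
        and for \<open>j >= 2\<close> it is still smaller than \<open>j\<close>.\<close>
      define i where "i = (j + 1) div 2"
      have i: "i < j" "i + i \<ge> j" using 3 by (auto simp: i_def)
      have "mpow T (i + i) ** M = mpow T (i + i - j) ** (mpow T j ** M)"
        using i(2) mpow_add[of T "i + i - j" j] by (simp add: matrix_mul_assoc)
      also have "\<dots> = 0" by (simp only: less.prems matrix_0_right)
      finally have "mpow T i ** M = 0" by (rule halve)
      then show ?thesis using less.IH i(1) by blast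
    next
      case 1
      then have "M = 0" using less.prems by simp
      then show ?thesis by simp
    next
      case 2
      then show ?thesis using less.prems by simp
    qed
  qed
  from this[of k] k show ?thesis by (simp add: T_def mpow_Suc)
qed

text \<open>If \<open>M\<close> is singular, a vector \<open>u\<close> killed by
  \<open>T = M ** J\<close> gives rank-two test elements on which ad acts through \<open>T\<close>,
  so \<open>T\<close> is nilpotent. If \<open>M\<close> is invertible, its factor \<open>A\<close>
  carries ad over to the commutator with a skew-hermitian \<open>S\<close>. That map is skew for the
  inner product, so nilpotency on \<open>P\<close> means that it kills \<open>P\<close>, and this
  contradicts the existence of an isotropic vector.\<close>

lemma lie_nilpotent_imp_isotropic:
  assumes M: "psd M" and nil: "lie_nilpotent \<gg> (J ** M)"
    and a: "a \<noteq> 0" "hf a (J *v a) = 0"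
  shows "M ** J ** M = 0"
proof -
  have cM: "ctr M = M" by (rule psd_ctr[OF M])
  define \<delta> where "\<delta> N = M ** J ** N - N ** J ** M" for N
  obtain m where m: "\<And>Y. Y \<in> \<gg> \<Longrightarrow> (lie (J ** M) ^^ m) Y = 0"
    using nil by (auto simp: lie_nilpotent_def)
  have "(lie (J ** M) ^^ j) (J ** N) = J ** (\<delta> ^^ j) N" for j N
    by (induction j) (simp_all add: lie_def \<delta>_def msimps matrix_mul_assoc)
  then have \<delta>: "(\<delta> ^^ m) N = 0" if "J ** N \<in> \<gg>" for N
    using m[OF that] J_mult_inj[of "(\<delta> ^^ m) N" 0] by simp
  show ?thesis
  proof (cases "\<exists>w. w \<noteq> 0 \<and> M *v w = 0")
    case True
    then obtain w where w: "w \<noteq> 0" "M *v w = 0" by blast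
    define u where "u = J *v w"
    define T where "T = M ** J"
    have u: "u \<noteq> 0" "T *v u = 0"
      using w by (simp_all add: u_def T_def J_vector_eq_0_iff J_J_vector matrix_vector_minus_right
          flip: matrix_vector_mul_assoc)
    define N where "N v = outer u v + outer v u" for v
    have "\<delta> (N v) = N (T *v v)" for v
    proof -
      have "N v ** J ** M = N v ** - ctr T"
        by (simp add: T_def ctr_mult cM ctr_J matrix_minus_left matrix_minus_right massoc)
      then have "\<delta> (N v) = T ** N v + N v ** ctr T"
        by (simp add: \<delta>_def T_def matrix_minus_right)
      then show ?thesis
        using u(2) by (simp add: N_def msimps matrix_mult_outer outer_mult_matrix)
    qed
    then have pow: "(\<delta> ^^ j) (N v) = N (mpow T j *v v)" for j v
      by (induction j) (simp_all add: mpow_Suc matrix_vector_mul_assoc)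
    have "mpow T (Suc m) *v v = 0" for v
    proof -
      define q where "q = hf u (J *v v)"
      \<comment> \<open>Rescales \<open>v\<close> to meet the reality condition of
        \<open>outer_in\<close>; being nonzero, \<open>l\<close> is cancelled at the end.\<close>
      define l where "l = (if q = 0 then 1 else cj q)"
      have l0: "l \<noteq> 0" by (auto simp: l_def) (metis cj_0 cj_cj)
      have "cj (hf u (J *v (v *r l))) = hf u (J *v (v *r l))"
        by (simp add: matrix_vector_scr hf_scr_right l_def cj_mult flip: q_def)
      then have "J ** N (v *r l) \<in> \<gg>" unfolding N_def by (rule outer_in)
      from \<delta>[OF this] have "N (mpow T m *v (v *r l)) = 0" by (simp only: pow)
      define y where "y = mpow T m *v (v *r l)"
      \<comment> \<open>At \<open>u\<close>, the test element returns a multiple of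
        \<open>u\<close>, which \<open>T\<close> kills, plus \<open>y\<close> times the squared norm
        of \<open>u\<close>. Hence \<open>T *v y = 0\<close>, at the cost of one more power of
        \<open>T\<close>.\<close>
      have "N y *v u = 0" using \<open>N (mpow T m *v (v *r l)) = 0\<close> by (simp add: y_def)
      then have "u *r hf y u + y *r hf u u = 0"
        by (simp add: N_def matrix_vector_mult_add_rdistrib outer_mult_vector)
      then have "T *v (u *r hf y u + y *r hf u u) = 0" by simp
      then have "(T *v y) *r hf u u = 0"
        by (simp add: matrix_vector_right_distrib matrix_vector_scr u)
      then have "T *v y = 0" using u(1) by (simp add: scr_eq_0_iff)
      then have "(mpow T (Suc m) *v v) *r l = 0"
        by (simp add: y_def mpow_Suc matrix_vector_mul_assoc flip: matrix_vector_scr)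
      then show ?thesis using l0 by (simp add: scr_eq_0_iff)
    qed
    then have "mpow T (Suc m) = 0" by (simp add: matrix_eq)
    then show ?thesis unfolding T_def by (rule nilpotent_imp_isotropic[OF M])
  next
    case False
    obtain A :: "'k^'n^'n" where A: "M = A ** ctr A" by (rule psd_decompose[OF M])
    have "v = 0" if "ctr A *v v = 0" for v
    proof -
      have "M *v v = A *v (ctr A *v v)" by (simp add: A matrix_vector_mul_assoc)
      also have "\<dots> = 0" by (simp add: that)
      finally show ?thesis using False by blast
    qed
    from exists_right_inverse[OF this] obtain C where C: "ctr A ** C = mat 1" by blast
    define B where "B = ctr C"
    have BA: "B ** A = mat 1" using arg_cong[OF C, of ctr] by (simp add: ctr_mult B_def)
    then have AB: "A ** B = mat 1" by (rule left_inverse_imp_right_inverse)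
    have AB': "ctr A ** ctr B = mat 1" by (simp add: B_def C)
    define x where "x = B *v a"
    have Ax: "A *v x = a" by (simp add: x_def matrix_vector_mul_assoc AB)
    define S where "S = ctr A ** J ** A"
    have cS: "ctr S = - S"
      by (simp add: S_def ctr_mult ctr_J matrix_minus_left matrix_minus_right matrix_mul_assoc)
    define \<sigma> where "\<sigma> Q = S ** Q - Q ** S" for Q
    have "\<delta> (A ** Q ** ctr A) = A ** \<sigma> Q ** ctr A" for Q
      by (simp add: \<delta>_def \<sigma>_def S_def A msimps matrix_mul_assoc)
    then have pow: "(\<delta> ^^ j) (A ** Q ** ctr A) = A ** (\<sigma> ^^ j) Q ** ctr A" for j Q
      by (induction j) simp_all
    define P where "P = outer x x"
    have APA: "A ** P ** ctr A = outer a a"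
      by (simp add: P_def matrix_mult_outer outer_mult_matrix Ax)
    have "A ** (\<sigma> ^^ m) P ** ctr A = 0"
      using \<delta>[OF outer_self_in[OF a(2)]] by (simp add: APA flip: pow)
    then have "B ** (A ** (\<sigma> ^^ m) P ** ctr A) ** ctr B = 0" by simp
    then have "(B ** A) ** (\<sigma> ^^ m) P ** (ctr A ** ctr B) = 0"
      by (simp only: matrix_mul_assoc)
    then have "(\<sigma> ^^ m) P = 0" by (simp add: BA AB')
    \<comment> \<open>For a skew map the squared norm of a positive iterate pairs the previous
      iterate with the next one, so vanishing descends to the first iterate.\<close>
    have skew: "inner (\<sigma> Q) R = - inner Q (\<sigma> R)" for Q R
    proof -
      have "inner (S ** Q) R = - inner Q (S ** R)"
        using inner_mult_left_ctr[of S Q R] by (simp add: cS matrix_minus_left)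
      moreover have "inner (Q ** S) R = - inner Q (R ** S)"
        using inner_mult_right_ctr[of Q S R] by (simp add: cS matrix_minus_right)
      ultimately show ?thesis by (simp add: \<sigma>_def inner_diff_left inner_diff_right)
    qed
    have "\<sigma> P = 0" if "(\<sigma> ^^ j) P = 0" for j
      using that
    proof (induction j)
      case (Suc j)
      show ?case
      proof (cases j)
        case 0
        then show ?thesis using Suc.prems by simp
      next
        case (Suc i)
        have "inner ((\<sigma> ^^ j) P) ((\<sigma> ^^ j) P) = - inner ((\<sigma> ^^ i) P) ((\<sigma> ^^ Suc j) P)"
          unfolding Suc by (simp add: skew)
        then have "(\<sigma> ^^ j) P = 0" using Suc.prems by simp
        then show ?thesis by (rule Suc.IH)
      qed
    qed (simp add: \<sigma>_def)
    with \<open>(\<sigma> ^^ m) P = 0\<close> have "\<sigma> P = 0" by blast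
    \<comment> \<open>\<open>S\<close> commutes with \<open>outer x x\<close>, so
      \<open>S *v x\<close> is a multiple of \<open>x\<close>. Isotropy of \<open>a\<close> makes
      \<open>S *v x\<close> orthogonal to \<open>x\<close>, hence zero, against the invertibility of
      \<open>A\<close>, \<open>J\<close> and \<open>ctr A\<close>.\<close>
    then have "\<sigma> P *v x = 0" by simp
    moreover have "hf x (S *v x) = 0"
      using a(2) by (simp add: S_def hf_matrix_right Ax flip: matrix_vector_mul_assoc)
    ultimately have "(S *v x) *r hf x x = 0"
      by (simp add: \<sigma>_def P_def matrix_mult_outer matrix_vector_mult_diff_rdistrib outer_mult_vector
          flip: matrix_vector_mul_assoc)
    moreover have "x \<noteq> 0" using Ax a(1) by auto
    ultimately have "ctr A *v (J *v a) = 0"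
      by (simp add: scr_eq_0_iff S_def Ax flip: matrix_vector_mul_assoc)
    then have "(ctr B ** ctr A) *v (J *v a) = 0"
      by (simp flip: matrix_vector_mul_assoc)
    moreover have "ctr B ** ctr A = mat 1" by (simp add: AB flip: ctr_mult)
    ultimately show ?thesis using a(1) by (simp add: J_vector_eq_0_iff)
  qed
qed

lemma nilpotent_non_negative_iff:
  assumes a: "a \<noteq> 0" "hf a (J *v a) = 0"
  shows "X \<in> \<gg> \<and> lie_nilpotent \<gg> X \<and> non_negative J X \<longleftrightarrow> X \<in> cone"
proof
  assume X: "X \<in> \<gg> \<and> lie_nilpotent \<gg> X \<and> non_negative J X"
  define M where "M = - (J ** X)"
  have XM: "X = J ** M" by (simp add: M_def matrix_minus_right J_J_mult)
  have "psd M" using X by (simp add: non_negative_iff M_def)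
  moreover have "M ** J ** M = 0"
    using X calculation lie_nilpotent_imp_isotropic[OF _ _ a] by (simp add: XM)
  ultimately show "X \<in> cone" unfolding cone_def XM by blast
next
  assume "X \<in> cone"
  then show "X \<in> \<gg> \<and> lie_nilpotent \<gg> X \<and> non_negative J X"
    using cone_subset lie_nilpotent_square_zero by (auto simp: non_negative_iff cone_iff)
qed

subsection \<open>The adjoint group\<close>

lemma adjoint_group_unitary:
  assumes "\<phi> \<in> adjoint_group \<gg>"
  obtains g h where "unitary_pair g h" "\<phi> = (\<lambda>X. g ** X ** h)"
proof -
  have "\<exists>g h. unitary_pair g h \<and> \<phi> = (\<lambda>X. g ** X ** h)"
    using assms
  proof induction
    case 1
    then show ?case
      by (intro exI[of _ "mat 1"]) (auto simp: unitary_pair_1)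
  next
    case (2 Y \<phi>)
    then obtain g h where gh: "unitary_pair g h" "\<phi> = (\<lambda>X. g ** X ** h)" by blast
    have "unitary_pair (mexp Y ** g) (h ** mexp (- Y))"
      using 2 \<gg>_subset by (intro unitary_pair_comp unitary_pair_mexp gh) auto
    moreover have "exp_ad Y \<circ> \<phi> = (\<lambda>X. (mexp Y ** g) ** X ** (h ** mexp (- Y)))"
      by (simp add: fun_eq_iff gh exp_ad_eq matrix_mul_assoc)
    ultimately show ?case by blast
  qed
  then show ?thesis using that by blast
qed

lemma adjoint_group_comp:
  assumes "\<phi> \<in> adjoint_group \<gg>" "\<psi> \<in> adjoint_group \<gg>"
  shows "\<phi> \<circ> \<psi> \<in> adjoint_group \<gg>"
  using assms by induction (auto simp: comp_assoc intro: adjoint_group.intros)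

text \<open>Only \<open>A ** ctr A\<close> enters, so a frame may be multiplied on the right by any
  unitary matrix.\<close>

definition reach :: "'k^'n^'n \<Rightarrow> 'k^'n^'n \<Rightarrow> bool" where
  "reach A B \<longleftrightarrow> (\<exists>\<phi>\<in>adjoint_group \<gg>. \<phi> (J ** (A ** ctr A)) = J ** (B ** ctr B))"

lemma reach_trans:
  assumes "reach A B" "reach B C"
  shows "reach A C"
proof -
  obtain \<phi> \<psi> where "\<phi> \<in> adjoint_group \<gg>" "\<phi> (J ** (A ** ctr A)) = J ** (B ** ctr B)"
    "\<psi> \<in> adjoint_group \<gg>" "\<psi> (J ** (B ** ctr B)) = J ** (C ** ctr C)"
    using assms unfolding reach_def by blast
  then show ?thesis
    unfolding reach_def by (intro bexI[of _ "\<psi> \<circ> \<phi>"] adjoint_group_comp) simp_all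
qed

lemma reach_refl: "reach A A"
  unfolding reach_def by (rule bexI[of _ id]) (auto intro: adjoint_group.intros)

text \<open>\<open>J ** N\<close> squares to zero, so its exponential is
  \<open>mat 1 + J ** N\<close>. Passing it across \<open>J\<close>, and using that
  \<open>ctr (mat 1 + N ** J)\<close> is \<open>mat 1 - J ** N\<close>, turns conjugation into a
  change of frame.\<close>

lemma reach_transvection:
  assumes N: "ctr N = N" "N ** J ** N = 0" "J ** N \<in> \<gg>"
  shows "reach A ((mat 1 + N ** J) ** A)"
proof -
  have "(J ** N) ** (J ** N) = J ** (N ** J ** N)" by (simp add: matrix_mul_assoc)
  then have sq: "(J ** N) ** (J ** N) = 0" by (simp add: N)
  have "(- (J ** N)) ** (- (J ** N)) = 0" using sq by (simp add: msimps)
  then have "exp_ad (J ** N) X = (mat 1 + J ** N) ** X ** (mat 1 - J ** N)" for X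
    using sq by (simp add: exp_ad_eq mexp_square_zero)
  then have "(exp_ad (J ** N) \<circ> id) (J ** (A ** ctr A))
      = J ** (((mat 1 + N ** J) ** A) ** ctr ((mat 1 + N ** J) ** A))"
    by (simp add: ctr_mult ctr_add ctr_J N msimps matrix_mul_assoc)
  moreover have "exp_ad (J ** N) \<circ> id \<in> adjoint_group \<gg>"
    by (intro adjoint_group.intros N)
  ultimately show ?thesis unfolding reach_def by blast
qed

lemma transvection:
  assumes N: "ctr N = N" "N ** J ** N = 0"
  shows transvection_isotropic: "ctr A ** J ** A = 0 \<Longrightarrow>
      ctr ((mat 1 + N ** J) ** A) ** J ** ((mat 1 + N ** J) ** A) = 0"
    and transvection_inverse: "(mat 1 - N ** J) ** (mat 1 + N ** J) = mat 1"
proof -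
  have 1: "N ** (J ** (N ** Z)) = 0" for Z by (simp add: matrix_mul_assoc N)
  have 2: "N ** (J ** N) = 0" by (simp add: matrix_mul_assoc N)
  have "ctr ((mat 1 + N ** J) ** A) ** J ** ((mat 1 + N ** J) ** A) = ctr A ** J ** A"
    by (simp add: ctr_mult ctr_add ctr_J N msimps massoc 1 2)
  then show "ctr A ** J ** A = 0 \<Longrightarrow>
      ctr ((mat 1 + N ** J) ** A) ** J ** ((mat 1 + N ** J) ** A) = 0" by simp
  show "(mat 1 - N ** J) ** (mat 1 + N ** J) = mat 1"
    by (simp add: msimps massoc 1 2)
qed

lemma ker_invertible_mult: "H ** G = mat 1 \<Longrightarrow> ker (G ** A) = ker (A :: 'k^'n^'n)"
proof safe
  fix v assume "H ** G = mat 1" "(G ** A) *v v = 0"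
  then have "(H ** G) *v (A *v v) = 0"
    by (metis matrix_vector_mul_assoc matrix_vector_mult_0_right)
  then show "A *v v = 0" by (simp add: \<open>H ** G = mat 1\<close>)
qed (simp flip: matrix_vector_mul_assoc)

text \<open>Transvections along suitable isotropic vectors move an isotropic frame into general position
  relative to a second one.\<close>

lemma reach_general_position:
  assumes "ctr A ** J ** A = 0" "ctr A' ** J ** A' = 0" "rdim A = rdim A'"
  shows "\<exists>B. reach A B \<and> ctr B ** J ** B = 0 \<and> ker B = ker A \<and> ker (ctr A' ** J ** B) = ker A"
  using assms
proof (induction "dim (ker (ctr A' ** J ** A))" arbitrary: A rule: less_induct)
  case less
  define C where "C = ctr A' ** J ** A"
  have sub: "ker A \<subseteq> ker C"
    by (auto simp: C_def simp flip: matrix_vector_mul_assoc)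
  show ?case
  proof (cases "ker C \<subseteq> ker A")
    case True
    then show ?thesis using sub less.prems reach_refl unfolding C_def by blast
  next
    case False
    then obtain x where x: "C *v x = 0" "A *v x \<noteq> 0" by blast
    \<comment> \<open>Both frames have the same rank, so a defect in the kernel of the Gram matrix
      appears on the side of \<open>A'\<close> as well.\<close>
    have "\<not> ker (ctr C) \<subseteq> ker A'"
    proof
      assume "ker (ctr C) \<subseteq> ker A'"
      then have "dim (ker (ctr C)) \<le> dim (ker A')" by (rule dim_subset)
      then have "rdim A' \<le> rdim C"
        using dim_ker[of "ctr C"] dim_ker[of A'] by (simp add: rdim_ctr)
      then have "ker C = ker A"
        using ker_eqI[OF sub] less.prems by (simp add: less.prems)
      then show False using False by simp
    qed
    then obtain x' where x': "ctr C *v x' = 0" "A' *v x' \<noteq> 0" by blast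
    obtain y where y: "hf y (J *v y) = 0" "hf y (J *v (A *v x)) \<noteq> 0" "hf (A' *v x') (J *v y) \<noteq> 0"
      using exists_isotropic_nonorthogonal[OF x(2) isotropic_frame_vector[OF less.prems(1)]
          x'(2) isotropic_frame_vector[OF less.prems(2)]] by blast
    define N where "N = outer y y"
    have N: "ctr N = N" "N ** J ** N = 0" "J ** N \<in> \<gg>"
    proof -
      show "ctr N = N" by (simp add: N_def ctr_outer)
      show "N ** J ** N = 0"
        by (rule matrix_eq[THEN iffD2])
           (simp add: N_def outer_mult_vector matrix_vector_scr y hf_scr_right flip: matrix_vector_mul_assoc)
      show "J ** N \<in> \<gg>" unfolding N_def by (rule outer_self_in[OF y(1)])
    qed
    define A1 where "A1 = (mat 1 + N ** J) ** A"
    have inv: "(mat 1 - N ** J) ** (mat 1 + N ** J) = mat 1" by (rule transvection_inverse[OF N(1,2)])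
    have kA1: "ker A1 = ker A" unfolding A1_def by (rule ker_invertible_mult[OF inv])
    have iso1: "ctr A1 ** J ** A1 = 0"
      unfolding A1_def by (rule transvection_isotropic[OF N(1,2) less.prems(1)])
    have r1: "rdim A1 = rdim A" unfolding A1_def by (rule rdim_mult_invertible[OF inv])
    define C1 where "C1 = ctr A' ** J ** A1"
    have C1: "C1 *v v = C *v v + (ctr A' *v (J *v y)) *r hf y (J *v (A *v v))" for v
      by (simp add: C1_def A1_def C_def N_def msimps matrix_vector_mult_add_rdistrib outer_mult_vector
          matrix_vector_right_distrib matrix_vector_scr flip: matrix_vector_mul_assoc)
    have "ker C1 \<subseteq> ker C"
    proof safe
      \<comment> \<open>Pairing with \<open>x'\<close>, which \<open>ctr C\<close> kills, isolates
        the coefficient of the rank-one term and shows that it vanishes.\<close>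
      fix v assume v: "C1 *v v = 0"
      then have "hf x' (C1 *v v) = 0" by simp
      then have "hf x' (C *v v) + hf x' (ctr A' *v (J *v y)) * hf y (J *v (A *v v)) = 0"
        by (simp add: C1 hf_add_right hf_scr_right)
      moreover have "hf x' (C *v v) = 0" by (simp add: hf_matrix_right x')
      moreover have "hf x' (ctr A' *v (J *v y)) \<noteq> 0" using y(3) by (simp add: hf_matrix_left)
      ultimately have "hf y (J *v (A *v v)) = 0" by simp
      then show "C *v v = 0" using v by (simp add: C1)
    qed
    moreover have "x \<notin> ker C1"
    proof -
      have "ctr A' *v (J *v y) \<noteq> 0"
        using y(3) by (auto simp: hf_matrix_left)
      then show ?thesis using y(2) by (simp add: C1 x scr_eq_0_iff)
    qed
    ultimately have "ker C1 \<subset> ker C" using x(1) by blast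
    then have "span (ker C1) \<subset> span (ker C)"
      using subspace_ker[of C1] subspace_ker[of C] by (simp only: span_eq_iff[symmetric])
    then have "dim (ker C1) < dim (ker C)" by (rule dim_psubset)
    then have "\<exists>B. reach A1 B \<and> ctr B ** J ** B = 0 \<and> ker B = ker A1 \<and> ker (ctr A' ** J ** B) = ker A1"
      using iso1 less.prems r1 unfolding C1_def C_def by (intro less.hyps) auto
    moreover have "reach A A1" unfolding A1_def by (rule reach_transvection[OF N])
    ultimately show ?thesis using reach_trans unfolding kA1 by blast
  qed
qed

text \<open>In general position, after a unitary change of one of the frames the Gram matrix of the two
  frames is hermitian, and then their difference is isotropic.\<close>

lemma reach_frame:
  assumes A: "ctr A ** J ** A = 0" and A': "ctr A' ** J ** A' = 0" and r: "rdim A = rdim A'"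
  shows "reach A A'"
proof -
  obtain A1 where A1: "reach A A1" "ctr A1 ** J ** A1 = 0" "ker A1 = ker A" "ker (ctr A' ** J ** A1) = ker A"
    using reach_general_position[OF assms] by blast
  obtain U :: "'k^'n^'n" where U: "ctr U ** U = mat 1" "U ** ctr U = mat 1"
    "ctr (ctr A' ** J ** A1 ** U) = ctr A' ** J ** A1 ** U"
    by (rule exists_unitary_hermitian_mult)
  define B where "B = A1 ** U"
  define P where "P = ctr A' ** J ** B"
  have cP: "ctr P = P" using U(3) by (simp add: P_def B_def matrix_mul_assoc)
  have "B ** ctr B = A1 ** (U ** ctr U) ** ctr A1"
    by (simp add: B_def ctr_mult matrix_mul_assoc)
  then have BB: "B ** ctr B = A1 ** ctr A1" by (simp add: U)
  have "ctr B ** J ** B = ctr U ** (ctr A1 ** J ** A1) ** U"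
    by (simp add: B_def ctr_mult matrix_mul_assoc)
  then have isoB: "ctr B ** J ** B = 0" by (simp add: A1)
  have kP: "ker P = ker B"
  proof -
    have "P *v v = 0 \<longleftrightarrow> U *v v \<in> ker (ctr A' ** J ** A1)" for v
      by (simp add: P_def B_def matrix_vector_mul_assoc matrix_mul_assoc)
    also have "\<dots> v \<longleftrightarrow> U *v v \<in> ker A1" for v by (simp only: A1)
    finally show ?thesis by (auto simp: B_def matrix_vector_mul_assoc)
  qed
  have "dim (ker A1) = dim (ker A)" by (simp only: A1)
  then have "rdim A1 = rdim A" using dim_ker[of A1] dim_ker[of A] by simp
  then have rB: "rdim B = rdim A'"
    using rdim_mult_ctr[of B] rdim_mult_ctr[of A1] BB r by simp
  have P': "P = - (ctr B ** J ** A')"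
    using cP by (simp add: P_def ctr_mult ctr_J msimps matrix_mul_assoc)
  have "ker A' \<subseteq> ker P"
    unfolding P' by (auto simp: matrix_vector_minus simp flip: matrix_vector_mul_assoc)
  moreover have "rdim A' \<le> rdim P"
  proof -
    have "dim (ker P) = dim (ker B)" by (simp only: kP)
    then show ?thesis using dim_ker[of P] dim_ker[of B] rB by simp
  qed
  ultimately have kA': "ker A' = ker P" by (rule ker_eqI)
  \<comment> \<open>The cross terms of \<open>ctr D ** J ** D\<close> are \<open>- P\<close> and
    \<open>ctr P\<close>; they cancel because \<open>P\<close> is hermitian.\<close>
  define D where "D = A' - B"
  have kD: "D *v v = 0" if "P *v v = 0" for v
  proof -
    have "v \<in> ker A'" "v \<in> ker B" using that kA' kP by blast+
    then show ?thesis by (simp add: D_def matrix_vector_mult_diff_rdistrib)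
  qed
  have isoD: "ctr D ** J ** D = 0"
    using P' by (simp add: D_def ctr_diff msimps A' isoB P_def[symmetric])
  \<comment> \<open>The transvection with \<open>N = D ** H ** ctr D\<close> adds
    \<open>D ** H ** P\<close> to \<open>B\<close>. Although \<open>P\<close> is singular this
    equals \<open>D\<close>, because \<open>D\<close> vanishes on the kernel of \<open>P\<close>; so
    the image is \<open>A'\<close>.\<close>
  obtain H where H: "ctr H = H" "P ** H ** P = P"
    by (rule exists_hermitian_generalised_inverse[OF cP])
  have DHP: "D ** H ** P = D"
  proof -
    have "P *v ((H ** P) *v v - v) = 0" for v
      using H(2) by (simp add: matrix_vector_mult_diff_distrib matrix_vector_mul_assoc matrix_mul_assoc)
    then have "D *v ((H ** P) *v v - v) = 0" for v by (rule kD)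
    then show ?thesis
      by (simp add: matrix_eq matrix_vector_mult_diff_distrib matrix_vector_mul_assoc matrix_mul_assoc)
  qed
  define N where "N = D ** H ** ctr D"
  have "N ** J ** N = D ** H ** (ctr D ** J ** D) ** H ** ctr D"
    by (simp add: N_def matrix_mul_assoc)
  then have N: "N ** J ** N = 0" by (simp add: isoD)
  have cN: "ctr N = N" by (simp add: N_def ctr_mult H matrix_mul_assoc)
  have "J ** N \<in> \<gg>" unfolding N_def by (rule frame_in[OF isoD H(1)])
  from reach_transvection[OF cN N this] have "reach B ((mat 1 + N ** J) ** B)" .
  also have "(mat 1 + N ** J) ** B = B + D ** H ** (ctr D ** J ** B)"
    by (simp add: msimps N_def matrix_mul_assoc)
  also have "ctr D ** J ** B = P"
    by (simp add: D_def ctr_diff msimps isoB P_def)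
  also have "B + D ** H ** P = A'" by (simp only: DHP) (simp add: D_def)
  finally have "reach A1 A'" by (simp add: reach_def BB)
  with A1(1) show ?thesis by (rule reach_trans)
qed

lemma cone_transitive:
  assumes "X \<in> cone" "Y \<in> cone" "rdim X = rdim Y"
  obtains \<phi> where "\<phi> \<in> adjoint_group \<gg>" "\<phi> X = Y"
proof -
  obtain A :: "'k^'n^'n" where A: "X = J ** (A ** ctr A)" "ctr A ** J ** A = 0" "rdim A = rdim X"
    by (rule coneE[OF assms(1)])
  obtain B :: "'k^'n^'n" where B: "Y = J ** (B ** ctr B)" "ctr B ** J ** B = 0" "rdim B = rdim Y"
    by (rule coneE[OF assms(2)])
  have "reach A B" using A B assms(3) by (intro reach_frame) auto
  then show ?thesis using that A B by (auto simp: reach_def)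
qed

end

subsection \<open>H1-triples\<close>

text \<open>\<open>z\<close> is fixed only up to elements that commute with everything, which
  absorbs the scalar shift in \<open>z_su\<close>. The rank bound is the Witt index of the form in
  terms of \<open>r\<close>.\<close>

locale hermitian_type_rank = hermitian_type J \<gg> for J :: "'k::involutive_algebra^'n^'n" and \<gg> +
  fixes z :: "'k^'n^'n" and r :: nat
  assumes lie_z: "\<And>X. lie z X = (1/2) *\<^sub>R (J ** X - X ** J)"
    and isotropic_rank_le: "\<And>A :: 'k^'n^'n. ctr A ** J ** A = 0 \<Longrightarrow> rdim A \<le> DIM('k) * r"
begin

text \<open>For an \<open>H\<^sub>1\<close>-triple the symmetric element \<open>p = e + f\<close> satisfies \<open>p\<^sup>3 = p\<close>, whence \<open>- J ** e\<close>
  is the orthogonal projection \<open>(p\<^sup>2 - J ** p) / 2\<close>.\<close>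

definition tripotent :: "'k^'n^'n \<Rightarrow> bool" where
  "tripotent p \<longleftrightarrow> ctr p = p \<and> p ** J = - (J ** p) \<and> p ** (p ** p) = p"

definition proj :: "'k^'n^'n \<Rightarrow> 'k^'n^'n" where
  "proj p = (1/2) *\<^sub>R (p ** p - J ** p)"

text \<open>With p = e + f and n = e - f: elements of the p-part anticommute with \<open>J\<close>,
  so [z,p] = h gives h = J p. Then [h,p] = 2 n gives n = J p^2, and [h,n] = 2 p gives p^3 =
  p.\<close>

lemma H1_triple_tripotent:
  assumes "H1_triple \<gg> z e f h"
  shows "tripotent (e + f)" "e = J ** proj (e + f)" "h = J ** (e + f)"
proof -
  define p n where "p = e + f" and "n = e - f"
  have H: "lie h e = 2 *\<^sub>R e" "lie h f = (- 2) *\<^sub>R f" "lie e f = h"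
    "e - f \<in> k_part \<gg> z" "e + f \<in> p_part \<gg> z" "lie z (e + f) = h"
    and efg: "e \<in> \<gg>" "f \<in> \<gg>"
    using assms by (auto simp: H1_triple_def)
  obtain Y where "p = lie z Y" using H(5) by (auto simp: p_part_def p_def)
  then have "p ** J = - (J ** p)"
    by (simp add: lie_z msimps J_J_mult massoc) (simp add: matrix_mul_assoc J_J algebra_simps msimps)
  then have pJ: "p ** J = - (J ** p)" and pJ': "p ** (J ** X) = - (J ** (p ** X))" for X
    by (simp_all add: matrix_mul_assoc matrix_minus_left)
  have "p \<in> u_alg J" using efg \<gg>_subset subspace_add[OF subspace_\<gg>] by (auto simp: p_def)
  then have "ctr p = J ** p ** J" by (rule u_alg_ctr)
  then have cp: "ctr p = p" by (simp add: massoc pJ matrix_minus_right J_J_mult)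
  have "h = (1/2) *\<^sub>R (J ** p - p ** J)" using H(6) by (simp add: lie_z p_def)
  also have "\<dots> = J ** p" by (simp add: pJ flip: scaleR_2)
  finally have hp: "h = J ** p" .
  then show "h = J ** (e + f)" by (simp add: p_def)
  have "lie h p = lie h e + lie h f" by (simp add: lie_def p_def msimps)
  also have "\<dots> = 2 *\<^sub>R n" by (simp add: H n_def algebra_simps)
  finally have "2 *\<^sub>R n = lie h p" by (rule sym)
  also have "\<dots> = 2 *\<^sub>R (J ** (p ** p))"
    by (simp add: lie_def hp massoc pJ' matrix_minus_left) (simp add: scaleR_2)
  finally have n: "n = J ** (p ** p)" by (rule scaleR_left_imp_eq[rotated]) simp
  have "lie h n = lie h e - lie h f" by (simp add: lie_def n_def msimps)
  also have "\<dots> = 2 *\<^sub>R p" by (simp add: H p_def algebra_simps)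
  finally have "2 *\<^sub>R p = lie h n" by (rule sym)
  also have "\<dots> = 2 *\<^sub>R (p ** (p ** p))"
    by (simp add: lie_def hp n massoc pJ' msimps J_J_mult) (simp add: scaleR_2)
  finally have "p = p ** (p ** p)" by (rule scaleR_left_imp_eq[rotated]) simp
  then have ppp: "p ** (p ** p) = p" by (rule sym)
  show "tripotent (e + f)" using cp pJ ppp by (simp add: tripotent_def p_def)
  have "e = (1/2) *\<^sub>R (p + n)"
    by (simp add: p_def n_def flip: scaleR_2)
  also have "\<dots> = J ** proj p"
    by (simp add: proj_def n msimps J_J_mult algebra_simps)
  finally show "e = J ** proj (e + f)" by (simp add: p_def)
qed

lemma tripotent_simps:
  assumes "tripotent p"
  shows "ctr p = p" "p ** J = - (J ** p)" "p ** (J ** X) = - (J ** (p ** X))"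
    "p ** (p ** p) = p" "p ** (p ** (p ** X)) = p ** X"
  using assms by (simp_all add: tripotent_def matrix_mul_assoc matrix_minus_left)

lemma proj_projection:
  assumes "tripotent p"
  shows "ctr (proj p) = proj p" "proj p ** proj p = proj p" "proj p ** J ** proj p = 0"
proof -
  note p = tripotent_simps[OF assms]
  show "ctr (proj p) = proj p"
    by (simp add: proj_def ctr_scaleR ctr_diff ctr_mult ctr_J p matrix_minus_right)
  show "proj p ** proj p = proj p"
    by (simp add: proj_def msimps massoc p J_J_mult) (simp add: algebra_simps flip: scaleR_2)
  show "proj p ** J ** proj p = 0"
    by (simp add: proj_def msimps massoc p J_J_mult)
qed

text \<open>\<open>q\<close> commutes with \<open>p\<close> and with \<open>J ** p\<close> but
  anticommutes with \<open>J\<close>, which forces \<open>p ** q = 0\<close>.\<close>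

lemma proj_orthogonal:
  assumes p: "tripotent p" and q: "tripotent q" and pq: "p ** q = q ** p" "J ** p ** q = q ** (J ** p)"
  shows "proj p ** proj q = 0"
proof -
  note [simp] = tripotent_simps[OF p] tripotent_simps[OF q]
  have "J ** (p ** q) = - (J ** (p ** q))"
    using pq by (simp add: massoc)
  then have "2 *\<^sub>R (J ** (p ** q)) = 2 *\<^sub>R 0"
    by (metis add.right_inverse scaleR_2 scaleR_zero_right)
  then have "J ** (p ** q) = 0" by (rule scaleR_left_imp_eq[rotated]) simp
  then have 1: "p ** q = 0" using J_mult_inj[of "p ** q" 0] by simp
  then have 2: "p ** (q ** X) = 0" for X by (simp add: matrix_mul_assoc)
  show ?thesis by (simp add: proj_def msimps massoc 1 2)
qed

text \<open>Each projection has rank at least one and there are as many of them as the Witt index allows, so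
  each has rank exactly one.\<close>

lemma H1_frame:
  assumes tr: "\<And>j. j \<in> {1..r} \<Longrightarrow> H1_triple \<gg> z (e j) (f j) (h j)"
    and comm: "\<And>j k X Y. j \<in> {1..r} \<Longrightarrow> k \<in> {1..r} \<Longrightarrow> j \<noteq> k \<Longrightarrow> X \<in> {e j, f j, h j} \<Longrightarrow>
      Y \<in> {e k, f k, h k} \<Longrightarrow> lie X Y = 0"
    and h0: "\<And>j. j \<in> {1..r} \<Longrightarrow> h j \<noteq> 0"
  obtains P where "\<And>t. t \<le> r \<Longrightarrow> (\<Sum>j=1..t. e j) = J ** P t"
    "\<And>t. t \<le> r \<Longrightarrow> ctr (P t) = P t" "\<And>t. t \<le> r \<Longrightarrow> P t ** P t = P t"
    "\<And>t. t \<le> r \<Longrightarrow> P t ** J ** P t = 0" "\<And>t. t \<le> r \<Longrightarrow> rdim (P t) = DIM('k) * t"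
    "\<And>s t. s \<le> t \<Longrightarrow> t \<le> r \<Longrightarrow> P s ** P t = P s" "\<And>s t. s \<le> t \<Longrightarrow> t \<le> r \<Longrightarrow> P t ** P s = P s"
proof -
  define p where "p j = e j + f j" for j
  define M where "M j = proj (p j)" for j
  define P where "P t = (\<Sum>j=1..t. M j)" for t
  have tp: "tripotent (p j)" and eM: "e j = J ** M j" and hp: "h j = J ** p j" if "j \<in> {1..r}" for j
    using H1_triple_tripotent[OF tr[OF that]] by (simp_all add: p_def M_def)
  have M: "ctr (M j) = M j" "M j ** M j = M j" "M j ** J ** M j = 0" if "j \<in> {1..r}" for j
    using proj_projection[OF tp[OF that]] by (simp_all add: M_def)
  have MM: "M j ** M k = 0" if jk: "j \<in> {1..r}" "k \<in> {1..r}" "j \<noteq> k" for j k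
  proof -
    have "lie (e j) (e k) = 0" "lie (e j) (f k) = 0" "lie (f j) (e k) = 0" "lie (f j) (f k) = 0"
      "lie (h j) (e k) = 0" "lie (h j) (f k) = 0"
      by (rule comm[OF jk]; simp)+
    then have "lie (p j) (p k) = 0" "lie (h j) (p k) = 0"
      by (simp_all add: lie_def p_def msimps)
    then have "p j ** p k = p k ** p j" "J ** p j ** p k = p k ** (J ** p j)"
      using jk by (simp_all add: lie_def hp)
    then show ?thesis unfolding M_def by (intro proj_orthogonal tp jk) auto
  qed
  \<comment> \<open>Commuting \<open>e j\<close> and \<open>e k\<close> make
    \<open>M j ** J ** M k\<close> symmetric in \<open>j\<close> and \<open>k\<close>. Multiplying
    by the projection \<open>M j\<close> then brings in \<open>M j ** M k = 0\<close>.\<close>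
  have MJM: "M j ** J ** M k = 0" if jk: "j \<in> {1..r}" "k \<in> {1..r}" "j \<noteq> k" for j k
  proof -
    have "e j ** e k = e k ** e j"
      using comm[OF jk, of "e j" "e k"] by (simp add: lie_def)
    then have "J ** (M j ** J ** M k) = J ** (M k ** J ** M j)"
      using jk by (simp add: eM matrix_mul_assoc)
    then have eq: "M j ** J ** M k = M k ** J ** M j" by (simp only: J_mult_inj)
    have "M j ** J ** M k = M j ** (M j ** J ** M k)"
      using M(2)[OF jk(1)] by (simp add: matrix_mul_assoc)
    also have "\<dots> = (M j ** M k) ** J ** M j"
      by (subst eq) (simp add: matrix_mul_assoc)
    finally show ?thesis using MM[OF jk] by simp
  qed
  have M0: "M j \<noteq> 0" if j: "j \<in> {1..r}" for j
  proof
    assume "M j = 0"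
    then have "e j = 0" using eM[OF j] by simp
    moreover have "h j = lie (e j) (f j)" using tr[OF j] by (simp add: H1_triple_def)
    ultimately show False using h0[OF j] by (simp add: lie_def)
  qed
  have PM: "P t ** M k = (if k \<le> t then M k else 0)" "M k ** P t = (if k \<le> t then M k else 0)"
    if "t \<le> r" "k \<in> {1..r}" for t k
  proof -
    have jr: "j \<in> {1..r}" if "j \<in> {1..t}" for j using that \<open>t \<le> r\<close> by simp
    have "P t ** M k = (\<Sum>j=1..t. if j = k then M k else 0)"
      unfolding P_def matrix_sum_left using MM[OF jr \<open>k \<in> _\<close>] M(2)[OF \<open>k \<in> _\<close>] by (intro sum.cong) auto
    then show "P t ** M k = (if k \<le> t then M k else 0)" using that by (simp add: sum.delta)
    have "M k ** P t = (\<Sum>j=1..t. if j = k then M k else 0)"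
      unfolding P_def matrix_sum_right using MM[OF \<open>k \<in> _\<close> jr] M(2)[OF \<open>k \<in> _\<close>] by (intro sum.cong) auto
    then show "M k ** P t = (if k \<le> t then M k else 0)" using that by (simp add: sum.delta)
  qed
  have cP: "ctr (P t) = P t" if "t \<le> r" for t
    unfolding P_def ctr_sum using that M by (intro sum.cong) auto
  have PP: "P s ** P t = P s" "P t ** P s = P s" if "s \<le> t" "t \<le> r" for s t
  proof -
    have "P s ** P t = (\<Sum>j=1..s. M j ** P t)" by (simp add: P_def matrix_sum_left)
    also have "\<dots> = P s" unfolding P_def[of s] using that PM by (intro sum.cong) auto
    finally show "P s ** P t = P s" .
    have "P t ** P s = (\<Sum>j=1..s. P t ** M j)" by (simp add: P_def matrix_sum_right)
    also have "\<dots> = P s" unfolding P_def[of s] using that PM by (intro sum.cong) auto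
    finally show "P t ** P s = P s" .
  qed
  have PJP: "P t ** J ** P t = 0" if "t \<le> r" for t
  proof -
    have "P t ** J ** P t = (\<Sum>j=1..t. \<Sum>k=1..t. M j ** J ** M k)"
      unfolding P_def matrix_sum_left by (simp only: matrix_sum_right)
    also have "\<dots> = 0"
    proof (intro sum.neutral ballI)
      fix j k assume "j \<in> {1..t}" "k \<in> {1..t}"
      then show "M j ** J ** M k = 0" using that M(3) MJM by (cases "j = k") auto
    qed
    finally show ?thesis .
  qed
  have rank_Suc: "rdim (P t) + DIM('k) \<le> rdim (P (Suc t))" if t: "Suc t \<le> r" for t
  proof -
    have k: "Suc t \<in> {1..r}" using t by simp
    obtain w where w: "M (Suc t) *v w \<noteq> 0" using M0[OF k] by (auto simp: matrix_eq)
    define v where "v = M (Suc t) *v w"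
    have v0: "v \<noteq> 0" using w by (simp add: v_def)
    have Mv: "M (Suc t) *v v = v" by (simp add: v_def matrix_vector_mul_assoc M(2)[OF k])
    have Pv: "P (Suc t) *v v = v" using PM(1)[of "Suc t" "Suc t"] t by (simp add: v_def matrix_vector_mul_assoc)
    let ?W = "range ((*v) (P t))"
    have "v \<notin> ?W"
    proof
      assume "v \<in> ?W"
      then obtain u where "v = P t *v u" by auto
      then have "M (Suc t) *v v = (M (Suc t) ** P t) *v u" by (simp add: matrix_vector_mul_assoc)
      then show False using PM(2)[of t "Suc t"] t v0 Mv by simp
    qed
    then have "dim {u + v *r c | u c. u \<in> ?W} = dim ?W + DIM('k)"
      by (intro dim_add_line subspace_range_matrix) (auto simp flip: matrix_vector_scr)
    moreover have "dim {u + v *r c | u c. u \<in> ?W} \<le> rdim (P (Suc t))"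
      unfolding rdim_def
    proof (rule dim_subset, safe)
      fix x c
      have "P (Suc t) *v (P t *v x + v *r c) = P t *v x + v *r c"
        using PP(2)[of t "Suc t"] t by (simp add: matrix_vector_right_distrib matrix_vector_mul_assoc matrix_vector_scr Pv)
      then show "P t *v x + v *r c \<in> range ((*v) (P (Suc t)))" by (metis rangeI)
    qed
    ultimately show ?thesis by (simp add: rdim_def)
  qed
  have lower: "rdim (P t) \<ge> DIM('k) * t" if "t \<le> r" for t
    using that
  proof (induction t)
    case (Suc t)
    then show ?case using rank_Suc[of t] by simp
  qed simp
  \<comment> \<open>Counting down from \<open>r\<close>, where the isotropic bound applies: each
    step down loses at least \<open>DIM('k)\<close>, which meets the lower bound exactly.\<close>
  have upper: "rdim (P t) + DIM('k) * (r - t) \<le> DIM('k) * r" if "t \<le> r" for t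
    using that
  proof (induction rule: inc_induct)
    case base
    have "ctr (P r) ** J ** P r = 0" using PJP[of r] cP[of r] by simp
    then show ?case using isotropic_rank_le by simp
  next
    case (step t)
    have "r - t = Suc (r - Suc t)" using step.hyps by simp
    then show ?case using step.IH rank_Suc[of t] step.hyps by simp
  qed
  have rank: "rdim (P t) = DIM('k) * t" if "t \<le> r" for t
    using lower[OF that] upper[OF that] that
    by (simp add: diff_mult_distrib2)
  have eP: "(\<Sum>j=1..t. e j) = J ** P t" if "t \<le> r" for t
    unfolding P_def matrix_sum_right using that eM by (intro sum.cong) auto
  show ?thesis by (rule that[of P]) (use eP cP PP PJP rank in auto)
qed

end

subsection \<open>Orbits and their closures\<close>

context hermitian_type
begin

definition stratum :: "nat \<Rightarrow> ('k^'n^'n) set" where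
  "stratum m = {X \<in> cone. rdim X = m}"

lemma unitary_pair_stratum: "unitary_pair g h \<Longrightarrow> X \<in> stratum m \<Longrightarrow> g ** X ** h \<in> stratum m"
  using unitary_pair_cone by (simp add: stratum_def)

lemma orbit_eq_stratum:
  assumes "X \<in> stratum m"
  shows "{\<phi> X | \<phi>. \<phi> \<in> adjoint_group \<gg>} = stratum m"
proof safe
  fix \<phi> assume "\<phi> \<in> adjoint_group \<gg>"
  then obtain g h where "unitary_pair g h" "\<phi> = (\<lambda>X. g ** X ** h)" by (rule adjoint_group_unitary)
  then show "\<phi> X \<in> stratum m" using assms unitary_pair_stratum by simp
next
  fix Y assume "Y \<in> stratum m"
  then obtain \<phi> where "\<phi> \<in> adjoint_group \<gg>" "\<phi> X = Y"
    using cone_transitive[of X Y] assms by (auto simp: stratum_def)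
  then show "\<exists>\<phi>. Y = \<phi> X \<and> \<phi> \<in> adjoint_group \<gg>" by blast
qed

text \<open>Every generator is joined to the identity by the exponentials of the multiples
  \<open>t *\<^sub>R Y\<close>, so each point of the orbit is linked to \<open>X\<close> by finitely
  many curves.\<close>

lemma connected_orbit: "connected {\<phi> X | \<phi>. \<phi> \<in> adjoint_group \<gg>}"
proof -
  let ?O = "{\<phi> X | \<phi>. \<phi> \<in> adjoint_group \<gg>}"
  have "\<exists>C. connected C \<and> X \<in> C \<and> \<phi> X \<in> C \<and> C \<subseteq> ?O" if "\<phi> \<in> adjoint_group \<gg>" for \<phi>
    using that
  proof induction
    case 1
    have "X \<in> ?O" by (auto intro!: exI[of _ id] adjoint_group.intros)
    then show ?case by (intro exI[of _ "{X}"]) simp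
  next
    case (2 Y \<phi>)
    then obtain C where C: "connected C" "X \<in> C" "\<phi> X \<in> C" "C \<subseteq> ?O" by blast
    let ?p = "\<lambda>t::real. mexp (t *\<^sub>R Y) ** \<phi> X ** mexp (t *\<^sub>R (- Y))"
    have "connected (range ?p)"
      by (intro connected_continuous_image continuous_intros continuous_on_mexp) simp
    moreover have p0: "?p 0 = \<phi> X" by (simp add: mexp_square_zero)
    ultimately have "connected (C \<union> range ?p)"
      using C p0[symmetric] by (intro connected_Un) blast+
    moreover have "range ?p \<subseteq> ?O"
    proof safe
      fix t
      have "exp_ad (t *\<^sub>R Y) \<circ> \<phi> \<in> adjoint_group \<gg>"
        by (intro adjoint_group.intros 2 subspace_scale[OF subspace_\<gg>])
      moreover have "?p t = (exp_ad (t *\<^sub>R Y) \<circ> \<phi>) X" by (simp add: exp_ad_eq)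
      ultimately show "\<exists>\<psi>. ?p t = \<psi> X \<and> \<psi> \<in> adjoint_group \<gg>" by blast
    qed
    moreover have "(exp_ad Y \<circ> \<phi>) X = ?p 1" by (simp add: exp_ad_eq)
    then have "(exp_ad Y \<circ> \<phi>) X \<in> range ?p" by (rule range_eqI)
    ultimately show ?case using C by (intro exI[of _ "C \<union> range ?p"]) auto
  qed
  then have "\<forall>Y\<in>?O. \<exists>C. connected C \<and> X \<in> C \<and> Y \<in> C \<and> C \<subseteq> ?O" by blast
  then have *: "\<exists>C. connected C \<and> X \<in> C \<and> Y \<in> C \<and> C \<subseteq> ?O" if "Y \<in> ?O" for Y
    using that by blast
  show ?thesis
    unfolding connected_iff_connected_component
  proof (intro ballI)
    fix Y Z assume "Y \<in> ?O" "Z \<in> ?O"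
    then have "connected_component ?O X Y" "connected_component ?O X Z"
      using *[of Y] *[of Z] unfolding connected_component_def by blast+
    then show "connected_component ?O Y Z"
      by (meson connected_component_sym connected_component_trans)
  qed
qed

lemma closed_cone_rank_le: "closed {X \<in> cone. rdim X \<le> k}"
proof -
  have lin: "continuous_on UNIV (\<lambda>X. - (J ** X))"
    by (intro continuous_intros)
  have "closed ((\<lambda>X. - (J ** X)) -` {M. psd M})"
    by (rule closed_vimage[OF closed_psd lin])
  moreover have "closed {X :: 'k^'n^'n. X ** X = 0}"
    by (intro closed_Collect_eq continuous_intros)
  moreover have "{X \<in> cone. rdim X \<le> k} = ((\<lambda>X. - (J ** X)) -` {M. psd M}) \<inter> {X. X ** X = 0} \<inter> {X. rdim X \<le> k}"
    by (auto simp: cone_iff)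
  ultimately show ?thesis using closed_rdim_le by auto
qed

lemma semialgebraic_cone_rank_le: "semialgebraic {X \<in> cone. rdim X \<le> DIM('k) * s}"
proof -
  have "semialgebraic {X :: 'k^'n^'n. X ** X = 0}"
    by (intro semialgebraic_Collect_eq_0 polynomial_function_bilinear[OF bounded_bilinear_matrix]
        polynomial_function_id)
  moreover have "polynomial_function (\<lambda>X. - (J ** X))"
    by (intro polynomial_function_minus polynomial_function_bilinear[OF bounded_bilinear_matrix]
        polynomial_function_id polynomial_function_const)
  then have "semialgebraic {X. psd (- (J ** X)) \<and> rdim (- (J ** X)) \<le> DIM('k) * s}"
    by (rule semialgebraic_psd_rank_le)
  moreover have "{X \<in> cone. rdim X \<le> DIM('k) * s} =
      {X. psd (- (J ** X)) \<and> rdim (- (J ** X)) \<le> DIM('k) * s} \<inter> {X. X ** X = 0}"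
    by (auto simp: cone_iff rdim_minus rdim_J_mult)
  ultimately show ?thesis by (simp only:) (rule semialgebraic.intros)
qed

text \<open>An element of lower rank can be moved to \<open>J ** P t\<close> by transitivity. That
  is the limit, as x tends to 0 from above, of the elements with matrix \<open>P t\<close> plus x
  times \<open>P s - P t\<close>, all of full rank.\<close>

lemma closure_stratum:
  assumes P: "\<And>t. t \<le> s \<Longrightarrow> ctr (P t) = P t" "\<And>t. t \<le> s \<Longrightarrow> P t ** P t = P t"
    "\<And>t. t \<le> s \<Longrightarrow> P t ** J ** P t = 0" "\<And>t. t \<le> s \<Longrightarrow> rdim (P t) = DIM('k) * t"
    "\<And>t. t \<le> s \<Longrightarrow> P t ** P s = P t" "\<And>t. t \<le> s \<Longrightarrow> P s ** P t = P t"
  shows "closure (stratum (DIM('k) * s)) = {X \<in> cone. rdim X \<le> DIM('k) * s}"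
proof
  show "closure (stratum (DIM('k) * s)) \<subseteq> {X \<in> cone. rdim X \<le> DIM('k) * s}"
    by (rule closure_minimal[OF _ closed_cone_rank_le]) (auto simp: stratum_def)
next
  show "{X \<in> cone. rdim X \<le> DIM('k) * s} \<subseteq> closure (stratum (DIM('k) * s))"
  proof safe
    fix X assume X: "X \<in> cone" "rdim X \<le> DIM('k) * s"
    have "DIM('k) dvd rdim (- (J ** X))"
      using X by (intro DIM_dvd_rdim_psd) (simp add: cone_iff)
    then obtain t where t: "rdim X = DIM('k) * t" by (auto simp: rdim_minus rdim_J_mult)
    then have ts: "t \<le> s" using X(2) by simp
    define F where "F x = J ** (P t + x *\<^sub>R (P s - P t))" for x :: real
    have psdP: "psd (P t)" using psd_mult_ctr[of "P t"] P(1,2)[OF ts] by simp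
    have "(P s - P t) ** ctr (P s - P t) = P s - P t"
      using P[OF ts] P[of s] by (simp add: ctr_diff msimps)
    then have psdQ: "psd (P s - P t)" using psd_mult_ctr[of "P s - P t"] by simp
    have F: "F x \<in> stratum (DIM('k) * s)" if x: "x > 0" for x
    proof -
      define M where "M = P t + x *\<^sub>R (P s - P t)"
      have pM: "psd M" unfolding M_def using psdP psdQ x by (intro psd_add psd_scaleR) auto
      have PM: "P s ** M = M" "M ** P s = M"
        using P[OF ts] P[of s] by (simp_all add: M_def msimps)
      have "M ** J ** M = (M ** P s) ** J ** (P s ** M)" by (simp only: PM)
      also have "\<dots> = M ** (P s ** J ** P s) ** M" by (simp add: matrix_mul_assoc)
      also have "\<dots> = 0" using P(3)[of s] by simp
      finally have iM: "M ** J ** M = 0" .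
      have "rdim M = rdim (P s)"
      proof (rule antisym)
        show "rdim M \<le> rdim (P s)" by (metis PM(1) rdim_mult_le_left)
        \<comment> \<open>Inverts \<open>M\<close> on the range of \<open>P s\<close>, since
          \<open>P t\<close> and \<open>P s - P t\<close> are orthogonal projections with sum
          \<open>P s\<close>.\<close>
        have "M ** (P t + (1/x) *\<^sub>R (P s - P t)) = P s"
          using P[OF ts] P[of s] x by (simp add: M_def msimps algebra_simps)
        then show "rdim (P s) \<le> rdim M" by (metis rdim_mult_le_left)
      qed
      then have "J ** M \<in> cone" "rdim (J ** M) = DIM('k) * s"
        using P(4)[of s] pM iM by (auto simp: cone_def rdim_J_mult)
      then show ?thesis by (simp add: stratum_def F_def M_def)
    qed
    have F0: "F 0 \<in> closure (stratum (DIM('k) * s))"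
    proof -
      have "((\<lambda>x. F x) \<longlongrightarrow> F 0) (at_right 0)"
        unfolding F_def by (intro tendsto_intros bounded_bilinear.tendsto[OF bounded_bilinear_matrix])
      moreover have "\<forall>\<^sub>F x in at_right 0. F x \<in> closure (stratum (DIM('k) * s))"
        using F closure_subset by (auto simp: eventually_at_filter intro!: always_eventually)
      ultimately show ?thesis
        by (intro Lim_in_closed_set[of _ F "at_right (0::real)"]) auto
    qed
    have "P t ** J ** P t = 0" "rdim (P t) = DIM('k) * t" using P ts by auto
    then have "F 0 \<in> cone" "rdim (F 0) = rdim X"
      using psdP t by (auto simp: F_def cone_def rdim_J_mult)
    then obtain \<phi> where \<phi>: "\<phi> \<in> adjoint_group \<gg>" "\<phi> (F 0) = X" using cone_transitive X(1) by metis
    obtain g h where gh: "unitary_pair g h" "\<phi> = (\<lambda>X. g ** X ** h)" by (rule adjoint_group_unitary[OF \<phi>(1)])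
    have "continuous_on (closure (stratum (DIM('k) * s))) \<phi>"
      unfolding gh by (intro continuous_intros)
    then have "\<phi> ` closure (stratum (DIM('k) * s)) \<subseteq> closure (stratum (DIM('k) * s))"
      by (rule image_closure_subset) (use gh unitary_pair_stratum[OF gh(1)] closure_subset[of "stratum (DIM('k) * s)"] in auto)
    then show "X \<in> closure (stratum (DIM('k) * s))" using F0 \<phi>(2) by blast
  qed
qed

end

subsection \<open>Slice charts\<close>

context complex_structure
begin

text \<open>The chart is centred at a projection \<open>P\<close> onto an isotropic subspace \<open>W\<close>.
  With respect to the decomposition given by \<open>P\<close> and \<open>R = mat 1 - P\<close>, a matrix \<open>M\<close> of the rank of \<open>P\<close> is
  \<open>(P + T) ** a ** ctr (P + T)\<close> with \<open>a = P ** M ** P\<close> and \<open>T = R ** M ** a\<^sup>-\<^sup>1\<close>. Its range is the graph of \<open>T\<close>,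
  and isotropy determines the skew-hermitian part of \<open>P ** J ** T\<close> quadratically through the part \<open>Q ** T\<close> of \<open>T\<close>
  orthogonal to \<open>W\<close> and \<open>J W\<close>.\<close>

lemma isotropic_chart:
  fixes P :: "'k^'n^'n"
  assumes P: "ctr P = P" "P ** P = P" "P ** J ** P = 0"
  obtains S \<phi> \<psi> where "open S" "P \<in> S" "\<And>k. Ck_on k S \<phi>" "\<And>k. Ck_on k S \<psi>"
    "\<And>Y. Y \<in> S \<Longrightarrow> \<phi> Y \<in> S" "\<And>Y. Y \<in> S \<Longrightarrow> \<psi> Y \<in> S"
    "\<And>Y. Y \<in> S \<Longrightarrow> \<psi> (\<phi> Y) = Y" "\<And>Y. Y \<in> S \<Longrightarrow> \<phi> (\<psi> Y) = Y"
    "\<And>M. M \<in> S \<Longrightarrow> psd M \<and> M ** J ** M = 0 \<and> rdim M = rdim P \<longleftrightarrow>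
       \<phi> M \<in> {Z. ctr (P ** Z ** P) = P ** Z ** P \<and> ctr (P ** J ** Z ** P) = P ** J ** Z ** P \<and>
         P ** Z ** (mat 1 - P) = 0 \<and> (mat 1 - P) ** Z ** (mat 1 - P) = 0}"
proof -
  define R where "R = mat 1 - P"
  have PR: "P + R = mat 1" by (simp add: R_def)
  have cR: "ctr R = R" by (simp add: R_def ctr_diff P)
  have b1: "P ** R = 0" "R ** P = 0" "R ** R = R" by (simp_all add: R_def msimps P)
  have PJP: "P ** (J ** P) = 0" using P(3) by (simp add: matrix_mul_assoc)
  have b2: "P ** (P ** X) = P ** X" "P ** (R ** X) = 0" "R ** (P ** X) = 0" "R ** (R ** X) = R ** X"
    "P ** (J ** (P ** X)) = 0" for X :: "'k^'n^'n"
    using b1 P by (simp_all add: matrix_mul_assoc)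
  have RJP: "R ** (J ** P) = J ** P" by (simp add: R_def msimps PJP)
  have RJP': "R ** (J ** (P ** X)) = J ** (P ** X)" for X :: "'k^'n^'n"
    by (simp only: matrix_mul_assoc) (simp only: RJP[unfolded matrix_mul_assoc])
  \<comment> \<open>Since \<open>J\<close> has inverse \<open>- J\<close>, this is the identity
    minus the projections onto \<open>W\<close> and \<open>J W\<close>.\<close>
  define Q where "Q = R + J ** P ** J"
  have cQ: "ctr Q = Q"
    by (simp add: Q_def ctr_add cR ctr_mult ctr_J P msimps massoc)
  have PJ_split: "R = Q - J ** P ** J" by (simp add: Q_def)
  have QJP: "Q ** (J ** P) = 0"
    by (simp add: Q_def msimps massoc RJP J_J_mult PJP) (simp add: matrix_mul_assoc J_J msimps P flip: massoc)
  have QJP': "Q ** (J ** (P ** X)) = 0" for X :: "'k^'n^'n"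
    by (simp only: matrix_mul_assoc) (simp add: QJP[unfolded matrix_mul_assoc])
  obtain K where K: "\<And>(B :: 'k^'n^'n) v. norm (B *v v) \<le> norm B * norm v * K" "K > 0"
    using bounded_bilinear.pos_bounded[OF bounded_bilinear_matrix_vector] by blast
  \<comment> \<open>Here the block \<open>P ** Y ** P\<close> is close enough to \<open>P\<close> to
    be invertible on \<open>W\<close>, and positive there when hermitian. The chart and its inverse
    keep this block, so both map \<open>S\<close> to itself.\<close>
  define S where "S = {Y :: 'k^'n^'n. norm (P ** Y ** P - P) * K < 1}"
  have oS: "open S"
    unfolding S_def by (intro open_Collect_less continuous_intros)
  have PS: "P \<in> S" by (simp add: S_def P)
  have near: "norm ((P ** Y ** P - P) *v v) < norm v" if "Y \<in> S" "v \<noteq> 0" for Y v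
  proof -
    have "norm ((P ** Y ** P - P) *v v) \<le> (norm (P ** Y ** P - P) * K) * norm v"
      using K(1)[of "P ** Y ** P - P" v] by (simp add: mult_ac)
    also have "\<dots> < 1 * norm v"
      using that by (intro mult_strict_right_mono) (auto simp: S_def)
    finally show ?thesis by simp
  qed
  have split: "(P ** Y ** P + R) *v v = v + (P ** Y ** P - P) *v v" for Y v
    by (simp add: R_def matrix_vector_mult_diff_rdistrib matrix_vector_mult_add_rdistrib)
  \<comment> \<open>Adding \<open>R\<close> extends the block from \<open>W\<close> to the whole
    space, so an ordinary matrix inverse provides the inverse on \<open>W\<close>.\<close>
  have "\<exists>B. (P ** Y ** P + R) ** B = mat 1" if Y: "Y \<in> S" for Y
  proof (rule exists_right_inverse)
    fix v assume "(P ** Y ** P + R) *v v = 0"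
    then have "v = - ((P ** Y ** P - P) *v v)" by (simp add: split eq_neg_iff_add_eq_0)
    then have "norm v = norm ((P ** Y ** P - P) *v v)" by (metis norm_minus_cancel)
    then show "v = 0" using near[OF Y, of v] by auto
  qed
  then obtain \<iota> where \<iota>: "\<And>Y. Y \<in> S \<Longrightarrow> (P ** Y ** P + R) ** \<iota> Y = mat 1" by metis
  have \<iota>': "\<iota> Y ** (P ** Y ** P + R) = mat 1" if "Y \<in> S" for Y
    by (rule left_inverse_imp_right_inverse[OF \<iota>[OF that]])
  have \<iota>P: "\<iota> Y ** P = P ** \<iota> Y" if Y: "Y \<in> S" for Y
  proof -
    have "\<iota> Y ** P = \<iota> Y ** (P ** ((P ** Y ** P + R) ** \<iota> Y))" by (simp add: \<iota>[OF Y])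
    also have "\<dots> = (\<iota> Y ** (P ** Y ** P + R)) ** (P ** \<iota> Y)"
      by (simp add: msimps massoc b1 b2 P)
    finally show ?thesis by (simp add: \<iota>'[OF Y])
  qed
  have a\<iota>: "P ** (Y ** (P ** \<iota> Y)) = P" "\<iota> Y ** (P ** (Y ** P)) = P" if Y: "Y \<in> S" for Y
  proof -
    have "P ** ((P ** Y ** P + R) ** \<iota> Y) = P ** (Y ** (P ** \<iota> Y))"
      by (simp add: msimps massoc b1 b2 P)
    then show "P ** (Y ** (P ** \<iota> Y)) = P" by (simp add: \<iota>[OF Y])
    have "(\<iota> Y ** (P ** Y ** P + R)) ** P = \<iota> Y ** (P ** (Y ** P))"
      by (simp add: msimps massoc b1 b2 P)
    then show "\<iota> Y ** (P ** (Y ** P)) = P" by (simp add: \<iota>'[OF Y])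
  qed
  define T where "T Y = R ** Y ** P ** \<iota> Y" for Y
  \<comment> \<open>For \<open>X ** P = X\<close>, \<open>P ** J ** c X\<close> is minus half of
    \<open>ctr (Q ** X) ** J ** (Q ** X)\<close>. Subtracting \<open>c\<close> thus turns the
    quadratic isotropy condition on a graph into hermitian symmetry, which is real-linear.\<close>
  define c where "c X = (1/2) *\<^sub>R (J ** (ctr (Q ** X) ** (J ** (Q ** X))))" for X
  \<comment> \<open>The last two summands measure the deviation of the remaining blocks from what
    hermitian symmetry and the rank prescribe, so these conditions become the vanishing of
    blocks.\<close>
  define \<phi> where "\<phi> Y = P ** Y ** P + (T Y - c (T Y)) + (P ** Y ** R - ctr (R ** Y ** P)) +
      (R ** Y ** R - T Y ** ctr (R ** Y ** P))" for Y
  define T' where "T' Z = R ** Z ** P + c (R ** Z ** P)" for Z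
  define b' where "b' Z = T' Z ** (P ** Z ** P)" for Z
  define \<psi> where "\<psi> Z = P ** Z ** P + b' Z + (P ** Z ** R + ctr (b' Z)) + (R ** Z ** R + T' Z ** ctr (b' Z))" for Z
  have blocks: "Y = P ** Y ** P + R ** Y ** P + P ** Y ** R + R ** Y ** R" for Y :: "'k^'n^'n"
    by (simp add: R_def msimps massoc)
  have T: "P ** T Y = 0" "R ** T Y = T Y" "T Y ** P = T Y" "T Y ** R = 0" if Y: "Y \<in> S" for Y
  proof -
    show "P ** T Y = 0" "R ** T Y = T Y" by (simp_all add: T_def massoc b1 b2)
    have "T Y ** P = R ** Y ** P ** (\<iota> Y ** P)" by (simp add: T_def massoc)
    also have "\<dots> = T Y" by (simp only: \<iota>P[OF Y]) (simp add: T_def massoc b2)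
    finally show TP: "T Y ** P = T Y" .
    show "T Y ** R = 0" by (simp add: R_def msimps TP)
  qed
  have cblock: "P ** c X = 0" "R ** c X = c X" "c X ** P = c X" "c X ** R = 0" "Q ** c X = 0"
    if X: "X ** P = X" for X
  proof -
    have "P ** ctr X = ctr X" using arg_cong[OF X, of ctr] by (simp add: ctr_mult P)
    then have "ctr (Q ** X) = P ** (ctr X ** Q)"
      by (simp add: ctr_mult cQ matrix_mul_assoc)
    then have c: "c X = (1/2) *\<^sub>R (J ** (P ** (ctr X ** (Q ** (J ** (Q ** X))))))"
      by (simp add: c_def massoc)
    show "P ** c X = 0" "R ** c X = c X" "Q ** c X = 0"
      by (simp_all add: c msimps b2 RJP' QJP')
    show cP: "c X ** P = c X" by (simp add: c_def msimps massoc X)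
    show "c X ** R = 0" by (simp add: R_def msimps cP)
  qed
  have \<phi>PP: "P ** \<phi> Y ** P = P ** Y ** P" and \<phi>RP: "R ** \<phi> Y ** P = T Y - c (T Y)"
    and \<phi>PR: "P ** \<phi> Y ** R = P ** Y ** R - ctr (R ** Y ** P)"
    and \<phi>RR: "R ** \<phi> Y ** R = R ** Y ** R - T Y ** ctr (R ** Y ** P)" if Y: "Y \<in> S" for Y
  proof -
    note t = T[OF Y] cblock[OF T(3)[OF Y]]
    have t': "P ** (T Y ** X) = 0" "R ** (T Y ** X) = T Y ** X" for X :: "'k^'n^'n"
      by (simp_all add: matrix_mul_assoc t)
    show "P ** \<phi> Y ** P = P ** Y ** P" "R ** \<phi> Y ** P = T Y - c (T Y)"
      "P ** \<phi> Y ** R = P ** Y ** R - ctr (R ** Y ** P)"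
      "R ** \<phi> Y ** R = R ** Y ** R - T Y ** ctr (R ** Y ** P)"
      by (simp_all add: \<phi>_def msimps ctr_mult cR P massoc b1 b2 t t')
  qed
  have T': "P ** T' Z = 0" "R ** T' Z = T' Z" "T' Z ** P = T' Z" "T' Z ** R = 0" for Z
  proof -
    have "R ** Z ** P ** P = R ** Z ** P" by (simp add: massoc P)
    note t = cblock[OF this]
    show "P ** T' Z = 0" "R ** T' Z = T' Z" "T' Z ** P = T' Z" "T' Z ** R = 0"
      by (simp_all add: T'_def msimps t) (simp_all add: massoc b1 b2 P)
  qed
  have ctrT': "ctr (T' Z) = P ** ctr (T' Z)" for Z
    using arg_cong[OF T'(3)[of Z], of ctr] by (simp add: ctr_mult P)
  have ctrT'R: "ctr (T' Z) ** R = ctr (T' Z)" "ctr (T' Z) ** P = 0" for Z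
    using arg_cong[OF T'(2)[of Z], of ctr] arg_cong[OF T'(1)[of Z], of ctr] by (simp_all add: ctr_mult cR P)
  have \<psi>PP: "P ** \<psi> Z ** P = P ** Z ** P" and \<psi>RP: "R ** \<psi> Z ** P = b' Z"
    and \<psi>PR: "P ** \<psi> Z ** R = P ** Z ** R + ctr (b' Z)"
    and \<psi>RR: "R ** \<psi> Z ** R = R ** Z ** R + T' Z ** ctr (b' Z)" for Z
  proof -
    note t = T'[of Z] ctrT'R[of Z]
    have t': "P ** (T' Z ** X) = 0" "R ** (T' Z ** X) = T' Z ** X" for X :: "'k^'n^'n"
      by (simp_all add: matrix_mul_assoc t)
    show "P ** \<psi> Z ** P = P ** Z ** P" "R ** \<psi> Z ** P = b' Z"
      "P ** \<psi> Z ** R = P ** Z ** R + ctr (b' Z)"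
      "R ** \<psi> Z ** R = R ** Z ** R + T' Z ** ctr (b' Z)"
      by (simp_all add: \<psi>_def b'_def msimps ctr_mult P massoc b1 b2 t t')
  qed
  have \<phi>S: "\<phi> Y \<in> S" if "Y \<in> S" for Y using that \<phi>PP[OF that] by (simp add: S_def)
  have \<psi>S: "\<psi> Y \<in> S" if "Y \<in> S" for Y using that \<psi>PP[of Y] by (simp add: S_def)
  \<comment> \<open>\<open>c\<close> has values in \<open>J W\<close>, which \<open>Q\<close> kills,
    and depends only on \<open>Q ** X\<close>. So subtracting \<open>c\<close> and adding
    \<open>c\<close> are inverse to each other.\<close>
  have cc: "c (X - c X) = c X" "c (X + c X) = c X" if X: "X ** P = X" for X
    by (simp_all add: c_def[of "X - c X"] c_def[of "X + c X"] matrix_diff_ldistrib matrix_add_ldistrib cblock[OF X])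
       (simp_all add: c_def)
  have \<psi>\<phi>: "\<psi> (\<phi> Y) = Y" if Y: "Y \<in> S" for Y
  proof -
    have T'\<phi>: "T' (\<phi> Y) = T Y"
      by (simp add: T'_def \<phi>RP[OF Y] cc[OF T(3)[OF Y]])
    have b\<phi>: "b' (\<phi> Y) = R ** Y ** P"
    proof -
      have "b' (\<phi> Y) = T Y ** (P ** Y ** P)" by (simp only: b'_def T'\<phi> \<phi>PP[OF Y])
      also have "\<dots> = R ** Y ** P" by (simp add: T_def massoc a\<iota>[OF Y] P)
      finally show ?thesis .
    qed
    have "\<psi> (\<phi> Y) = P ** Y ** P + R ** Y ** P + P ** Y ** R + R ** Y ** R"
      by (simp add: \<psi>_def b\<phi> T'\<phi> \<phi>PP[OF Y] \<phi>PR[OF Y] \<phi>RR[OF Y])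
    then show ?thesis using blocks[of Y] by simp
  qed
  have \<phi>\<psi>: "\<phi> (\<psi> Z) = Z" if Z: "Z \<in> S" for Z
  proof -
    have Y: "\<psi> Z \<in> S" by (rule \<psi>S[OF Z])
    have "T (\<psi> Z) = b' Z ** \<iota> (\<psi> Z)" by (simp add: T_def \<psi>RP)
    also have "\<dots> = T' Z ** (P ** \<psi> Z ** P ** \<iota> (\<psi> Z))"
      unfolding b'_def \<psi>PP by (simp add: massoc)
    also have "\<dots> = T' Z" using a\<iota>(1)[OF Y] by (simp add: massoc T')
    finally have T\<psi>: "T (\<psi> Z) = T' Z" .
    have "T' Z - c (T' Z) = R ** Z ** P"
      using cc(2)[of "R ** Z ** P"] by (simp add: T'_def massoc P)
    then have "\<phi> (\<psi> Z) = P ** Z ** P + R ** Z ** P + P ** Z ** R + R ** Z ** R"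
      by (simp add: \<phi>_def T\<psi> \<psi>PP \<psi>RP \<psi>PR \<psi>RR)
    then show ?thesis using blocks[of Z] by simp
  qed
  have lin: "Ck_on k S (\<lambda>Y. A ** Y ** B)" for k and A B :: "'k^'n^'n"
  proof (rule Ck_on_linear[OF oS])
    have "linear (\<lambda>Y. A ** Y ** B)" by (simp add: linear_iff msimps)
    then show "bounded_linear (\<lambda>Y. A ** Y ** B)" by (simp add: linear_linear)
  qed
  have diff: "Ck_on k S (\<lambda>Y. f Y - g Y)" if "Ck_on k S f" "Ck_on k S g" for k and f g :: "'k^'n^'n \<Rightarrow> 'k^'n^'n"
  proof -
    have "Ck_on k S (\<lambda>Y. f Y + - g Y)"
      by (intro Ck_on_add[OF oS] that Ck_on_compose_linear[OF oS bounded_linear_minus[OF bounded_linear_ident]])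
    then show ?thesis by simp
  qed
  note mult = Ck_on_bilinear[OF oS bounded_bilinear_matrix]
  note ctr' = Ck_on_compose_linear[OF oS bounded_linear_ctr]
  have Ckc: "Ck_on k S (\<lambda>Y. c (f Y))" if "Ck_on k S f" for k f
    unfolding c_def
    by (intro Ck_on_compose_linear[OF oS bounded_linear_scaleR_right] mult ctr' that Ck_on_const[OF oS])
  have "Ck_on k S \<iota>" for k
  proof (rule Ck_on_matrix_inverse[OF oS])
    show "Ck_on k S (\<lambda>Y. P ** Y ** P + R)"
      by (intro Ck_on_add[OF oS] lin Ck_on_const[OF oS])
  qed (rule \<iota>)
  then have CkT: "Ck_on k S T" for k
    unfolding T_def by (intro mult lin)
  have Ck\<phi>: "Ck_on k S \<phi>" for k
    unfolding \<phi>_def by (intro Ck_on_add[OF oS] diff mult lin CkT Ckc ctr')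
  have CkT': "Ck_on k S T'" for k
    unfolding T'_def by (intro Ck_on_add[OF oS] lin Ckc)
  have Ckb': "Ck_on k S b'" for k
    unfolding b'_def by (intro mult lin CkT')
  have Ck\<psi>: "Ck_on k S \<psi>" for k
    unfolding \<psi>_def by (intro Ck_on_add[OF oS] lin mult CkT' Ckb' ctr')
  have slice: "psd M \<and> M ** J ** M = 0 \<and> rdim M = rdim P \<longleftrightarrow>
      ctr (P ** \<phi> M ** P) = P ** \<phi> M ** P \<and> ctr (P ** J ** \<phi> M ** P) = P ** J ** \<phi> M ** P \<and>
      P ** \<phi> M ** R = 0 \<and> R ** \<phi> M ** R = 0" if M: "M \<in> S" for M
  proof -
    define a t where "a = P ** M ** P" and "t = T M"
    note tb = T[OF M, folded t_def]
    have ct: "P ** ctr t = ctr t" "ctr t ** P = 0"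
      using arg_cong[OF tb(3), of ctr] arg_cong[OF tb(1), of ctr] by (simp_all add: ctr_mult P)
    have RMP: "R ** M ** P = t ** a"
    proof -
      have "t ** a = R ** M ** (P ** (\<iota> M ** (P ** (M ** P))))"
        by (simp add: t_def a_def T_def massoc b2)
      then show ?thesis by (simp add: a\<iota>[OF M] P massoc)
    qed
    have c1: "ctr (P ** \<phi> M ** P) = P ** \<phi> M ** P \<longleftrightarrow> ctr a = a"
      by (simp add: \<phi>PP[OF M] a_def)
    have c3: "P ** \<phi> M ** R = 0 \<longleftrightarrow> P ** M ** R = ctr (t ** a)"
      by (simp add: \<phi>PR[OF M] RMP)
    have c4: "R ** \<phi> M ** R = 0 \<longleftrightarrow> R ** M ** R = t ** ctr (t ** a)"
      by (simp add: \<phi>RR[OF M] RMP t_def)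
    have Qt: "R ** t = Q ** t - J ** P ** J ** t"
      by (simp add: PJ_split matrix_diff_rdistrib)
    have iso: "ctr (P + t) ** J ** (P + t) = P ** J ** t - ctr (P ** J ** t) + ctr (Q ** t) ** J ** (Q ** t)"
    proof -
      have "ctr t ** J ** t = ctr (R ** t) ** J ** (R ** t)" by (simp add: tb)
      also have "\<dots> = ctr (Q ** t) ** J ** (Q ** t)"
      proof -
        have "P ** Q = 0"
          by (simp add: Q_def msimps b1 matrix_mul_assoc P)
        then have PQ: "P ** (Q ** X) = 0" for X :: "'k^'n^'n" by (simp add: matrix_mul_assoc)
        have QP: "Q ** (P ** X) = 0" for X :: "'k^'n^'n"
        proof -
          have "Q ** P = ctr (P ** Q)" by (simp add: ctr_mult cQ P)
          then show ?thesis by (simp add: matrix_mul_assoc \<open>P ** Q = 0\<close>)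
        qed
        show ?thesis
          unfolding Qt
          by (simp add: ctr_diff ctr_mult cQ P ctr_J msimps massoc J_J_mult PQ QP QJP' b2)
      qed
      finally have tJt: "ctr t ** (J ** t) = ctr (Q ** t) ** J ** (Q ** t)" by (simp add: massoc)
      show ?thesis
        by (simp add: ctr_add msimps massoc PJP P ctr_mult ctr_J tJt)
    qed
    have c2: "ctr (P ** J ** \<phi> M ** P) = P ** J ** \<phi> M ** P \<longleftrightarrow> ctr (P + t) ** J ** (P + t) = 0"
    proof -
      have "P ** J ** \<phi> M ** P = P ** J ** (P ** \<phi> M ** P) + P ** J ** (R ** \<phi> M ** P)"
        by (simp add: R_def msimps massoc)
      also have "\<dots> = P ** J ** (t - c t)" unfolding \<phi>RP[OF M] t_def by (simp add: massoc b2)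
      also have "\<dots> = P ** J ** t + (1/2) *\<^sub>R (ctr (Q ** t) ** J ** (Q ** t))"
      proof -
        have "P ** (ctr (Q ** t) ** X) = ctr (Q ** t) ** X" for X :: "'k^'n^'n"
          by (simp add: ctr_mult cQ matrix_mul_assoc ct)
        then show ?thesis by (simp add: c_def msimps massoc J_J_mult)
      qed
      finally have eq: "P ** J ** \<phi> M ** P = P ** J ** t + (1/2) *\<^sub>R (ctr (Q ** t) ** J ** (Q ** t))" .
      define w where "w = ctr (Q ** t) ** J ** (Q ** t)"
      have cw: "ctr w = - w"
        by (simp add: w_def ctr_mult ctr_J msimps massoc)
      have "ctr (P ** J ** \<phi> M ** P) = P ** J ** \<phi> M ** P \<longleftrightarrow>
          ctr (P ** J ** t) - (1/2) *\<^sub>R w = P ** J ** t + (1/2) *\<^sub>R w"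
        by (simp only: eq w_def[symmetric] ctr_add ctr_scaleR cw scaleR_minus_right add_uminus_conv_diff)
      also have "\<dots> \<longleftrightarrow> P ** J ** t - ctr (P ** J ** t) + ((1/2) *\<^sub>R w + (1/2) *\<^sub>R w) = 0"
        by (auto simp: algebra_simps)
      also have "(1/2) *\<^sub>R w + (1/2) *\<^sub>R w = w" by (simp flip: scaleR_left_distrib)
      finally show ?thesis by (simp only: iso w_def)
    qed
    have form: "M = (P + t) ** a ** ctr (P + t)" if "ctr a = a" "P ** M ** R = ctr (t ** a)" "R ** M ** R = t ** ctr (t ** a)"
    proof -
      have aP: "P ** a = a" "a ** P = a" by (simp_all add: a_def massoc b2 P)
      have "M = a + t ** a + ctr (t ** a) + t ** ctr (t ** a)"
        using blocks[of M] that RMP by (simp add: a_def)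
      also have "\<dots> = (P + t) ** a ** ctr (P + t)"
        using that(1) by (simp add: ctr_add ctr_mult msimps P aP massoc)
      finally show ?thesis .
    qed
    have rank_a: "rdim P \<le> rdim a"
    proof -
      have "P = a ** \<iota> M" using a\<iota>(1)[OF M] by (simp add: a_def massoc)
      then show ?thesis by (metis rdim_mult_le_left)
    qed
    show ?thesis
      unfolding c1 c2 c3 c4
    proof (intro iffI conjI; elim conjE)
      assume M1: "psd M" "M ** J ** M = 0" "rdim M = rdim P"
      have cM: "ctr M = M" by (rule psd_ctr[OF M1(1)])
      show ca: "ctr a = a" by (simp add: a_def ctr_mult cM P massoc)
      have "ctr (R ** M ** P) = P ** M ** R" by (simp add: ctr_mult cM cR P massoc)
      then show PMR: "P ** M ** R = ctr (t ** a)" by (simp add: RMP)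
      have "rdim a \<le> rdim (M ** P)"
        using rdim_mult_le_right[of P "M ** P"] by (simp add: a_def massoc)
      then have "dim (range ((*v) M)) \<le> dim (range ((*v) (M ** P)))"
        using rank_a M1(3) by (simp add: rdim_def)
      moreover have "range ((*v) (M ** P)) \<subseteq> range ((*v) M)"
        by (auto simp flip: matrix_vector_mul_assoc)
      ultimately have "range ((*v) (M ** P)) = range ((*v) M)"
        by (intro subspace_dim_equal subspace_range_matrix)
      \<comment> \<open>Equal ranks let \<open>M\<close> factor through its block on
        \<open>W\<close>. This is the vanishing of the Schur complement and determines the block
        \<open>R ** M ** R\<close>.\<close>
      have "M *v v = (M ** P ** \<iota> M ** P ** M) *v v" for v
      proof -
        have "M *v v \<in> range ((*v) (M ** P))"
          using \<open>range ((*v) (M ** P)) = range ((*v) M)\<close> by blast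
        then obtain w where w: "M *v v = (M ** P) *v w" by blast
        have "(M ** P ** \<iota> M ** P ** M) *v v = (M ** P ** \<iota> M ** P) *v (M *v v)"
          by (simp add: matrix_vector_mul_assoc)
        also have "\<dots> = (M ** P ** (\<iota> M ** (P ** (M ** P)))) *v w"
          by (simp add: w matrix_vector_mul_assoc matrix_mul_assoc)
        also have "\<dots> = M *v v" by (simp add: a\<iota>[OF M] w massoc P)
        finally show ?thesis by simp
      qed
      then have fac: "M = M ** P ** \<iota> M ** P ** M" by (simp add: matrix_eq)
      have "R ** M ** R = R ** (M ** P ** \<iota> M ** P ** M) ** R" by (simp only: fac[symmetric])
      also have "\<dots> = t ** (P ** M ** R)" by (simp add: t_def T_def massoc)
      finally show RMR: "R ** M ** R = t ** ctr (t ** a)" by (simp only: PMR)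
      have Mf: "M = (P + t) ** a ** ctr (P + t)" by (rule form[OF ca PMR RMR])
      define w where "w = ctr (P + t) ** J ** (P + t)"
      have tw: "(P + t) ** P = P + t" "P ** (P + t) = P" "ctr (P + t) ** P = P" "P ** ctr (P + t) = ctr (P + t)"
        by (simp_all add: msimps tb P ctr_add ct)
      have aP: "P ** a = a" "a ** P = a" by (simp_all add: a_def massoc b2 P)
      \<comment> \<open>This block is \<open>a ** w ** a\<close> with \<open>w\<close> the Gram
        matrix of the frame \<open>P + t\<close>. As \<open>a\<close> is invertible on
        \<open>W\<close>, isotropy passes from \<open>M\<close> to the frame.\<close>
      have "P ** (M ** J ** M) ** P = (P ** (P + t)) ** a ** w ** a ** (ctr (P + t) ** P)"
        by (subst (1 2) Mf) (simp add: w_def massoc)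
      also have "\<dots> = a ** w ** a" by (simp add: tw aP massoc)
      finally have "a ** w ** a = 0" by (simp add: M1)
      then have "\<iota> M ** (a ** w ** a) ** \<iota> M = 0" by simp
      moreover have "\<iota> M ** (a ** w ** a) ** \<iota> M = (\<iota> M ** a) ** w ** (a ** \<iota> M)"
        by (simp add: massoc)
      moreover have "\<iota> M ** a = P" "a ** \<iota> M = P" using a\<iota>[OF M] by (simp_all add: a_def massoc)
      ultimately have "P ** w ** P = 0" by simp
      moreover have "P ** w ** P = w"
      proof -
        have "P ** w ** P = (P ** ctr (P + t)) ** J ** ((P + t) ** P)" by (simp add: w_def massoc)
        then show ?thesis by (simp only: tw w_def)
      qed
      ultimately show "ctr (P + t) ** J ** (P + t) = 0" by (simp add: w_def)
    next
      assume H: "ctr a = a" "ctr (P + t) ** J ** (P + t) = 0" "P ** M ** R = ctr (t ** a)" "R ** M ** R = t ** ctr (t ** a)"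
      have Mf: "M = (P + t) ** a ** ctr (P + t)" by (rule form[OF H(1,3,4)])
      have "psd a"
        unfolding psd_def
      proof (intro conjI allI H)
        fix v
        define u where "u = P *v v"
        have Pu: "P *v u = u" by (simp add: u_def matrix_vector_mul_assoc P)
        \<comment> \<open>Positivity is checked on \<open>W\<close>, where \<open>a\<close> differs
          from the identity by less than the length of the vector, so Cauchy-Schwarz
          applies.\<close>
        have "inner v (a *v v) = inner u ((P ** M ** P + R) *v u)"
        proof -
          have "R *v u = 0" by (simp add: u_def matrix_vector_mul_assoc b1)
          moreover have "inner u ((P ** M ** P) *v u) = inner v (P *v ((P ** M ** P) *v (P *v v)))"
            unfolding u_def using inner_matrix_vector_ctr[of P v] by (simp add: P)
          ultimately show ?thesis
            by (simp add: matrix_vector_mult_add_rdistrib a_def matrix_vector_mul_assoc massoc b2 P)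
        qed
        also have "\<dots> = inner u u + inner u ((P ** M ** P - P) *v u)"
          by (simp add: split inner_add_right)
        also have "\<dots> \<ge> 0"
        proof (cases "u = 0")
          case False
          have "\<bar>inner u ((P ** M ** P - P) *v u)\<bar> \<le> norm u * norm ((P ** M ** P - P) *v u)"
            by (rule Cauchy_Schwarz_ineq2)
          also have "\<dots> \<le> norm u * norm u"
            using near[OF M False] by (intro mult_left_mono) auto
          finally show ?thesis by (simp add: power2_norm_eq_inner[symmetric] power2_eq_square)
        qed simp
        finally show "0 \<le> inner v (a *v v)" .
      qed
      then have "psd ((P + t) ** a ** ctr (P + t))" by (rule psd_congruence)
      then show "psd M" using Mf by simp
      have "M ** J ** M = (P + t) ** a ** (ctr (P + t) ** J ** (P + t)) ** a ** ctr (P + t)"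
        by (subst (1 2) Mf) (simp add: massoc)
      then show "M ** J ** M = 0" by (simp add: H)
      show "rdim M = rdim P"
      proof (rule antisym)
        have "rdim M \<le> rdim (P + t)"
          by (subst Mf) (metis matrix_mul_assoc rdim_mult_le_left)
        also have "P + t = (P + t) ** P" by (simp add: msimps tb P)
        then have "rdim (P + t) \<le> rdim P" by (metis rdim_mult_le_right)
        finally show "rdim M \<le> rdim P" .
        have "rdim a \<le> rdim M"
          unfolding a_def by (metis rdim_mult_le_left rdim_mult_le_right order_trans)
        with rank_a show "rdim P \<le> rdim M" by simp
      qed
    qed
  qed
  show ?thesis
    by (rule that[of S \<phi> \<psi>]) (use oS PS Ck\<phi> Ck\<psi> \<phi>S \<psi>S \<psi>\<phi> \<phi>\<psi> slice in \<open>auto simp: R_def\<close>)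
qed

end

context hermitian_type
begin

text \<open>Transitivity provides, for each point, a linear isomorphism that carries the chart at
  \<open>P\<close> to it and preserves the stratum.\<close>

lemma smooth_submanifold_stratum:
  assumes P: "ctr P = P" "P ** P = P" "P ** J ** P = 0"
  shows "smooth_submanifold (stratum (rdim P))"
proof -
  define L where "L = {Z. ctr (P ** Z ** P) = P ** Z ** P \<and> ctr (P ** J ** Z ** P) = P ** J ** Z ** P \<and>
         P ** Z ** (mat 1 - P) = 0 \<and> (mat 1 - P) ** Z ** (mat 1 - P) = 0}"
  have "subspace {Z. A ** Z ** B = 0}" "subspace {Z. ctr (A ** Z ** B) = A ** Z ** B}" for A B :: "'k^'n^'n"
    by (simp_all add: subspace_def msimps ctr_add ctr_scaleR)
  then have L: "subspace L"
    unfolding L_def by (simp only: Collect_conj_eq) (intro subspace_inter)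
  obtain S \<phi> \<psi> where S: "open S" "P \<in> S" "\<And>k. Ck_on k S \<phi>" "\<And>k. Ck_on k S \<psi>"
    "\<And>Y. Y \<in> S \<Longrightarrow> \<phi> Y \<in> S" "\<And>Y. Y \<in> S \<Longrightarrow> \<psi> Y \<in> S"
    "\<And>Y. Y \<in> S \<Longrightarrow> \<psi> (\<phi> Y) = Y" "\<And>Y. Y \<in> S \<Longrightarrow> \<phi> (\<psi> Y) = Y"
    and slice: "\<And>M. M \<in> S \<Longrightarrow> psd M \<and> M ** J ** M = 0 \<and> rdim M = rdim P \<longleftrightarrow> \<phi> M \<in> L"
    using isotropic_chart[OF P] unfolding L_def by blast
  have JP: "J ** P \<in> cone" "rdim (J ** P) = rdim P"
    using psd_mult_ctr[of P] P by (auto simp: cone_def rdim_J_mult)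
  have "\<exists>U V \<Phi> \<Psi> (L' :: ('k^'n^'n) set). open U \<and> x \<in> U \<and> open V \<and> homeomorphism U V \<Phi> \<Psi> \<and>
      smooth_on U \<Phi> \<and> smooth_on V \<Psi> \<and> subspace L' \<and> dim L' = dim L \<and>
      \<Phi> ` (U \<inter> stratum (rdim P)) = V \<inter> L'" if x: "x \<in> stratum (rdim P)" for x
  proof -
    obtain \<theta> where \<theta>: "\<theta> \<in> adjoint_group \<gg>" "\<theta> (J ** P) = x"
      using cone_transitive[of "J ** P" x] JP x by (auto simp: stratum_def)
    obtain g h where gh: "unitary_pair g h" "\<theta> = (\<lambda>X. g ** X ** h)" by (rule adjoint_group_unitary[OF \<theta>(1)])
    have gh1: "g ** h = mat 1" "h ** g = mat 1" using gh(1) by (auto simp: unitary_pair_def)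
    define F where "F M = g ** (J ** M) ** h" for M
    define G where "G X = - (J ** (h ** X ** g))" for X
    have hgX: "h ** (g ** X) = X" "g ** (h ** X) = X" for X :: "'k^'n^'n"
      by (simp_all add: matrix_mul_assoc gh1)
    have GF: "G (F M) = M" for M
      by (simp add: F_def G_def massoc hgX gh1 J_J_mult)
    have FG: "F (G X) = X" for X
      by (simp add: F_def G_def massoc hgX gh1 J_J_mult msimps)
    have "linear F" "linear G"
      by (simp_all add: linear_iff F_def G_def msimps)
    then have bF: "bounded_linear F" and bG: "bounded_linear G"
      by (simp_all add: linear_linear)
    have F_stratum: "F M \<in> stratum (rdim P) \<longleftrightarrow> psd M \<and> M ** J ** M = 0 \<and> rdim M = rdim P" for M
    proof
      assume "F M \<in> stratum (rdim P)"
      then have "h ** F M ** g \<in> stratum (rdim P)"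
        by (rule unitary_pair_stratum[OF unitary_pair_sym[OF gh(1)]])
      moreover have "h ** F M ** g = J ** M" by (simp add: F_def massoc hgX gh1)
      ultimately have JM: "J ** M \<in> cone" "rdim (J ** M) = rdim P" by (auto simp: stratum_def)
      then obtain M' where "J ** M = J ** M'" "psd M'" "M' ** J ** M' = 0" by (auto simp: cone_def)
      then show "psd M \<and> M ** J ** M = 0 \<and> rdim M = rdim P" using JM by (simp add: J_mult_inj rdim_J_mult)
    next
      assume "psd M \<and> M ** J ** M = 0 \<and> rdim M = rdim P"
      then have "J ** M \<in> stratum (rdim P)" by (auto simp: stratum_def cone_def rdim_J_mult)
      then show "F M \<in> stratum (rdim P)" unfolding F_def by (rule unitary_pair_stratum[OF gh(1)])
    qed
    let ?U = "G -` S"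
    have oU: "open ?U"
      using bG by (intro open_vimage S linear_continuous_on)
    have xU: "x \<in> ?U"
      using S(2) GF[of P] \<theta>(2) by (simp add: F_def gh(2))
    have Ck1: "Ck_on k ?U (\<lambda>X. \<phi> (G X))" for k
      by (rule Ck_on_linear_compose[OF S(1) bG S(3)])
    have Ck2: "Ck_on k S (\<lambda>Z. F (\<psi> Z))" for k
      by (rule Ck_on_compose_linear[OF S(1) bF S(4)])
    have hom: "homeomorphism ?U S (\<lambda>X. \<phi> (G X)) (\<lambda>Z. F (\<psi> Z))"
    proof (rule homeomorphismI)
      show "continuous_on ?U (\<lambda>X. \<phi> (G X))" using Ck1[of 0] by simp
      show "continuous_on S (\<lambda>Z. F (\<psi> Z))" using Ck2[of 0] by simp
    qed (use S FG GF in auto)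
    have img: "(\<lambda>X. \<phi> (G X)) ` (?U \<inter> stratum (rdim P)) = S \<inter> L"
    proof safe
      fix X assume X: "G X \<in> S" "X \<in> stratum (rdim P)"
      show "\<phi> (G X) \<in> S" using S X by blast
      have "F (G X) \<in> stratum (rdim P)" using X by (simp add: FG)
      then show "\<phi> (G X) \<in> L" using slice[OF X(1)] F_stratum by simp
    next
      fix Z assume Z: "Z \<in> S" "Z \<in> L"
      have "\<phi> (\<psi> Z) \<in> L" using Z S by simp
      then have "F (\<psi> Z) \<in> stratum (rdim P)" using slice[of "\<psi> Z"] S(6)[OF Z(1)] F_stratum by simp
      moreover have "Z = \<phi> (G (F (\<psi> Z)))" using S Z by (simp add: GF)
      moreover have "F (\<psi> Z) \<in> ?U" using S Z by (simp add: GF)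
      ultimately show "Z \<in> (\<lambda>X. \<phi> (G X)) ` (?U \<inter> stratum (rdim P))" by blast
    qed
    have sm: "smooth_on ?U (\<lambda>X. \<phi> (G X))" "smooth_on S (\<lambda>Z. F (\<psi> Z))"
      using Ck1 Ck2 by (simp_all add: smooth_on_def)
    show ?thesis
      by (rule exI[of _ ?U], rule exI[of _ S], rule exI[of _ "\<lambda>X. \<phi> (G X)"],
          rule exI[of _ "\<lambda>Z. F (\<psi> Z)"], rule exI[of _ L])
         (intro conjI refl oU xU S(1) L hom img sm)
  qed
  then show ?thesis unfolding smooth_submanifold_def by blast
qed

end

subsection \<open>Holomorphic nilpotent orbits\<close>

context hermitian_type_rank
begin

lemma holo_orbit_characterisation:
  assumes sys: "H1_system \<gg> z r \<aa> e f h" and s: "1 \<le> s" "s \<le> r"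
  shows "holo_orbit \<gg> e s = {X \<in> \<gg>. lie_nilpotent \<gg> X \<and> non_negative J X \<and> rdim X = DIM('k) * s} \<and>
    connected (holo_orbit \<gg> e s) \<and> smooth_submanifold (holo_orbit \<gg> e s) \<and>
    closure (holo_orbit \<gg> e s) =
      {X \<in> \<gg>. lie_nilpotent \<gg> X \<and> non_negative J X \<and> rdim X \<le> DIM('k) * s} \<and>
    semialgebraic (closure (holo_orbit \<gg> e s))"
proof -
  have tr: "H1_triple \<gg> z (e j) (f j) (h j)" if "j \<in> {1..r}" for j
    using sys that unfolding H1_system_def by blast
  have comm: "lie X Y = 0" if "j \<in> {1..r}" "k \<in> {1..r}" "j \<noteq> k" "X \<in> {e j, f j, h j}" "Y \<in> {e k, f k, h k}" for j k X Y
    using sys that unfolding H1_system_def by blast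
  have h0: "h j \<noteq> 0" if "j \<in> {1..r}" for j
  proof -
    have "independent (h ` {1..r})" using sys unfolding H1_system_def by blast
    then have "0 \<notin> h ` {1..r}" using dependent_zero by blast
    then show ?thesis using that by (metis imageI)
  qed
  obtain P where P: "\<And>t. t \<le> r \<Longrightarrow> (\<Sum>j=1..t. e j) = J ** P t"
    "\<And>t. t \<le> r \<Longrightarrow> ctr (P t) = P t" "\<And>t. t \<le> r \<Longrightarrow> P t ** P t = P t"
    "\<And>t. t \<le> r \<Longrightarrow> P t ** J ** P t = 0" "\<And>t. t \<le> r \<Longrightarrow> rdim (P t) = DIM('k) * t"
    "\<And>s t. s \<le> t \<Longrightarrow> t \<le> r \<Longrightarrow> P s ** P t = P s" "\<And>s t. s \<le> t \<Longrightarrow> t \<le> r \<Longrightarrow> P t ** P s = P s"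
    by (rule H1_frame[of e f h, OF tr comm h0]) auto
  have "psd (P s)" using psd_mult_ctr[of "P s"] P(2,3)[OF s(2)] by simp
  then have base: "(\<Sum>j=1..s. e j) \<in> stratum (DIM('k) * s)"
    using P(1,4,5)[OF s(2)] by (auto simp: stratum_def cone_def rdim_J_mult)
  have orbit: "holo_orbit \<gg> e s = stratum (DIM('k) * s)"
    unfolding holo_orbit_def by (rule orbit_eq_stratum[OF base])
  \<comment> \<open>The base point yields the nonzero isotropic vector that the characterisation of
    ad-nilpotency requires.\<close>
  have "P s \<noteq> 0" using P(5)[OF s(2)] s by auto
  then obtain v where v: "P s *v v \<noteq> 0" by (auto simp: matrix_eq)
  have iso: "hf (P s *v v) (J *v (P s *v v)) = 0"
    using P(2,4)[OF s(2)] by (simp add: hf_matrix_left matrix_vector_mul_assoc)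
       (simp add: matrix_mul_assoc)
  have cone: "X \<in> \<gg> \<and> lie_nilpotent \<gg> X \<and> non_negative J X \<longleftrightarrow> X \<in> cone" for X
    by (rule nilpotent_non_negative_iff[OF v iso])
  have "closure (stratum (DIM('k) * s)) = {X \<in> cone. rdim X \<le> DIM('k) * s}"
    by (rule closure_stratum[of s P]) (use P s in auto)
  moreover have "connected (holo_orbit \<gg> e s)"
    unfolding holo_orbit_def by (rule connected_orbit)
  moreover have "smooth_submanifold (stratum (DIM('k) * s))"
    using smooth_submanifold_stratum[of "P s"] P(2-5)[OF s(2)] by simp
  moreover have "{X \<in> \<gg>. lie_nilpotent \<gg> X \<and> non_negative J X \<and> rdim X \<le> DIM('k) * s} =
      {X \<in> cone. rdim X \<le> DIM('k) * s}"
    "{X \<in> \<gg>. lie_nilpotent \<gg> X \<and> non_negative J X \<and> rdim X = DIM('k) * s} = stratum (DIM('k) * s)"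
    using cone by (auto simp: stratum_def)
  ultimately show ?thesis using semialgebraic_cone_rank_le[of s] by (simp add: orbit)
qed

end

section \<open>The full unitary algebra of the form and the bound by half the dimension\<close>

context complex_structure
begin

lemma subspace_u_alg: "subspace (u_alg J)"
  by (simp add: subspace_def u_alg_iff msimps ctr_add ctr_scaleR)

lemma J_hermitian_in_u_alg: "ctr N = N \<Longrightarrow> J ** N \<in> u_alg J"
  by (simp add: u_alg_iff J_J_mult ctr_minus)

text \<open>The range of \<open>A\<close> is orthogonal to its image under \<open>J\<close>, which
  has the same dimension.\<close>

lemma isotropic_rdim_le: "ctr A ** J ** A = 0 \<Longrightarrow> 2 * rdim A \<le> CARD('n) * DIM('k)"
  for A :: "'k^'n^'n"
proof -
  assume A: "ctr A ** J ** A = 0"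
  have "range ((*v) (J ** A)) \<subseteq> ker (ctr A)"
    using A by (auto simp: matrix_vector_mul_assoc matrix_mul_assoc)
  then have "rdim (J ** A) \<le> dim (ker (ctr A))"
    unfolding rdim_def by (rule dim_subset)
  then show ?thesis using dim_ker_ctr[of A] by (simp add: rdim_J_mult)
qed

lemma hermitian_type_u_alg: "hermitian_type J (u_alg J)"
proof
  show "subspace (u_alg J)" by (rule subspace_u_alg)
  show "J ** (D ** H ** ctr D) \<in> u_alg J" if "ctr H = H" for D H :: "'k^'n^'n"
    by (rule J_hermitian_in_u_alg) (simp add: ctr_mult that matrix_mul_assoc)
  show "J ** (outer u v + outer v u) \<in> u_alg J" for u v
    by (rule J_hermitian_in_u_alg) (simp add: ctr_add ctr_outer)
qed simp

end

section \<open>The three families\<close>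

lemma sum_UNIV_Plus: "(\<Sum>i\<in>(UNIV :: ('a::finite + 'b::finite) set). f i) = (\<Sum>a\<in>UNIV. f (Inl a)) + (\<Sum>b\<in>UNIV. f (Inr b))"
  by (subst UNIV_Plus_UNIV[symmetric], subst sum.Plus) auto

subsection \<open>Symplectic matrices\<close>

lemma J_sp_vector: "(J_sp *v v) $ Inl a = - v $ Inr a" "(J_sp *v v) $ Inr a = v $ Inl a"
  by (simp_all add: J_sp_def matrix_vector_mult_def sum_UNIV_Plus if_distrib if_distribR cong: if_cong)

lemma complex_structure_J_sp: "complex_structure (J_sp :: real ^ ('l::finite + 'l) ^ ('l + 'l))"
proof
  show "ctr (J_sp :: real ^ ('l + 'l) ^ ('l + 'l)) = - J_sp"
    by (auto simp: vec_eq_iff ctr_def J_sp_def cj_real_def split: sum.splits)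
  have "(J_sp *v (J_sp *v x)) $ i = - x $ i" for x :: "real ^ ('l + 'l)" and i
    by (cases i) (simp_all add: J_sp_vector)
  then show "J_sp ** J_sp = (- mat 1 :: real ^ ('l + 'l) ^ ('l + 'l))"
    by (simp add: matrix_eq vec_eq_iff matrix_vector_minus flip: matrix_vector_mul_assoc)
qed

lemma hermitian_type_rank_sp:
  "hermitian_type_rank (J_sp :: real ^ ('l::finite + 'l) ^ ('l + 'l)) sp_alg z_sp CARD('l)"
proof -
  interpret complex_structure "J_sp :: real ^ ('l + 'l) ^ ('l + 'l)" by (rule complex_structure_J_sp)
  interpret hermitian_type "J_sp :: real ^ ('l + 'l) ^ ('l + 'l)" sp_alg
    unfolding sp_alg_def by (rule hermitian_type_u_alg)
  show ?thesis
  proof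
    show "lie z_sp X = (1/2) *\<^sub>R (J_sp ** X - X ** J_sp)" for X :: "real ^ ('l + 'l) ^ ('l + 'l)"
      by (simp add: lie_def z_sp_def msimps scaleR_diff_right)
    show "rdim A \<le> DIM(real) * CARD('l)" if "ctr A ** J_sp ** A = 0" for A :: "real ^ ('l + 'l) ^ ('l + 'l)"
      using isotropic_rdim_le[OF that] by simp
  qed
qed

lemma rdim_iff_rank:
  fixes X :: "real^'n^'m"
  shows "rdim X = DIM(real) * s \<longleftrightarrow> rank X = s" "rdim X \<le> DIM(real) * s \<longleftrightarrow> rank X \<le> s"
  by (simp_all add: rdim_def rank_dim_range)

subsection \<open>Indefinite unitary matrices\<close>

lemma J_su_vector: "(J_su *v v) $ Inl a = \<i> * v $ Inl a" "(J_su *v v) $ Inr b = - \<i> * v $ Inr b"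
  by (simp_all add: J_su_def matrix_vector_mult_def sum_UNIV_Plus if_distrib if_distribR cong: if_cong)

lemma complex_structure_J_su: "complex_structure (J_su :: complex ^ ('p::finite + 'q::finite) ^ ('p + 'q))"
proof
  show "ctr (J_su :: complex ^ ('p + 'q) ^ ('p + 'q)) = - J_su"
    by (auto simp: vec_eq_iff ctr_def J_su_def cj_complex_def split: sum.splits)
  have "(J_su *v (J_su *v x)) $ i = - x $ i" for x :: "complex ^ ('p + 'q)" and i
    by (cases i) (simp_all add: J_su_vector flip: mult.assoc)
  then show "J_su ** J_su = (- mat 1 :: complex ^ ('p + 'q) ^ ('p + 'q))"
    by (simp add: matrix_eq vec_eq_iff matrix_vector_minus flip: matrix_vector_mul_assoc)
qed

lemma trace_outer: "trace (outer u v) = hf v (u :: complex^'n)"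
  by (simp add: trace_def outer_def herm_form_def mult.commute)

lemma hermitian_type_rank_su:
  "hermitian_type_rank (J_su :: complex ^ ('p::finite + 'q::finite) ^ ('p + 'q)) su_alg z_su CARD('q)"
proof -
  let ?J = "J_su :: complex ^ ('p + 'q) ^ ('p + 'q)"
  interpret complex_structure ?J by (rule complex_structure_J_su)
  have trJ: "trace (r *\<^sub>R X) = r *\<^sub>R trace X" for r and X :: "complex ^ ('p + 'q) ^ ('p + 'q)"
    by (simp add: trace_def scaleR_sum_right)
  interpret hermitian_type ?J su_alg
  proof
    show "subspace (su_alg :: (complex ^ ('p + 'q) ^ ('p + 'q)) set)"
    proof -
      have "linear (trace :: complex ^ ('p + 'q) ^ ('p + 'q) \<Rightarrow> complex)"
        by (simp add: linear_iff trace_add trJ)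
      then have "subspace {X :: complex ^ ('p + 'q) ^ ('p + 'q). trace X = 0}"
        by (rule linear_subspace_kernel)
      then have "subspace (u_alg ?J \<inter> {X. trace X = 0})"
        by (rule subspace_inter[OF subspace_u_alg])
      moreover have "u_alg ?J \<inter> {X. trace X = 0} = su_alg" by (auto simp: su_alg_def)
      ultimately show ?thesis by simp
    qed
    show "su_alg \<subseteq> u_alg ?J" by (auto simp: su_alg_def)
    \<comment> \<open>Over the complex numbers the trace is cyclic, which brings
      \<open>ctr D ** J ** D\<close> together.\<close>
    show "?J ** (D ** H ** ctr D) \<in> su_alg" if "ctr D ** ?J ** D = 0" "ctr H = H" for D H :: "complex ^ ('p + 'q) ^ ('p + 'q)"
    proof -
      have "trace (?J ** (D ** H ** ctr D)) = trace ((?J ** D ** H) ** ctr D)"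
        by (simp add: matrix_mul_assoc)
      also have "\<dots> = trace (ctr D ** (?J ** D ** H))" by (rule trace_mul_sym)
      also have "ctr D ** (?J ** D ** H) = (ctr D ** ?J ** D) ** H"
        by (simp add: matrix_mul_assoc)
      finally have "trace (?J ** (D ** H ** ctr D)) = 0" by (simp add: that trace_def)
      moreover have "?J ** (D ** H ** ctr D) \<in> u_alg ?J"
        by (rule J_hermitian_in_u_alg) (simp add: ctr_mult that matrix_mul_assoc)
      ultimately show ?thesis by (simp add: su_alg_def)
    qed
    \<comment> \<open>The two traces are \<open>hf v (J u)\<close> and \<open>hf u (J v)\<close>.
      Skewness makes the first minus the conjugate of the second, so they cancel when the second is
      real.\<close>
    show "?J ** (outer u v + outer v u) \<in> su_alg" if uv: "cj (hf u (?J *v v)) = hf u (?J *v v)" for u v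
    proof -
      have "hf v (?J *v u) = - hf u (?J *v v)"
        using cj_hf[of "?J *v u" v] uv by (simp add: hf_J_left cj_minus)
      then have "trace (?J ** (outer u v + outer v u)) = 0"
        by (simp add: msimps matrix_mult_outer trace_add trace_outer)
      moreover have "?J ** (outer u v + outer v u) \<in> u_alg ?J"
        by (rule J_hermitian_in_u_alg) (simp add: ctr_add ctr_outer)
      ultimately show ?thesis by (simp add: su_alg_def)
    qed
  qed
  show ?thesis
  proof
    fix X :: "complex ^ ('p + 'q) ^ ('p + 'q)"
    \<comment> \<open>The scalar that distinguishes \<open>z_su\<close> from half of
      \<open>J_su\<close> is central.\<close>
    have "mat c ** X = X ** mat c" for c
      by (simp add: matrix_matrix_mult_def mat_def vec_eq_iff if_distrib if_distribR mult.commute cong: if_cong)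
    then show "lie z_su X = (1/2) *\<^sub>R (?J ** X - X ** ?J)"
      by (simp add: lie_def z_su_def msimps scaleR_diff_right)
  next
    fix A :: "complex ^ ('p + 'q) ^ ('p + 'q)"
    assume A: "ctr A ** ?J ** A = 0"
    let ?W = "range ((*v) A)"
    \<comment> \<open>The projection to the negative definite part. On its kernel
      \<open>hf u (J u)\<close> is \<open>i\<close> times \<open>hf u u\<close>, so it is injective
      on isotropic subspaces.\<close>
    define \<pi> where "\<pi> v = (\<chi> b. v $ Inr b)" for v :: "complex ^ ('p + 'q)"
    have lin: "linear \<pi>" by (simp add: \<pi>_def linear_iff vec_eq_iff)
    have "u = 0" if u: "u \<in> ?W" "\<pi> u = 0" for u
    proof -
      have b: "u $ Inr b = 0" for b using u(2) by (simp add: \<pi>_def vec_eq_iff)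
      have "hf u (?J *v u) = 0" using u(1) isotropic_frame_vector[OF A] by auto
      moreover have "hf u (?J *v u) = \<i> * hf u u"
        by (simp add: herm_form_def sum_UNIV_Plus J_su_vector b sum_distrib_left mult_ac)
      ultimately show ?thesis by simp
    qed
    then have "inj_on \<pi> ?W"
      by (subst linear_inj_on_iff_eq_0[OF lin subspace_range_matrix]) auto
    then have "inj_on \<pi> (span ?W)"
      using subspace_range_matrix[of A] by (simp only: span_eq_iff[symmetric])
    then have "dim ?W = dim (\<pi> ` ?W)" by (rule dim_image_eq[OF lin, symmetric])
    also have "\<dots> \<le> DIM(complex ^ 'q)" by (rule dim_subset_UNIV)
    finally show "rdim A \<le> DIM(complex) * CARD('q)" by (simp add: rdim_def)
  qed
qed

section \<open>Complex rank as half of a real dimension\<close>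

lemma subspace_vec_subspace: "vec.subspace W \<Longrightarrow> subspace (W :: (complex^'n) set)"
proof -
  assume W: "vec.subspace W"
  have "r *\<^sub>R x \<in> W" if "x \<in> W" for r x
  proof -
    have "complex_of_real r *s x \<in> W" using vec.subspace_scale[OF W that] .
    also have "complex_of_real r *s x = r *\<^sub>R x" by (simp add: vec_eq_iff scaleR_conv_of_real[where 'a = complex])
    finally show ?thesis .
  qed
  then show ?thesis
    using vec.subspace_0[OF W] vec.subspace_add[OF W] by (auto simp: subspace_def)
qed

lemma dim_complex_span:
  assumes "finite B" "vec.independent B"
  shows "dim (vec.span (B :: (complex^'n) set)) = 2 * card B"
  using assms
proof (induction B)
  case (insert b B)
  have scr: "v *r c = c *s v" for v :: "complex^'n" and c
    by (simp add: scr_def vec_eq_iff mult.commute)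
  have b: "b \<notin> vec.span B" "vec.independent B"
    using insert.prems insert.hyps by (simp_all add: vec.independent_insert)
  have "vec.span (insert b B) = {w + b *r c | w c. w \<in> vec.span B}"
  proof -
    have "x \<in> vec.span (insert b B) \<longleftrightarrow> (\<exists>w c. x = w + b *r c \<and> w \<in> vec.span B)" for x
      unfolding vec.span_insert scr
      by (auto intro: exI[of _ "x - _ *s b"] simp: algebra_simps) (metis add_diff_cancel_left' add.commute)
    then show ?thesis by blast
  qed
  also have "dim \<dots> = dim (vec.span B) + DIM(complex)"
    using b(1) by (intro dim_add_line subspace_vec_subspace vec.subspace_span) (auto simp: scr vec.span_scale)
  finally show ?case using insert b(2) by simp
qed simp

text \<open>\<open>rank\<close> refers to the row space, which is the range of the transpose.
  Entrywise conjugation carries it to the range of \<open>ctr X\<close>, and \<open>rdim_ctr\<close>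
  leads back to \<open>X\<close>.\<close>

lemma rdim_eq_complex_rank: "rdim X = 2 * rank X" for X :: "complex^'n^'m"
proof -
  have "range ((*v) (transpose X)) = vec.span (rows X)"
  proof
    show "range ((*v) (transpose X)) \<subseteq> vec.span (rows X)"
      using matrix_vector_mult_in_columnspace_gen[of "transpose X"] by (auto simp: columns_transpose simp del: transpose_matrix_vector)
    have "vec.subspace (range ((*v) (transpose X)))"
      by (rule vec.linear_subspace_image[OF matrix_vector_mul_linear_gen vec.subspace_UNIV])
    moreover have "rows X \<subseteq> range ((*v) (transpose X))"
    proof
      fix y assume "y \<in> rows X"
      then obtain i where "y = row i X" by (auto simp: rows_def)
      then have "y = transpose X *v axis i 1"
        by (simp add: row_def vec_eq_iff matrix_vector_mult_def transpose_def axis_def if_distrib del: transpose_matrix_vector cong: if_cong)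
      then show "y \<in> range ((*v) (transpose X))" by blast
    qed
    ultimately show "vec.span (rows X) \<subseteq> range ((*v) (transpose X))" by (rule vec.span_minimal[rotated])
  qed
  then have "rdim (transpose X) = dim (vec.span (rows X))" by (simp add: rdim_def)
  also obtain B where B: "B \<subseteq> rows X" "vec.independent B" "rows X \<subseteq> vec.span B" "card B = vec.dim (rows X)"
    using vec.basis_exists by blast
  then have "vec.span (rows X) = vec.span B"
    by (metis vec.span_eq vec.span_superset subset_trans)
  also have "dim (vec.span B) = 2 * card B"
    using B(2) vec.finiteI_independent by (intro dim_complex_span) auto
  finally have "rdim (transpose X) = 2 * rank X" by (simp add: B row_rank_def_gen)
  moreover have "rdim (transpose X) = rdim (ctr X)"
  proof -
    define \<gamma> where "\<gamma> v = (\<chi> i. cnj (v $ i))" for v :: "complex^'n"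
    have "linear \<gamma>" by (simp add: \<gamma>_def linear_iff vec_eq_iff)
    moreover have "inj \<gamma>" by (rule injI) (simp add: \<gamma>_def vec_eq_iff)
    moreover have "range ((*v) (ctr X)) = \<gamma> ` range ((*v) (transpose X))"
    proof -
      have 1: "ctr X *v (\<chi> i. cnj (v $ i)) = \<gamma> (transpose X *v v)" for v
        by (simp add: \<gamma>_def vec_eq_iff matrix_vector_mult_def ctr_def transpose_def cj_complex_def del: transpose_matrix_vector)
      have 2: "ctr X *v v = \<gamma> (transpose X *v (\<chi> i. cnj (v $ i)))" for v
        using 1[of "\<chi> i. cnj (v $ i)"] by simp
      show ?thesis
      proof (intro antisym subsetI)
        fix y assume "y \<in> range ((*v) (ctr X))"
        then obtain v where "y = ctr X *v v" by blast
        then show "y \<in> \<gamma> ` range ((*v) (transpose X))"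
          by (simp only: 2 imageI rangeI)
      next
        fix y assume "y \<in> \<gamma> ` range ((*v) (transpose X))"
        then obtain v where "y = \<gamma> (transpose X *v v)" by blast
        then show "y \<in> range ((*v) (ctr X))" by (simp only: 1[symmetric] rangeI)
      qed
    qed
    ultimately show ?thesis
      unfolding rdim_def by (metis dim_image_eq inj_on_subset subset_UNIV)
  qed
  ultimately show ?thesis by (simp add: rdim_ctr)
qed

lemma rdim_iff_complex_rank:
  fixes X :: "complex^'n^'m"
  shows "rdim X = DIM(complex) * s \<longleftrightarrow> rank X = s" "rdim X \<le> DIM(complex) * s \<longleftrightarrow> rank X \<le> s"
  by (simp_all add: rdim_eq_complex_rank)

subsection \<open>Quaternionic matrices\<close>

lemma DIM_quat: "DIM(quat) = 4"
  by (simp add: Basis_quat_def)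

lemma mat_mult_mat: "mat a ** mat b = (mat (a * b) :: 'a::semiring_1^'n^'n)"
proof -
  have "mat c *v v = (\<chi> i. c * v $ i)" for c and v :: "'a^'n"
    by (simp add: matrix_vector_mult_def mat_def vec_eq_iff if_distrib if_distribR cong: if_cong)
  then show ?thesis
    by (simp add: matrix_eq mult.assoc flip: matrix_vector_mul_assoc)
qed

lemma complex_structure_J_so:
  assumes c: "qre c = 0" "norm c = 1"
  shows "complex_structure (J_so c :: quat ^ 'n ^ 'n)"
proof
  have cc: "cj c = - c" using c(1) by (simp add: cj_quat_def uminus_quat_def quat_eq_iff)
  have "cj c * c = 1" by (simp add: cj_mult_self c)
  then have "c * c = - 1" by (simp add: cc) (metis minus_minus)
  then show "J_so c ** J_so c = (- mat 1 :: quat ^ 'n ^ 'n)"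
    by (simp add: J_so_def mat_mult_mat) (simp add: mat_def vec_eq_iff)
  show "ctr (J_so c :: quat ^ 'n ^ 'n) = - J_so c"
    by (simp add: J_so_def ctr_mat cc) (simp add: mat_def vec_eq_iff)
qed

lemma hermitian_type_rank_so:
  assumes c: "qre c = 0" "norm c = 1"
  shows "hermitian_type_rank (J_so c :: quat ^ 'n ^ 'n) (so_star_alg c) (z_so c) (CARD('n) div 2)"
proof -
  interpret complex_structure "J_so c :: quat ^ 'n ^ 'n" by (rule complex_structure_J_so[OF c])
  interpret hermitian_type "J_so c :: quat ^ 'n ^ 'n" "so_star_alg c"
    unfolding so_star_alg_def by (rule hermitian_type_u_alg)
  show ?thesis
  proof
    show "lie (z_so c) X = (1/2) *\<^sub>R (J_so c ** X - X ** J_so c)" for X :: "quat ^ 'n ^ 'n"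
      by (simp add: lie_def z_so_def msimps scaleR_diff_right)
    show "rdim A \<le> DIM(quat) * (CARD('n) div 2)" if A: "ctr A ** J_so c ** A = 0" for A :: "quat ^ 'n ^ 'n"
    proof -
      \<comment> \<open>Real ranks are multiples of 4, so the bound by half the dimension rounds
        down to \<open>CARD('n) div 2\<close>.\<close>
      have "DIM(quat) dvd rdim (A ** ctr A)" by (rule DIM_dvd_rdim_psd[OF psd_mult_ctr])
      then obtain k where k: "rdim A = 4 * k" by (auto simp: rdim_mult_ctr DIM_quat)
      then have "2 * k \<le> CARD('n)" using isotropic_rdim_le[OF A] by (simp add: DIM_quat)
      then show ?thesis using k by (simp add: DIM_quat)
    qed
  qed
qed

section \<open>Right-linear algebra over the quaternions\<close>

lemma rscale_eq_scr: "rscale v c = v *r c"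
  by (simp add: rscale_def scr_def)

lemma right_span_finite:
  assumes "finite B"
  shows "right_span B = {(\<Sum>v\<in>B. v *r c v) | c. True}"
proof safe
  fix x assume "x \<in> right_span B"
  then obtain A c where A: "A \<subseteq> B" "x = (\<Sum>v\<in>A. v *r c v)" by (auto simp: right_span_def rscale_eq_scr)
  have "x = (\<Sum>v\<in>B. v *r (if v \<in> A then c v else 0))"
    unfolding A(2) using A(1) assms by (intro sum.mono_neutral_cong_left) auto
  then show "\<exists>c. x = (\<Sum>v\<in>B. v *r c v) \<and> True" by (intro exI[of _ "\<lambda>v. if v \<in> A then c v else 0"]) simp
qed (use assms in \<open>auto simp: right_span_def rscale_eq_scr\<close>)

lemma right_spanI: "finite B \<Longrightarrow> (\<Sum>v\<in>B. v *r c v) \<in> right_span B"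
  by (auto simp: right_span_finite)

lemma right_spanE:
  assumes "finite B" "x \<in> right_span B"
  obtains c where "x = (\<Sum>v\<in>B. v *r c v)"
  using assms by (auto simp: right_span_finite)

lemma right_span_superset:
  assumes "finite B" "b \<in> B"
  shows "b \<in> right_span B"
proof -
  have "(\<Sum>v\<in>B. v *r (if v = b then 1 else 0)) = (\<Sum>v\<in>B. if v = b then b else 0)"
    by (intro sum.cong) auto
  also have "\<dots> = b" using assms by (simp add: sum.delta)
  finally show ?thesis using right_spanI[OF assms(1), of "\<lambda>v. if v = b then 1 else 0"] by (simp only:)
qed

lemma subspace_right_span:
  assumes B: "finite B"
  shows "subspace (right_span B)"
  unfolding subspace_def
proof (intro conjI ballI allI)
  show "0 \<in> right_span B"
    using right_spanI[OF B, of "\<lambda>v. 0"] by simp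
next
  fix x y assume "x \<in> right_span B" "y \<in> right_span B"
  then obtain c d where "x = (\<Sum>v\<in>B. v *r c v)" "y = (\<Sum>v\<in>B. v *r d v)"
    by (elim right_spanE[OF B])
  then have "x + y = (\<Sum>v\<in>B. v *r (c v + d v))" by (simp add: scr_add_right sum.distrib)
  then show "x + y \<in> right_span B" using right_spanI[OF B] by (simp only:)
next
  fix r x assume "x \<in> right_span B"
  then obtain c where "x = (\<Sum>v\<in>B. v *r c v)" by (elim right_spanE[OF B])
  then have "r *\<^sub>R x = (\<Sum>v\<in>B. v *r (r *\<^sub>R c v))"
    by (simp add: scaleR_sum_right linear_scale[OF linear_scr])
  then show "r *\<^sub>R x \<in> right_span B" using right_spanI[OF B] by (simp only:)
qed

lemma scr_right_span:
  assumes B: "finite B" and x: "x \<in> right_span B"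
  shows "x *r d \<in> right_span B"
proof -
  obtain c where "x = (\<Sum>v\<in>B. v *r c v)"
    using x by (elim right_spanE[OF B])
  then have "x *r d = (\<Sum>v\<in>B. v *r (c v * d))" by (simp add: scr_sum scr_scr)
  then show ?thesis using right_spanI[OF B] by (simp only:)
qed

lemma right_span_insert:
  assumes B: "finite B" and b: "b \<notin> B"
  shows "right_span (insert b B) = {w + b *r c | w c. w \<in> right_span B}"
proof safe
  fix x assume "x \<in> right_span (insert b B)"
  moreover have "finite (insert b B)" using B by simp
  ultimately obtain c where "x = (\<Sum>v\<in>insert b B. v *r c v)" by (elim right_spanE)
  then have "x = (\<Sum>v\<in>B. v *r c v) + b *r c b" using B b by (simp add: add.commute)
  then show "\<exists>w c. x = w + b *r c \<and> w \<in> right_span B"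
    using right_spanI[OF B, of c] by blast
next
  fix w c assume "w \<in> right_span B"
  then obtain d where d: "w = (\<Sum>v\<in>B. v *r d v)" by (elim right_spanE[OF B])
  have "w + b *r c = (\<Sum>v\<in>insert b B. v *r (if v = b then c else d v))"
    using B b d by (simp add: add.commute) (rule sum.cong, auto)
  also have "\<dots> \<in> right_span (insert b B)" using B by (intro right_spanI) simp
  finally show "w + b *r c \<in> right_span (insert b B)" .
qed

lemma right_independentD: "right_independent B \<Longrightarrow> (\<Sum>v\<in>B. v *r c v) = 0 \<Longrightarrow> v \<in> B \<Longrightarrow> c v = 0"
  by (auto simp: right_independent_def rscale_eq_scr)

lemma right_independent_insert:
  assumes b: "b \<notin> B"
  shows "right_independent (insert b B) \<longleftrightarrow> right_independent B \<and> b \<notin> right_span B"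
proof (cases "finite B")
  case B: True
  have sum: "(\<Sum>v\<in>insert b B. v *r c v) = b *r c b + (\<Sum>v\<in>B. v *r c v)" for c
    using B b by simp
  show ?thesis
  proof safe
    assume ind: "right_independent (insert b B)"
    show "right_independent B"
      unfolding right_independent_def rscale_eq_scr
    proof (intro conjI B allI impI ballI)
      fix c v assume 0: "(\<Sum>v\<in>B. v *r c v) = 0" and v: "v \<in> B"
      let ?c = "\<lambda>v. if v = b then 0 else c v"
      have "(\<Sum>v\<in>B. v *r ?c v) = (\<Sum>v\<in>B. v *r c v)" using b by (intro sum.cong) auto
      then have "(\<Sum>v\<in>insert b B. v *r ?c v) = 0" using 0 by (simp add: sum)
      from right_independentD[OF ind this, of v] v have "?c v = 0" by simp
      then show "c v = 0" using b v by (auto split: if_splits)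
    qed
    assume "b \<in> right_span B"
    then obtain d where d: "b = (\<Sum>v\<in>B. v *r d v)" by (elim right_spanE[OF B])
    let ?c = "\<lambda>v. if v = b then - 1 else d v"
    have "(\<Sum>v\<in>B. v *r ?c v) = (\<Sum>v\<in>B. v *r d v)" using b by (intro sum.cong) auto
    then have "(\<Sum>v\<in>insert b B. v *r ?c v) = 0" by (simp add: sum scr_minus_right flip: d)
    from right_independentD[OF ind this, of b] have "?c b = 0" by simp
    then show False by simp
  next
    assume ind: "right_independent B" and nb: "b \<notin> right_span B"
    show "right_independent (insert b B)"
      unfolding right_independent_def rscale_eq_scr
    proof (intro conjI allI impI)
      show "finite (insert b B)" using B by simp
      fix c assume 0: "(\<Sum>v\<in>insert b B. v *r c v) = 0"
      then have e: "b *r c b = - (\<Sum>v\<in>B. v *r c v)" by (simp only: sum eq_neg_iff_add_eq_0)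
      have "c b = 0"
      proof (rule ccontr)
        assume cb: "c b \<noteq> 0"
        have "b *r c b \<in> right_span B"
          unfolding e by (intro subspace_neg subspace_right_span right_spanI B)
        then have "b *r c b *r inverse (c b) \<in> right_span B" by (rule scr_right_span[OF B])
        then show False using nb cb by (simp add: scr_scr)
      qed
      moreover have "(\<Sum>v\<in>B. v *r c v) = 0" using 0 calculation by (simp only: sum) simp
      then have "\<forall>v\<in>B. c v = 0" using right_independentD[OF ind] by blast
      ultimately show "\<forall>v\<in>insert b B. c v = 0" by simp
    qed
  qed
qed (simp add: right_independent_def)

lemma dim_right_span_insert:
  assumes "finite B" "b \<notin> right_span B"
  shows "dim (right_span (insert b B)) = dim (right_span B) + 4"
proof -
  have "b \<notin> B"
    using right_span_superset[OF assms(1)] assms(2) by blast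
  then have "right_span (insert b B) = {w + b *r c | w c. w \<in> right_span B}"
    by (rule right_span_insert[OF assms(1)])
  also have "dim \<dots> = dim (right_span B) + DIM(quat)"
    by (intro dim_add_line subspace_right_span scr_right_span assms)
  finally show ?thesis by (simp only: DIM_quat)
qed

lemma dim_right_span:
  assumes "right_independent B"
  shows "dim (right_span B) = 4 * card B"
proof -
  have "finite B" using assms by (simp add: right_independent_def)
  then show ?thesis
    using assms
  proof (induction B rule: finite_induct)
    case empty
    then show ?case by (simp add: right_span_finite)
  next
    case (insert b B)
    then show ?case using right_independent_insert[of b B] by (simp add: dim_right_span_insert)
  qed
qed

text \<open>Extend an independent set as long as it does not span; each new vector raises the real
  dimension by 4. This makes the choice in \<open>right_dim\<close> meaningful.\<close>

lemma exists_right_basis: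
  assumes W: "subspace W" "\<And>w c. w \<in> W \<Longrightarrow> w *r c \<in> W"
  shows "\<exists>B. right_independent B \<and> right_span B = W"
proof -
  have "\<exists>B'. right_independent B' \<and> right_span B' = W" if "right_independent B" "right_span B \<subseteq> W" for B
    using that
  proof (induction "dim W - dim (right_span B)" arbitrary: B rule: less_induct)
    case less
    have fB: "finite B" using less.prems by (simp add: right_independent_def)
    show ?case
    proof (cases "right_span B = W")
      case False
      then obtain b where b: "b \<in> W" "b \<notin> right_span B" using less.prems by blast
      have bB: "b \<notin> B"
        using right_span_superset[OF fB] b(2) by blast
      have sub: "right_span (insert b B) \<subseteq> W"
        unfolding right_span_insert[OF fB bB] using less.prems b W by (auto intro: subspace_add)
      have d: "dim (right_span (insert b B)) = dim (right_span B) + 4"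
        by (rule dim_right_span_insert[OF fB b(2)])
      have "dim (right_span (insert b B)) \<le> dim W" by (rule dim_subset[OF sub])
      then show ?thesis
        using d sub right_independent_insert[OF bB] less.prems b(2) by (intro less.hyps[of "insert b B"]) auto
    qed (use less.prems in blast)
  qed
  from this[of "{}"] show ?thesis
    using subspace_0[OF W(1)] by (simp add: right_independent_def right_span_finite)
qed

text \<open>The span of a right basis has real dimension 4 times its cardinality, so the rank is the
  same for whichever basis \<open>SOME\<close> picks.\<close>

lemma rdim_eq_quat_rank: "rdim X = 4 * quat_rank X"
proof -
  let ?W = "range (\<lambda>v. X *v v)"
  define B where "B = (SOME B. right_independent B \<and> right_span B = ?W)"
  have B: "right_independent B \<and> right_span B = ?W"
    unfolding B_def
    by (rule someI_ex, rule exists_right_basis[OF subspace_range_matrix]) (auto simp flip: matrix_vector_scr)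
  then have "rdim X = dim (right_span B)" by (simp add: rdim_def)
  also have "\<dots> = 4 * card B" using B by (intro dim_right_span) simp
  also have "card B = quat_rank X" by (simp only: quat_rank_def right_dim_def B_def)
  finally show ?thesis .
qed

lemma rdim_iff_quat_rank:
  "rdim X = DIM(quat) * s \<longleftrightarrow> quat_rank X = s" "rdim X \<le> DIM(quat) * s \<longleftrightarrow> quat_rank X \<le> s"
  by (simp_all add: rdim_eq_quat_rank DIM_quat)

theorem theorem3p5p4:
  shows
    "(\<forall>\<aa> e f h s.
        H1_system (sp_alg :: (real ^ ('l::finite + 'l) ^ ('l + 'l)) set) z_sp CARD('l) \<aa> e f h \<and>
        1 \<le> s \<and> s \<le> CARD('l) \<longrightarrow>
        holo_orbit sp_alg e s =
          {X \<in> sp_alg. lie_nilpotent sp_alg X \<and> non_negative J_sp X \<and> rank X = s} \<and>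
        connected (holo_orbit sp_alg e s) \<and>
        smooth_submanifold (holo_orbit sp_alg e s) \<and>
        closure (holo_orbit sp_alg e s) =
          {X \<in> sp_alg. lie_nilpotent sp_alg X \<and> non_negative J_sp X \<and> rank X \<le> s} \<and>
        semialgebraic (closure (holo_orbit sp_alg e s)))
   \<and> (CARD('p) \<ge> CARD('q) \<longrightarrow>
      (\<forall>\<aa> e f h s.
        H1_system (su_alg :: (complex ^ ('p::finite + 'q::finite) ^ ('p + 'q)) set) z_su CARD('q) \<aa> e f h \<and>
        1 \<le> s \<and> s \<le> CARD('q) \<longrightarrow>
        holo_orbit su_alg e s =
          {X \<in> su_alg. lie_nilpotent su_alg X \<and> non_negative J_su X \<and> rank X = s} \<and>
        connected (holo_orbit su_alg e s) \<and>
        smooth_submanifold (holo_orbit su_alg e s) \<and>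
        closure (holo_orbit su_alg e s) =
          {X \<in> su_alg. lie_nilpotent su_alg X \<and> non_negative J_su X \<and> rank X \<le> s} \<and>
        semialgebraic (closure (holo_orbit su_alg e s))))
   \<and> (CARD('n) > 2 \<longrightarrow>
      (\<forall>c \<aa> e f h s.
        qre c = 0 \<and> norm c = 1 \<and>
        H1_system (so_star_alg c :: (quat ^ 'n ^ 'n) set) (z_so c) (CARD('n) div 2) \<aa> e f h \<and>
        1 \<le> s \<and> s \<le> CARD('n) div 2 \<longrightarrow>
        holo_orbit (so_star_alg c) e s =
          {X \<in> so_star_alg c. lie_nilpotent (so_star_alg c) X \<and>
             non_negative (J_so c) X \<and> quat_rank X = s} \<and>
        connected (holo_orbit (so_star_alg c) e s) \<and>
        smooth_submanifold (holo_orbit (so_star_alg c) e s) \<and>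
        closure (holo_orbit (so_star_alg c) e s) =
          {X \<in> so_star_alg c. lie_nilpotent (so_star_alg c) X \<and>
             non_negative (J_so c) X \<and> quat_rank X \<le> s} \<and>
        semialgebraic (closure (holo_orbit (so_star_alg c) e s))))"
proof (rule conjI[OF _ conjI]; intro allI impI; elim conjE)
  fix \<aa> :: "(real ^ ('l + 'l) ^ ('l + 'l)) set" and e f h s
  assume H: "H1_system sp_alg z_sp CARD('l) \<aa> e f h" "1 \<le> s" "s \<le> CARD('l)"
  from hermitian_type_rank.holo_orbit_characterisation[OF hermitian_type_rank_sp H, unfolded rdim_iff_rank]
  show "holo_orbit sp_alg e s = {X \<in> sp_alg. lie_nilpotent sp_alg X \<and> non_negative J_sp X \<and> rank X = s} \<and>
    connected (holo_orbit sp_alg e s) \<and> smooth_submanifold (holo_orbit sp_alg e s) \<and>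
    closure (holo_orbit sp_alg e s) =
      {X \<in> sp_alg. lie_nilpotent sp_alg X \<and> non_negative J_sp X \<and> rank X \<le> s} \<and>
    semialgebraic (closure (holo_orbit sp_alg e s))" .
next
  fix \<aa> :: "(complex ^ ('p + 'q) ^ ('p + 'q)) set" and e f h s
  assume H: "H1_system su_alg z_su CARD('q) \<aa> e f h" "1 \<le> s" "s \<le> CARD('q)"
  from hermitian_type_rank.holo_orbit_characterisation[OF hermitian_type_rank_su H, unfolded rdim_iff_complex_rank]
  show "holo_orbit su_alg e s = {X \<in> su_alg. lie_nilpotent su_alg X \<and> non_negative J_su X \<and> rank X = s} \<and>
    connected (holo_orbit su_alg e s) \<and> smooth_submanifold (holo_orbit su_alg e s) \<and>
    closure (holo_orbit su_alg e s) =
      {X \<in> su_alg. lie_nilpotent su_alg X \<and> non_negative J_su X \<and> rank X \<le> s} \<and>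
    semialgebraic (closure (holo_orbit su_alg e s))" .
next
  fix c and \<aa> :: "(quat ^ 'n ^ 'n) set" and e f h s
  assume c: "qre c = 0" "norm c = 1"
    and H: "H1_system (so_star_alg c) (z_so c) (CARD('n) div 2) \<aa> e f h" "1 \<le> s" "s \<le> CARD('n) div 2"
  from hermitian_type_rank.holo_orbit_characterisation[OF hermitian_type_rank_so[OF c] H, unfolded rdim_iff_quat_rank]
  show "holo_orbit (so_star_alg c) e s = {X \<in> so_star_alg c. lie_nilpotent (so_star_alg c) X \<and>
      non_negative (J_so c) X \<and> quat_rank X = s} \<and>
    connected (holo_orbit (so_star_alg c) e s) \<and> smooth_submanifold (holo_orbit (so_star_alg c) e s) \<and>
    closure (holo_orbit (so_star_alg c) e s) = {X \<in> so_star_alg c. lie_nilpotent (so_star_alg c) X \<and>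
      non_negative (J_so c) X \<and> quat_rank X \<le> s} \<and>
    semialgebraic (closure (holo_orbit (so_star_alg c) e s))" .
qed

end
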